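(* Consider the two-stage stochastic linear optimization problem, the sample robust problem, and its multi-policy approximation defined in the context, and suppose that the following conditions hold: [A1] $\Pi=\mathcal{L}$ (the space of linear decision rules) and $\epsilon_N\to0$ as $N\to\infty$. [A2] $v^*$ is finite and $\mathbb{E}[\|\boldsymbol\xi\|]<\infty$. [A3] The set of optimal first-stage decisions of the stochastic problem $\min_{\mathbf{x}\in\mathbb{R}^n}V^*(\mathbf{x})$ is nonempty and bounded. [A4] There exist a first-stage decision $\mathbf{x}\in\mathbb{R}^n$ and a radius $\epsilon>0$ such that, for all $\hat{\boldsymbol\zeta}\in\Xi$, there exists a decision rule $\mathbf{y}^{\hat{\boldsymbol\zeta}}(\cdot)\in\mathcal{L}$ such that $\mathbf{T}\mathbf{x}+\mathbf{W}\mathbf{y}^{\hat{\boldsymbol\zeta}}(\boldsymbol\zeta)\ge\mathbf{h}(\boldsymbol\zeta)$ for all $\boldsymbol\zeta\in B(\hat{\boldsymbol\zeta},\epsilon)\cap\Xi$. Then $$\lim_{N\to\infty}\hat v_N^{\mathrm{SRO}}=\lim_{N\to\infty}\hat v_N^{\mathrm{MP}}=v^*\quad\text{almost surely.}$$ Moreover, let $\hat{\mathbf{x}}_N^{\mathrm{SRO}}$ and $\hat{\mathbf{x}}_N^{\mathrm{MP}}$ be optimal first-stage decisions for the sample robust problem and for the multi-policy approximation, respectively (i.e. minimizers of $\hat V_N^{\mathrm{SRO}}$ and $\hat V_N^{\mathrm{MP}}$). Then any accumulation point of $\{\hat{\mathbf{x}}_N^{\mathrm{SRO}}\}_{N\in\mathbb{N}}$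 or $\{\hat{\mathbf{x}}_N^{\mathrm{MP}}\}_{N\in\mathbb{N}}$ is almost surely an optimal first-stage decision for the stochastic problem $\min_{\mathbf{x}\in\mathbb{R}^n}V^*(\mathbf{x})$.
   Context: Data: $\mathbf{c}\in\mathbb{R}^n$, $\mathbf{q}\in\mathbb{R}^r$, $\mathbf{T}\in\mathbb{R}^{m\times n}$, $\mathbf{W}\in\mathbb{R}^{m\times r}$, and an affine function $\mathbf{h}(\boldsymbol\zeta)=\mathbf{h}^0+\mathbf{H}\boldsymbol\zeta\in\mathbb{R}^m$ of $\boldsymbol\zeta\in\mathbb{R}^d$. $\Xi=\{\boldsymbol\zeta\in\mathbb{R}^d:\mathbf{G}\boldsymbol\zeta\ge\mathbf{g}^0\}$ is a polyhedron. $\boldsymbol\xi$ is a random vector in $\mathbb{R}^d$ with $\mathbb{P}(\boldsymbol\xi\in\Xi)=1$, and $\boldsymbol\xi^1,\boldsymbol\xi^2,\dots$ are independent samples with the same distribution as $\boldsymbol\xi$. $\|\cdot\|$ is an $\ell_p$-norm, $B(\hat{\boldsymbol\zeta},\epsilon)=\{\boldsymbol\zeta:\|\boldsymbol\zeta-\hat{\boldsymbol\zeta}\|\le\epsilon\}$, $\epsilon_N\ge0$, and $\mathcal{U}_N^i=B(\boldsymbol\xi^i,\epsilon_N)\cap\Xi$ for $i=1,\dots,N$. Second-stage cost: $Q(\mathbf{x},\boldsymbol\zeta)=\inf\{\mathbf{q}^\top\mathbf{y}:\mathbf{y}\in\mathbb{R}^r,\ \mathbf{T}\mathbf{x}+\mathbf{W}\mathbf{y}\ge\mathbf{h}(\boldsymbol\zeta)\}$,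 equal to $+\infty$ if infeasible. Stochastic problem: $V^*(\mathbf{x})=\mathbf{c}^\top\mathbf{x}+\mathbb{E}[Q(\mathbf{x},\boldsymbol\xi)]$ and $v^*=\inf_{\mathbf{x}\in\mathbb{R}^n}V^*(\mathbf{x})$. Sample robust problem: $\hat V_N^{\mathrm{SRO}}(\mathbf{x})=\mathbf{c}^\top\mathbf{x}+\frac1N\sum_{i=1}^N\sup_{\boldsymbol\zeta\in\mathcal{U}_N^i}Q(\mathbf{x},\boldsymbol\zeta)$ and $\hat v_N^{\mathrm{SRO}}=\inf_{\mathbf{x}\in\mathbb{R}^n}\hat V_N^{\mathrm{SRO}}(\mathbf{x})$. Linear decision rules: $\mathcal{L}$ is the set of functions $\mathbf{y}(\cdot):\mathbb{R}^d\to\mathbb{R}^r$ of the form $\mathbf{y}(\boldsymbol\zeta)=\mathbf{y}^0+\mathbf{Y}\boldsymbol\zeta$ with $\mathbf{y}^0\in\mathbb{R}^r$, $\mathbf{Y}\in\mathbb{R}^{r\times d}$. Multi-policy approximation with policy space $\Pi$ (a set of functions $\mathbb{R}^d\to\mathbb{R}^r$): $\hat V_N^{\mathrm{MP}}(\mathbf{x})$ is the infimum of $\mathbf{c}^\top\mathbf{x}+\frac1N\sum_{i=1}^N\sup_{\boldsymbol\zeta\in\mathcal{U}_N^i}\mathbf{q}^\top\mathbf{y}^i(\boldsymbol\zeta)$ over $\mathbf{y}^1(\cdot),\dots,\mathbf{y}^N(\cdot)\in\Pi$ satisfying $\mathbf{T}\mathbf{x}+\mathbf{W}\mathbf{y}^i(\boldsymbol\zeta)\ge\mathbf{h}(\boldsymbol\zeta)$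 for all $\boldsymbol\zeta\in\mathcal{U}_N^i$ and all $i=1,\dots,N$; it is $+\infty$ if there are no such policies. $\hat v_N^{\mathrm{MP}}=\inf_{\mathbf{x}\in\mathbb{R}^n}\hat V_N^{\mathrm{MP}}(\mathbf{x})$. *)

theory Defs
  imports "HOL-Probability.Probability"
begin

definition lp_norm :: "ereal \<Rightarrow> real ^ 'n \<Rightarrow> real" where
  "lp_norm p x =
     (if p = \<infinity> then infnorm x
      else (\<Sum>i\<in>UNIV. \<bar>x $ i\<bar> powr real_of_ereal p) powr (1 / real_of_ereal p))"

definition lp_ball :: "ereal \<Rightarrow> real ^ 'n \<Rightarrow> real \<Rightarrow> (real ^ 'n) set" where
  "lp_ball p z e = {\<zeta>. lp_norm p (\<zeta> - z) \<le> e}"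

text \<open>The order on vectors is the componentwise one. The infimum of the empty set in
  \<^typ>\<open>ereal\<close> is \<open>\<infinity>\<close>, so an infeasible second stage costs \<open>\<infinity>\<close>.\<close>

definition second_stage_cost ::
  "real ^ 'r \<Rightarrow> real ^ 'n ^ 'm \<Rightarrow> real ^ 'r ^ 'm \<Rightarrow> (real ^ 'd \<Rightarrow> real ^ 'm)
     \<Rightarrow> real ^ 'n \<Rightarrow> real ^ 'd \<Rightarrow> ereal" where
  "second_stage_cost q T W h x \<zeta> = (INF y\<in>{y. T *v x + W *v y \<ge> h \<zeta>}. ereal (q \<bullet> y))"

text \<open>Expectation of an extended-real-valued function, as the integral of the positive part minus
  that of the negative part. In \<^typ>\<open>ereal\<close>, \<open>\<infinity> - \<infinity> = \<infinity>\<close>: if both integrals are infinite the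
  expectation is \<open>\<infinity>\<close>, the usual convention for minimisation.\<close>

definition ereal_expectation :: "'w measure \<Rightarrow> ('w \<Rightarrow> ereal) \<Rightarrow> ereal" where
  "ereal_expectation M f =
     enn2ereal (\<integral>\<^sup>+\<omega>. e2ennreal (f \<omega>) \<partial>M) - enn2ereal (\<integral>\<^sup>+\<omega>. e2ennreal (- f \<omega>) \<partial>M)"

definition stochastic_cost ::
  "'w measure \<Rightarrow> ('w \<Rightarrow> real ^ 'd) \<Rightarrow> real ^ 'n \<Rightarrow> real ^ 'r \<Rightarrow> real ^ 'n ^ 'm \<Rightarrow> real ^ 'r ^ 'm
     \<Rightarrow> (real ^ 'd \<Rightarrow> real ^ 'm) \<Rightarrow> real ^ 'n \<Rightarrow> ereal" where
  "stochastic_cost M \<xi> c q T W h x =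
     ereal (c \<bullet> x) + ereal_expectation M (\<lambda>\<omega>. second_stage_cost q T W h x (\<xi> \<omega>))"

text \<open>Below, \<open>U i\<close> is the uncertainty set around the \<open>i\<close>-th of \<open>N\<close> samples.\<close>

definition sample_robust_cost ::
  "real ^ 'n \<Rightarrow> real ^ 'r \<Rightarrow> real ^ 'n ^ 'm \<Rightarrow> real ^ 'r ^ 'm \<Rightarrow> (real ^ 'd \<Rightarrow> real ^ 'm)
     \<Rightarrow> nat \<Rightarrow> (nat \<Rightarrow> (real ^ 'd) set) \<Rightarrow> real ^ 'n \<Rightarrow> ereal" where
  "sample_robust_cost c q T W h N U x =
     ereal (c \<bullet> x)
       + ereal (1 / real N) * (\<Sum>i = 1..N. SUP \<zeta>\<in>U i. second_stage_cost q T W h x \<zeta>)"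

definition multi_policy_cost ::
  "(real ^ 'd \<Rightarrow> real ^ 'r) set \<Rightarrow> real ^ 'n \<Rightarrow> real ^ 'r \<Rightarrow> real ^ 'n ^ 'm \<Rightarrow> real ^ 'r ^ 'm
     \<Rightarrow> (real ^ 'd \<Rightarrow> real ^ 'm) \<Rightarrow> nat \<Rightarrow> (nat \<Rightarrow> (real ^ 'd) set) \<Rightarrow> real ^ 'n \<Rightarrow> ereal" where
  "multi_policy_cost Pol c q T W h N U x =
     (INF y\<in>{y. \<forall>i\<in>{1..N}. y i \<in> Pol \<and> (\<forall>\<zeta>\<in>U i. T *v x + W *v y i \<zeta> \<ge> h \<zeta>)}.
        ereal (c \<bullet> x) + ereal (1 / real N) * (\<Sum>i = 1..N. SUP \<zeta>\<in>U i. ereal (q \<bullet> y i \<zeta>)))"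

definition linear_decision_rules :: "(real ^ 'd \<Rightarrow> real ^ 'r) set" where
  "linear_decision_rules = {y. \<exists>(y0 :: real ^ 'r) (Y :: real ^ 'd ^ 'r). y = (\<lambda>\<zeta>. y0 + Y *v \<zeta>)}"

definition optimal_decisions :: "(real ^ 'n \<Rightarrow> ereal) \<Rightarrow> (real ^ 'n) set" where
  "optimal_decisions V = {x. is_arg_min V (\<lambda>_. True) x}"

definition accumulation_point :: "(nat \<Rightarrow> 'a :: topological_space) \<Rightarrow> 'a \<Rightarrow> bool" where
  "accumulation_point s a \<longleftrightarrow> (\<exists>k :: nat \<Rightarrow> nat. strict_mono k \<and> (s \<circ> k) \<longlonglongrightarrow> a)"

end

(* By linear programming duality the second-stage cost is the maximum of finitely many linear functions
   of h(zeta) - T x where finitely many linear inequalities (dual rays) hold, and infinity elsewhere.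
   Hence the sample average approximation is a convex function, Lipschitz uniformly in N, restricted to
   a decreasing sequence of closed convex sets, and by the strong law of large numbers (Etemadi's
   proof) both parts converge almost surely to those of the stochastic cost. It is a lower bound for
   the sample robust cost, which is a lower bound for the multi-policy cost.

   For the matching upper bound, an optimal decision is moved slightly towards the decision of A4. A
   sample point is replaced by a nearby point z of the support whose constraints are either active or
   have slack much larger than the radius; near z the support looks like one of finitely many cones,
   and for each of these the admissible data of a linear rule form a polyhedral cone. This yields linear
   rules whose cost exceeds that of the sample by at most C (epsilon_N + 1/N), with C independent of the
   sample. Boundedness of the optimal set and convexity then give convergence of the minimal values. *)
theory Submission
  imports Defs
begin

section \<open>Polyhedral cones and linear programs\<close>

text \<open>Three obstacles shape the argument. An optimal decision is only known to be feasible
  almost surely, so points of the support arbitrarily close to a sample may be infeasible for it,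
  and its robust cost may be infinite for every positive radius; hence the move towards the decision
  of A4. The rules of A4 come without any bound: over an unbounded support their coefficients and
  costs may grow, so averaging them with optimal recourse gives no uniform estimate. They merely
  certify that certain linear systems are solvable, and the cost is read off the rows of a fixed
  cone. For these rows to be finitely many, the shape of the support near a sample must range over a
  finite list, which fails when a constraint is nearly but not quite active; well-separated points
  cure this. The uniform constants arise in one way: the data for which a linear system with an
  existential quantifier is solvable form a polyhedral cone, and a constant is computed from its
  finitely many rows.\<close>

definition polyhedral_cone :: "'a::euclidean_space set \<Rightarrow> bool" where
  "polyhedral_cone S \<longleftrightarrow> polyhedron S \<and> convex_cone S"

text \<open>A linear functional is the inner product with its adjoint at 1, which turns the
  inequality into a halfspace through the origin, or into the whole space when
  \<open>f = g\<close>.\<close>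

lemma polyhedral_cone_le:
  fixes f g :: "'a::euclidean_space \<Rightarrow> real"
  assumes "linear f" "linear g"
  shows "polyhedral_cone {x. f x \<le> g x}"
proof -
  have l: "linear (\<lambda>x. f x - g x)"
    using assms by (rule linear_compose_sub)
  have "f x - g x = adjoint (\<lambda>x. f x - g x) (1::real) \<bullet> x" for x
    using adjoint_works[OF l, of x "1::real"] by (simp add: inner_commute)
  then have "f x \<le> g x \<longleftrightarrow> adjoint (\<lambda>x. f x - g x) (1::real) \<bullet> x \<le> 0" for x
    by (metis diff_le_0_iff_le)
  then have "{x. f x \<le> g x} = {x. adjoint (\<lambda>x. f x - g x) (1::real) \<bullet> x \<le> 0}"
    by blast
  then show ?thesis
    by (simp add: polyhedral_cone_def polyhedron_halfspace_le convex_cone_halfspace_le)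
qed

lemma polyhedral_cone_Inter:
  "finite F \<Longrightarrow> (\<And>S. S \<in> F \<Longrightarrow> polyhedral_cone S) \<Longrightarrow> polyhedral_cone (\<Inter>F)"
  by (simp add: polyhedral_cone_def convex_cone_Inter)

lemma polyhedral_cone_conj:
  assumes "polyhedral_cone {x. P x}" "polyhedral_cone {x. Q x}"
  shows "polyhedral_cone {x. P x \<and> Q x}"
proof -
  have "{x. P x \<and> Q x} = \<Inter>{{x. P x}, {x. Q x}}"
    by auto
  then show ?thesis
    using polyhedral_cone_Inter[of "{{x. P x}, {x. Q x}}"] assms by auto
qed

lemma polyhedral_cone_ball:
  assumes "finite I" "\<And>i. i \<in> I \<Longrightarrow> polyhedral_cone {x. P i x}"
  shows "polyhedral_cone {x. \<forall>i\<in>I. P i x}"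
proof -
  have "{x. \<forall>i\<in>I. P i x} = \<Inter>((\<lambda>i. {x. P i x}) ` I)"
    by auto
  then show ?thesis
    using polyhedral_cone_Inter[of "(\<lambda>i. {x. P i x}) ` I"] assms by auto
qed

lemma polyhedral_cone_all:
  assumes "\<And>i::'i::finite. polyhedral_cone {x. P i x}"
  shows "polyhedral_cone {x. \<forall>i. P i x}"
  using polyhedral_cone_ball[of "UNIV :: 'i set" P] assms by simp

text \<open>Reduction to bounded sets: a cone is generated by its part in the unit box, and for a
  polyhedral cone that part is a polytope.\<close>

lemma polyhedral_cone_eq_hull:
  fixes S :: "'a::euclidean_space set"
  assumes "polyhedral_cone S"
  shows "S = convex_cone hull (S \<inter> cbox (- One) One)"
proof
  show "convex_cone hull (S \<inter> cbox (- One) One) \<subseteq> S"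
    using assms by (intro hull_minimal) (auto simp: polyhedral_cone_def)
  show "S \<subseteq> convex_cone hull (S \<inter> cbox (- One) One)"
  proof
    fix x assume x: "x \<in> S"
    \<comment> \<open>The summand 1 keeps \<open>t\<close> positive at \<open>x = 0\<close>;
      division by \<open>t\<close> brings every coordinate into [-1, 1].\<close>
    define t where "t = norm x + 1"
    have t: "t > 0" by (simp add: t_def add_nonneg_pos)
    have "x /\<^sub>R t \<in> S"
      using x assms t by (auto simp: polyhedral_cone_def intro!: convex_cone_scaleR)
    moreover have "x /\<^sub>R t \<in> cbox (- One) One"
    proof -
      have "- 1 \<le> (x \<bullet> b) / t \<and> (x \<bullet> b) / t \<le> 1" if "b \<in> Basis" for b
        using Basis_le_norm[OF that, of x] t by (simp add: t_def field_simps abs_le_iff)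
      then show ?thesis
        by (auto simp: mem_box divide_inverse_commute)
    qed
    ultimately have "x /\<^sub>R t \<in> convex_cone hull (S \<inter> cbox (- One) One)"
      by (simp add: hull_inc)
    then have "t *\<^sub>R (x /\<^sub>R t) \<in> convex_cone hull (S \<inter> cbox (- One) One)"
      by (rule convex_cone_hull_mul[OF _ less_imp_le[OF t]])
    moreover have "t *\<^sub>R (x /\<^sub>R t) = x"
      using t by simp
    ultimately show "x \<in> convex_cone hull (S \<inter> cbox (- One) One)"
      by metis
  qed
qed

text \<open>Takes the place of Fourier-Motzkin elimination: linear maps send polytopes to polytopes
  and commute with cone hulls, and the cone generated by a polytope is polyhedral.\<close>

lemma polyhedral_cone_linear_image:
  fixes f :: "'a::euclidean_space \<Rightarrow> 'b::euclidean_space"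
  assumes "polyhedral_cone S" "linear f"
  shows "polyhedral_cone (f ` S)"
proof -
  have "polytope (S \<inter> cbox (- One) One)"
    using assms(1)
    by (metis Int_commute polyhedral_cone_def polytope_Int_polyhedron polytope_interval)
  then have "polytope (f ` (S \<inter> cbox (- One) One))"
    using assms(2) by (simp add: polytope_linear_image)
  then have "polyhedron (convex_cone hull (f ` (S \<inter> cbox (- One) One)))"
    by (rule polyhedron_convex_cone_hull_polytope)
  also have "convex_cone hull (f ` (S \<inter> cbox (- One) One)) = f ` S"
    using polyhedral_cone_eq_hull[OF assms(1)] convex_cone_hull_linear_image[OF assms(2)] by metis
  finally show ?thesis
    using assms by (simp add: polyhedral_cone_def convex_cone_linear_image)
qed

text \<open>Existential quantification is projection. With the preceding closure rules,
  polyhedrality can be read off from the shape of the formula that defines a set.\<close>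

lemma polyhedral_cone_ex:
  fixes P :: "'a::euclidean_space \<Rightarrow> 'b::euclidean_space \<Rightarrow> bool"
  assumes "polyhedral_cone {z. P (fst z) (snd z)}"
  shows "polyhedral_cone {x. \<exists>y. P x y}"
proof -
  have "{x. \<exists>y. P x y} = fst ` {z. P (fst z) (snd z)}"
    by (auto simp: image_iff)
  then show ?thesis
    using polyhedral_cone_linear_image[OF assms linear_fst] by simp
qed

text \<open>Every halfspace containing a cone can be tightened to its parallel through the origin:
  the right-hand sides are nonnegative because the origin lies in \<open>S\<close>, and a positive
  value of a row on \<open>S\<close> would exceed them after scaling.\<close>

lemma polyhedral_cone_rows:
  fixes S :: "'a::euclidean_space set"
  assumes "polyhedral_cone S"
  obtains A where "finite A" "S = {x. \<forall>a\<in>A. a \<bullet> x \<le> 0}"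
proof -
  obtain F where F: "finite F" "S = \<Inter>F" "\<forall>h\<in>F. \<exists>a b. a \<noteq> 0 \<and> h = {x. a \<bullet> x \<le> b}"
    using assms unfolding polyhedral_cone_def polyhedron_def by blast
  then obtain a b where ab: "\<And>h. h \<in> F \<Longrightarrow> h = {x. a h \<bullet> x \<le> b h}"
    by metis
  have cone: "convex_cone S" using assms by (simp add: polyhedral_cone_def)
  have b: "b h \<ge> 0" if "h \<in> F" for h
    using convex_cone_contains_0[OF cone] F(2) ab[OF that] that by (metis (no_types, lifting) InterD inner_zero_right mem_Collect_eq)
  have a: "a h \<bullet> x \<le> 0" if h: "h \<in> F" and x: "x \<in> S" for h x
  proof (rule ccontr)
    assume "\<not> a h \<bullet> x \<le> 0"
    then have pos: "a h \<bullet> x > 0" by simp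
    define t where "t = (b h + 1) / (a h \<bullet> x)"
    have "t \<ge> 0" using pos b[OF h] by (simp add: t_def)
    then have "t *\<^sub>R x \<in> h"
      using convex_cone_scaleR[OF cone _ x] F(2) h by blast
    then have "a h \<bullet> (t *\<^sub>R x) \<le> b h" using ab[OF h] by blast
    then show False using pos by (simp add: t_def)
  qed
  have "S = {x. \<forall>v\<in>a ` F. v \<bullet> x \<le> 0}"
  proof (intro equalityI subsetI CollectI ballI)
    fix x v assume "x \<in> S" "v \<in> a ` F"
    then show "v \<bullet> x \<le> 0" using a by auto
  next
    fix x assume "x \<in> {x. \<forall>v\<in>a ` F. v \<bullet> x \<le> 0}"
    then have "x \<in> h" if "h \<in> F" for h
      using ab[OF that] b[OF that] that by fastforce
    then show "x \<in> S" using F(2) by blast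
  qed
  then show thesis using that F(1) by blast
qed

text \<open>The hypothesis \<open>(0, 1) \<in> S\<close> forces the last coefficient of each row to
  be nonpositive. Rows with last coefficient zero become the conditions \<open>R\<close> on
  \<open>x\<close>; the others, after division, become the lower bounds \<open>L\<close> on
  \<open>t\<close>.\<close>

lemma polyhedral_cone_epigraph:
  fixes S :: "('a::euclidean_space \<times> real) set"
  assumes "polyhedral_cone S" "(0, 1) \<in> S"
  obtains R L where "finite R" "finite L"
    "\<And>x t. (x, t) \<in> S \<longleftrightarrow> (\<forall>r\<in>R. r \<bullet> x \<le> 0) \<and> (\<forall>l\<in>L. l \<bullet> x \<le> t)"
proof -
  obtain A where A: "finite A" "S = {x. \<forall>a\<in>A. a \<bullet> x \<le> 0}"
    using polyhedral_cone_rows[OF assms(1)] by blast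
  have neg: "snd a \<le> 0" if "a \<in> A" for a
    using assms(2) A(2) that by (auto simp: inner_prod_def)
  define R where "R = fst ` {a\<in>A. snd a = 0}"
  define L where "L = (\<lambda>a. fst a /\<^sub>R (- snd a)) ` {a\<in>A. snd a \<noteq> 0}"
  have row: "a \<bullet> (x, t) \<le> 0 \<longleftrightarrow> (fst a /\<^sub>R (- snd a)) \<bullet> x \<le> t" if "a \<in> A" "snd a \<noteq> 0" for a x t
  proof -
    have "snd a < 0" using neg[OF that(1)] that(2) by linarith
    then show ?thesis
      by (auto simp: inner_prod_def field_simps)
  qed
  have "(x, t) \<in> S \<longleftrightarrow> (\<forall>r\<in>R. r \<bullet> x \<le> 0) \<and> (\<forall>l\<in>L. l \<bullet> x \<le> t)" for x t
  proof -
    have "(x, t) \<in> S \<longleftrightarrow> (\<forall>a\<in>A. (snd a = 0 \<longrightarrow> a \<bullet> (x, t) \<le> 0) \<and> (snd a \<noteq> 0 \<longrightarrow> a \<bullet> (x, t) \<le> 0))"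
      using A(2) by auto
    also have "\<dots> \<longleftrightarrow> (\<forall>a\<in>A. (snd a = 0 \<longrightarrow> fst a \<bullet> x \<le> 0) \<and> (snd a \<noteq> 0 \<longrightarrow> (fst a /\<^sub>R (- snd a)) \<bullet> x \<le> t))"
      using row by (simp add: inner_prod_def)
    finally show ?thesis
      unfolding R_def L_def by blast
  qed
  moreover have "finite R" "finite L" using A(1) by (auto simp: R_def L_def)
  ultimately show thesis using that by blast
qed

section \<open>Value function of a linear program\<close>

lemma linear_mult_vec_nth:
  "linear f \<Longrightarrow> linear (\<lambda>x. (A *v f x) $ i)" for A :: "real ^ 'n ^ 'm"
  by (auto intro!: linearI simp: linear_add linear_scale matrix_vector_right_distrib
      matrix_vector_mult_scaleR)

lemma linear_vec_nth_compose: "linear f \<Longrightarrow> linear (\<lambda>x. f x $ i)" for f :: "'a::real_vector \<Rightarrow> real ^ 'n"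
  by (auto intro!: linearI simp: linear_add linear_scale)

text \<open>Duality without a dual program: the pairs of right-hand side and cost bound form an
  epigraph, so \<open>R\<close> plays the part of the dual rays and \<open>L\<close> that of the
  dual solutions. \<open>L\<close> may be empty; the program is then unbounded below wherever it is
  feasible.\<close>

lemma linear_program_value:
  fixes W :: "real ^ 'r ^ 'm" and q :: "real ^ 'r"
  obtains R L :: "(real ^ 'm) set" where "finite R" "finite L"
    "\<And>b t. (\<exists>y. b \<le> W *v y \<and> q \<bullet> y \<le> t) \<longleftrightarrow> (\<forall>r\<in>R. r \<bullet> b \<le> 0) \<and> (\<forall>l\<in>L. l \<bullet> b \<le> t)"
proof -
  let ?S = "{x :: (real ^ 'm) \<times> real. \<exists>y. (\<forall>i. fst x $ i \<le> (W *v y) $ i) \<and> q \<bullet> y \<le> snd x}"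
  have "polyhedral_cone ?S"
    by (intro polyhedral_cone_ex polyhedral_cone_conj polyhedral_cone_all polyhedral_cone_le
        linear_mult_vec_nth linear_vec_nth_compose)
      (auto intro!: linearI simp: inner_add_right)
  moreover have "(0, 1) \<in> ?S" by (auto intro!: exI[of _ 0])
  ultimately show thesis
    using polyhedral_cone_epigraph[of ?S] that by (auto simp: less_eq_vec_def)
qed

section \<open>Comparison of \<open>lp_norm\<close> with the Euclidean norm\<close>

lemma lp_norm_bounds:
  fixes x :: "real ^ 'n"
  assumes "p \<ge> 1"
  shows "norm x \<le> real CARD('n) * lp_norm p x" "lp_norm p x \<le> real CARD('n) * norm x"
proof -
  have n1: "1 \<le> real CARD('n)" by (simp add: Suc_le_eq)
  \<comment> \<open>Bounding single coordinates leads to the first claim through the sum of absolute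
    values. The crude constant \<open>CARD('n)\<close> serves all \<open>p\<close> at once,
    \<open>p = \<infinity>\<close> included.\<close>
  have "(\<forall>i. \<bar>x $ i\<bar> \<le> lp_norm p x) \<and> lp_norm p x \<le> real CARD('n) * norm x"
  proof (cases "p = \<infinity>")
    case True
    have "\<bar>x $ i\<bar> \<le> infnorm x" for i
      using component_le_infnorm_cart[of x i] by simp
    moreover have "infnorm x \<le> real CARD('n) * norm x"
      using infnorm_le_norm[of x] n1 mult_right_mono[OF n1, of "norm x"] by simp
    ultimately show ?thesis using True by (simp add: lp_norm_def)
  next
    case False
    then obtain s where s: "p = ereal s" "s \<ge> 1"
      using assms by (cases p) (auto simp: one_ereal_def)
    have lp: "lp_norm p x = (\<Sum>i\<in>UNIV. \<bar>x $ i\<bar> powr s) powr (1 / s)"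
      using s by (simp add: lp_norm_def)
    have "\<bar>x $ i\<bar> \<le> lp_norm p x" for i
    proof -
      have "\<bar>x $ i\<bar> = (\<bar>x $ i\<bar> powr s) powr (1 / s)"
        using s by (simp add: powr_powr)
      also have "\<dots> \<le> (\<Sum>i\<in>UNIV. \<bar>x $ i\<bar> powr s) powr (1 / s)"
        using s by (intro powr_mono2 member_le_sum) auto
      finally show ?thesis using lp by simp
    qed
    moreover have "lp_norm p x \<le> real CARD('n) * norm x"
    proof -
      have "(\<Sum>i\<in>UNIV. \<bar>x $ i\<bar> powr s) \<le> (\<Sum>i\<in>(UNIV::'n set). norm x powr s)"
        using s by (intro sum_mono powr_mono2) (auto simp: component_le_norm_cart)
      then have "lp_norm p x \<le> (real CARD('n) * norm x powr s) powr (1 / s)"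
        unfolding lp using s by (intro powr_mono2) (auto intro: sum_nonneg)
      also have "\<dots> = real CARD('n) powr (1 / s) * norm x"
        using s by (simp add: powr_mult powr_powr)
      also have "real CARD('n) powr (1 / s) \<le> real CARD('n) powr 1"
        using s n1 by (intro powr_mono) auto
      finally show ?thesis by (simp add: mult_right_mono)
    qed
    ultimately show ?thesis by blast
  qed
  then have 1: "\<And>i. \<bar>x $ i\<bar> \<le> lp_norm p x" and 2: "lp_norm p x \<le> real CARD('n) * norm x"
    by blast+
  have "norm x \<le> (\<Sum>i\<in>UNIV. \<bar>x $ i\<bar>)" by (rule norm_le_l1_cart)
  also have "\<dots> \<le> (\<Sum>i\<in>(UNIV::'n set). lp_norm p x)" by (intro sum_mono 1)
  finally show "norm x \<le> real CARD('n) * lp_norm p x" by simp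
  show "lp_norm p x \<le> real CARD('n) * norm x" by (rule 2)
qed

lemma lp_norm_zero [simp]: "p \<ge> 1 \<Longrightarrow> lp_norm p (0 :: real ^ 'n) = 0"
  using lp_norm_bounds[of p "0 :: real ^ 'n"] by (simp add: zero_le_mult_iff)

section \<open>Points of a polyhedron with well-separated slacks\<close>

definition polyhedron_face :: "real ^ 'd ^ 'k \<Rightarrow> real ^ 'k \<Rightarrow> 'k set \<Rightarrow> (real ^ 'd) set" where
  "polyhedron_face G g I = {z. g \<le> G *v z \<and> (\<forall>j\<in>I. (G *v z) $ j = g $ j)}"

text \<open>Hoffman's error bound: the admissible pairs of right-hand side and distance form a polyhedral
  cone, and the slack vector with its entries in \<open>I\<close> deleted is admissible at distance zero.\<close>

lemma hoffman_bound_face: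
  fixes G :: "real ^ 'd ^ 'k"
  assumes "polyhedron_face G g I \<noteq> {}"
  shows "\<exists>C. \<forall>x. g \<le> G *v x \<longrightarrow>
    (\<exists>z\<in>polyhedron_face G g I. norm (z - x) \<le> C * (\<Sum>j\<in>I. (G *v x) $ j - g $ j))"
proof -
  \<comment> \<open>With \<open>fst x\<close> the slack vector at a point, \<open>v\<close> is a
    displacement that stays in the polyhedron and reaches the face, and \<open>snd x\<close> bounds
    its coordinates.\<close>
  define S where "S = {x :: (real ^ 'k) \<times> real. \<exists>v :: real ^ 'd.
    (\<forall>j. - fst x $ j \<le> (G *v v) $ j) \<and> (\<forall>j\<in>I. (G *v v) $ j \<le> - fst x $ j)
    \<and> (\<forall>i. v $ i \<le> snd x \<and> - snd x \<le> v $ i)}"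
  have pS: "polyhedral_cone S"
    unfolding S_def
    by (intro polyhedral_cone_ex polyhedral_cone_conj polyhedral_cone_all polyhedral_cone_ball
        polyhedral_cone_le linear_mult_vec_nth linear_vec_nth_compose)
      (auto intro!: linearI)
  have up: "(0, 1) \<in> S" unfolding S_def by (auto intro!: exI[of _ 0])
  obtain R L where RL: "finite R" "finite L"
    "\<And>s t. (s, t) \<in> S \<longleftrightarrow> (\<forall>r\<in>R. r \<bullet> s \<le> 0) \<and> (\<forall>l\<in>L. l \<bullet> s \<le> t)"
    using polyhedral_cone_epigraph[OF pS up] by blast
  define C where "C = (\<Sum>l\<in>L. norm l)"
  obtain w where w: "w \<in> polyhedron_face G g I" using assms by blast
  have "\<exists>z\<in>polyhedron_face G g I.
      norm (z - x) \<le> (real CARD('d) * C) * (\<Sum>j\<in>I. (G *v x) $ j - g $ j)"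
    if x: "g \<le> G *v x" for x
  proof -
    define s where "s = G *v x - g"
    define s' where "s' = (\<chi> j. if j \<in> I then 0 else s $ j)"
    define \<sigma> where "\<sigma> = (\<Sum>j\<in>I. s $ j)"
    have s0: "s $ j \<ge> 0" for j
      using x by (simp add: s_def less_eq_vec_def)
    have "(s', 0) \<in> S"
      unfolding S_def s'_def using s0 by (auto intro!: exI[of _ 0])
    then have l': "l \<bullet> s' \<le> 0" if "l \<in> L" for l using RL(3) that by blast
    \<comment> \<open>Some displacement, however long, leads to the fixed point \<open>w\<close> of
      the face. This settles the rows in \<open>R\<close>, in which the length does not
      occur.\<close>
    have "(s, norm (w - x)) \<in> S"
      unfolding S_def
    proof (simp, intro exI[of _ "w - x"] conjI allI ballI)
      fix j show "- s $ j \<le> (G *v (w - x)) $ j"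
        using w by (simp add: s_def polyhedron_face_def matrix_vector_mult_diff_distrib less_eq_vec_def)
    next
      fix j assume "j \<in> I" then show "(G *v (w - x)) $ j \<le> - s $ j"
        using w by (simp add: s_def polyhedron_face_def matrix_vector_mult_diff_distrib)
    next
      fix i show "(w - x) $ i \<le> norm (w - x)" "- norm (w - x) \<le> (w - x) $ i"
        using component_le_norm_cart[of "w - x" i] by (simp_all add: abs_le_iff)
    qed
    then have r: "r \<bullet> s \<le> 0" if "r \<in> R" for r using RL(3) that by blast
    have \<sigma>0: "\<sigma> \<ge> 0" unfolding \<sigma>_def using s0 by (simp add: sum_nonneg)
    have ns: "norm (s - s') \<le> \<sigma>"
    proof -
      have "norm (s - s') \<le> (\<Sum>j\<in>UNIV. \<bar>(s - s') $ j\<bar>)" by (rule norm_le_l1_cart)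
      also have "\<dots> = (\<Sum>j\<in>UNIV. if j \<in> I then s $ j else 0)"
        using s0 by (intro sum.cong) (auto simp: s'_def)
      also have "\<dots> = \<sigma>" by (simp add: \<sigma>_def sum.If_cases)
      finally show ?thesis .
    qed
    \<comment> \<open>A row in \<open>L\<close> is nonpositive at \<open>s'\<close>, so only the
      slack in \<open>I\<close>, of total size \<open>\<sigma>\<close>, contributes.\<close>
    have l: "l \<bullet> s \<le> C * \<sigma>" if "l \<in> L" for l
    proof -
      have "l \<bullet> s = l \<bullet> s' + l \<bullet> (s - s')" by (simp add: inner_diff_right)
      also have "\<dots> \<le> 0 + norm l * norm (s - s')"
        using l'[OF that] norm_cauchy_schwarz[of l "s - s'"] by linarith
      also have "\<dots> \<le> C * \<sigma>"
        using ns \<sigma>0 that RL(2) unfolding C_def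
        by (simp, intro mult_mono) (auto intro: member_le_sum sum_nonneg)
      finally show ?thesis .
    qed
    have "(s, C * \<sigma>) \<in> S" using RL(3) l r by blast
    then obtain v where v: "\<And>j. - s $ j \<le> (G *v v) $ j" "\<And>j. j \<in> I \<Longrightarrow> (G *v v) $ j \<le> - s $ j"
      "\<And>i. v $ i \<le> C * \<sigma> \<and> - (C * \<sigma>) \<le> v $ i"
      unfolding S_def by auto
    have "x + v \<in> polyhedron_face G g I"
      unfolding polyhedron_face_def
    proof (intro CollectI conjI ballI)
      show "g \<le> G *v (x + v)"
        using v(1) by (simp add: less_eq_vec_def s_def matrix_vector_right_distrib algebra_simps)
      fix j assume "j \<in> I"
      then show "(G *v (x + v)) $ j = g $ j"
        using v(1)[of j] v(2)[of j] by (simp add: s_def matrix_vector_right_distrib algebra_simps)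
    qed
    moreover have "norm (x + v - x) \<le> (real CARD('d) * C) * \<sigma>"
    proof -
      have "norm v \<le> (\<Sum>i\<in>UNIV. \<bar>v $ i\<bar>)" by (rule norm_le_l1_cart)
      also have "\<dots> \<le> (\<Sum>i\<in>(UNIV :: 'd set). C * \<sigma>)"
      proof (rule sum_mono)
        fix i show "\<bar>v $ i\<bar> \<le> C * \<sigma>" using v(3)[of i] by (simp add: abs_le_iff)
      qed
      finally show ?thesis by simp
    qed
    ultimately show ?thesis
      by (intro bexI[of _ "x + v"]) (auto simp: \<sigma>_def s_def)
  qed
  then show ?thesis by blast
qed

text \<open>A Farkas argument after homogenisation: \<open>fst x\<close> is the homogenising
  variable and \<open>snd x\<close> relaxes the constraints in \<open>I\<close>. An empty face means
  that (1, 0) violates a row of the cone. A violated row in \<open>R\<close> makes the whole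
  polyhedron empty; a violated row in \<open>L\<close> is the positive bound sought.\<close>

lemma empty_face_slack_bound:
  fixes G :: "real ^ 'd ^ 'k"
  assumes "polyhedron_face G g I = {}"
  shows "\<exists>e>0. \<forall>x. g \<le> G *v x \<longrightarrow> e \<le> (\<Sum>j\<in>I. (G *v x) $ j - g $ j)"
proof -
  define S where "S = {x :: real \<times> real. \<exists>z :: real ^ 'd.
    (\<forall>j. fst x * g $ j \<le> (G *v z) $ j) \<and> (\<forall>j\<in>I. (G *v z) $ j \<le> fst x * g $ j + snd x)}"
  have pS: "polyhedral_cone S"
    unfolding S_def
    by (intro polyhedral_cone_ex polyhedral_cone_conj polyhedral_cone_all polyhedral_cone_ball
        polyhedral_cone_le linear_mult_vec_nth linear_vec_nth_compose)
      (auto intro!: linearI simp: algebra_simps)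
  have up: "(0, 1) \<in> S" unfolding S_def by (auto intro!: exI[of _ 0])
  obtain R L where RL: "finite R" "finite L"
    "\<And>s t. (s, t) \<in> S \<longleftrightarrow> (\<forall>r\<in>R. r \<bullet> s \<le> 0) \<and> (\<forall>l\<in>L. l \<bullet> s \<le> t)"
    using polyhedral_cone_epigraph[OF pS up] by blast
  have mem: "(1, \<Sum>j\<in>I. (G *v x) $ j - g $ j) \<in> S" if x: "g \<le> G *v x" for x
    unfolding S_def
  proof (simp, intro exI[of _ x] conjI allI ballI)
    fix j assume "j \<in> I"
    then have "(G *v x) $ j - g $ j \<le> (\<Sum>j\<in>I. (G *v x) $ j - g $ j)"
      using x by (intro member_le_sum) (auto simp: less_eq_vec_def)
    then show "(G *v x) $ j \<le> g $ j + (\<Sum>j\<in>I. (G *v x) $ j - g $ j)" by simp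
  qed (use x in \<open>auto simp: less_eq_vec_def\<close>)
  have "(1, 0) \<notin> S"
  proof
    assume "(1, 0) \<in> S"
    then obtain z where "\<forall>j. g $ j \<le> (G *v z) $ j" "\<forall>j\<in>I. (G *v z) $ j \<le> g $ j"
      by (auto simp: S_def)
    then have "z \<in> polyhedron_face G g I"
      by (simp add: polyhedron_face_def less_eq_vec_def order_antisym)
    then show False using assms by simp
  qed
  then consider r where "r \<in> R" "r > 0" | l where "l \<in> L" "l > 0"
    using RL(3)[of 1 0] by (auto simp: not_le)
  then show ?thesis
  proof cases
    case 1
    then have "\<not> g \<le> G *v x" for x using mem[of x] RL(3) by fastforce
    then show ?thesis by (auto intro: exI[of _ 1])
  next
    case 2
    then show ?thesis using mem RL(3) by fastforce
  qed
qed

text \<open>If a constraint that is inactive at \<open>z\<close> has slack below \<open>K \<rho>\<close>, then the error bound moves \<open>z\<close>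
  to a nearby point at which this constraint is active too; this happens at most \<open>CARD('k)\<close> times.\<close>

lemma polyhedron_well_separated_point:
  fixes G :: "real ^ 'd ^ 'k"
  assumes "K \<ge> 0"
  obtains C d0 where "C \<ge> 1" "d0 > 0"
    "\<And>x d. g \<le> G *v x \<Longrightarrow> 0 < d \<Longrightarrow> d \<le> d0 \<Longrightarrow>
      \<exists>z \<rho>. g \<le> G *v z \<and> d \<le> \<rho> \<and> \<rho> \<le> C * d \<and> norm (z - x) \<le> \<rho> \<and>
        (\<forall>j. (G *v z) $ j = g $ j \<or> K * \<rho> \<le> (G *v z) $ j - g $ j)"
proof -
  define slk where "slk z j = (G *v z) $ j - g $ j" for z j
  have slk0: "slk z j \<ge> 0" if "g \<le> G *v z" for z j
    using that by (simp add: slk_def less_eq_vec_def)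
  have "\<exists>C. polyhedron_face G g I \<noteq> {} \<longrightarrow> (\<forall>x. g \<le> G *v x \<longrightarrow>
      (\<exists>z\<in>polyhedron_face G g I. norm (z - x) \<le> C * (\<Sum>j\<in>I. slk x j)))" for I
    using hoffman_bound_face unfolding slk_def by blast
  then obtain Cf where Cf: "\<And>I x. polyhedron_face G g I \<noteq> {} \<Longrightarrow> g \<le> G *v x \<Longrightarrow>
      \<exists>z\<in>polyhedron_face G g I. norm (z - x) \<le> Cf I * (\<Sum>j\<in>I. slk x j)"
    by metis
  have "\<exists>e>0. polyhedron_face G g I = {} \<longrightarrow> (\<forall>x. g \<le> G *v x \<longrightarrow> e \<le> (\<Sum>j\<in>I. slk x j))" for I
    using empty_face_slack_bound[of G g I] unfolding slk_def by (meson zero_less_one)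
  then obtain ef where ef: "\<And>I. ef I > 0"
    "\<And>I x. polyhedron_face G g I = {} \<Longrightarrow> g \<le> G *v x \<Longrightarrow> ef I \<le> (\<Sum>j\<in>I. slk x j)"
    by metis
  define C1 where "C1 = (\<Sum>I\<in>UNIV. \<bar>Cf I\<bar>)"
  define e where "e = Min (range ef)"
  have e: "e > 0" "e \<le> ef I" for I
    using ef(1) by (auto simp: e_def)
  have C1: "Cf I \<le> C1" "C1 \<ge> 0" for I
  proof -
    have "\<bar>Cf I\<bar> \<le> C1" unfolding C1_def by (intro member_le_sum) auto
    then show "Cf I \<le> C1" "C1 \<ge> 0" by linarith+
  qed
  \<comment> \<open>Activating one more constraint moves the point by at most
    \<open>C1 * K * \<rho>\<close>, so the radius grows by the factor \<open>B\<close> each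
    time.\<close>
  define B where "B = 1 + C1 * K"
  have B: "B \<ge> 1" using C1 assms by (simp add: B_def)
  have step: "\<exists>z' \<rho>'. g \<le> G *v z' \<and> \<rho> \<le> \<rho>' \<and> \<rho>' \<le> B ^ m * \<rho> \<and> norm (z' - x) \<le> \<rho>' \<and>
        (\<forall>j. slk z' j = 0 \<or> K * \<rho>' \<le> slk z' j)"
    if "card {j. slk z j \<noteq> 0} \<le> m" "g \<le> G *v z" "norm (z - x) \<le> \<rho>" "0 < \<rho>" "K * (B ^ m * \<rho>) < e"
    for m z x \<rho>
    using that
  proof (induction m arbitrary: z \<rho>)
    case 0
    then show ?case by (intro exI[of _ z] exI[of _ \<rho>]) auto
  next
    case (Suc m)
    show ?case
    proof (cases "\<forall>j. slk z j = 0 \<or> K * \<rho> \<le> slk z j")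
      case True
      have "\<rho> \<le> B ^ Suc m * \<rho>"
        using B Suc.prems(4) one_le_power[OF B, of "Suc m"] by (simp del: power_Suc)
      then show ?thesis using True Suc.prems by (intro exI[of _ z] exI[of _ \<rho>]) auto
    next
      case False
      then obtain j where j: "slk z j \<noteq> 0" "slk z j < K * \<rho>" by auto
      define I where "I = insert j {i. slk z i = 0}"
      have sum: "(\<Sum>i\<in>I. slk z i) = slk z j"
        using j(1) by (simp add: I_def)
      have "K * \<rho> \<le> K * (B ^ Suc m * \<rho>)"
        using assms B Suc.prems(4) one_le_power[OF B, of "Suc m"]
        by (intro mult_left_mono) (simp_all del: power_Suc)
      \<comment> \<open>Below the threshold \<open>e\<close>, the face on which \<open>j\<close> is
        active as well cannot be empty, so the error bound applies to it.\<close>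
      then have "slk z j < e" using j Suc.prems(5) by linarith
      then have "polyhedron_face G g I \<noteq> {}"
        using ef(2)[of I z] e(2)[of I] sum Suc.prems(2) by fastforce
      then obtain z' where z': "z' \<in> polyhedron_face G g I" "norm (z' - z) \<le> Cf I * slk z j"
        using Cf[of I z] Suc.prems(2) sum by auto
      have "Cf I * slk z j \<le> C1 * (K * \<rho>)"
        using C1 j slk0[OF Suc.prems(2)] by (intro mult_mono) auto
      then have near: "norm (z' - z) \<le> C1 * K * \<rho>" using z' by simp
      have z'0: "slk z' i = 0" if "i \<in> I" for i
        using z' that by (simp add: polyhedron_face_def slk_def)
      have "{i. slk z' i \<noteq> 0} \<subset> {i. slk z i \<noteq> 0}"
      proof
        show "{i. slk z' i \<noteq> 0} \<subseteq> {i. slk z i \<noteq> 0}" using z'0 by (auto simp: I_def)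
        show "{i. slk z' i \<noteq> 0} \<noteq> {i. slk z i \<noteq> 0}" using z'0[of j] j by (auto simp: I_def)
      qed
      then have "card {i. slk z' i \<noteq> 0} < card {i. slk z i \<noteq> 0}"
        by (intro psubset_card_mono) auto
      moreover have "norm (z' - x) \<le> B * \<rho>"
        using near Suc.prems(3) norm_triangle_ineq[of "z' - z" "z - x"]
        by (simp add: B_def algebra_simps)
      moreover have Bm: "B ^ m * (B * \<rho>) = B ^ Suc m * \<rho>" by simp
      moreover have "g \<le> G *v z'" using z'(1) by (simp add: polyhedron_face_def)
      moreover have "0 < B * \<rho>" using B Suc.prems(4) by simp
      ultimately obtain z'' \<rho>' where "g \<le> G *v z''" "B * \<rho> \<le> \<rho>'" "\<rho>' \<le> B ^ Suc m * \<rho>"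
        "norm (z'' - x) \<le> \<rho>'" "\<forall>j. slk z'' j = 0 \<or> K * \<rho>' \<le> slk z'' j"
        using Suc.IH[of z' "B * \<rho>"] Suc.prems(1,5) unfolding Bm by fastforce
      moreover have "\<rho> \<le> B * \<rho>" using B Suc.prems(4) by simp
      ultimately show ?thesis by (meson order_trans)
    qed
  qed
  define n where "n = CARD('k)"
  \<comment> \<open>\<open>K + 1\<close> instead of \<open>K\<close> keeps the denominator positive
    when \<open>K = 0\<close>; the factor 2 yields the strict inequality required by
    \<open>step\<close> for up to \<open>n\<close> enlargements of the radius.\<close>
  define d0 where "d0 = e / (2 * (K + 1) * B ^ n)"
  have Bn: "B ^ n \<ge> 1" using B by (rule one_le_power)
  have d0: "d0 > 0" using e assms Bn by (simp add: d0_def)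
  have "\<exists>z \<rho>. g \<le> G *v z \<and> d \<le> \<rho> \<and> \<rho> \<le> B ^ n * d \<and> norm (z - x) \<le> \<rho> \<and>
        (\<forall>j. (G *v z) $ j = g $ j \<or> K * \<rho> \<le> (G *v z) $ j - g $ j)"
    if x: "g \<le> G *v x" "0 < d" "d \<le> d0" for x d
  proof -
    have "K * (B ^ n * d) \<le> (K + 1) * (B ^ n * d0)"
      using that assms Bn by (intro mult_mono) auto
    also have "\<dots> = e / 2"
    proof -
      have "K + 1 \<noteq> 0" "B \<noteq> 0" using assms B by auto
      then show ?thesis by (simp add: d0_def divide_simps)
    qed
    also have "\<dots> < e" using e by simp
    finally have K: "K * (B ^ n * d) < e" .
    have "card {j. slk x j \<noteq> 0} \<le> n"
      unfolding n_def by (intro card_mono) auto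
    from step[OF this x(1) _ x(2) K, of x] x(2)
    show ?thesis unfolding slk_def by (simp add: algebra_simps)
  qed
  then show thesis using that[OF Bn d0] by blast
qed

section \<open>The strong law of large numbers\<close>

lemma tendsto_cesaro_mean:
  fixes a :: "nat \<Rightarrow> real"
  assumes "a \<longlonglongrightarrow> l"
  shows "(\<lambda>n. (\<Sum>i = 1..n. a i) / real n) \<longlonglongrightarrow> l"
proof (rule LIMSEQ_I)
  fix e :: real assume e: "e > 0"
  obtain m where m: "\<And>i. i \<ge> m \<Longrightarrow> \<bar>a i - l\<bar> < e / 2"
    using LIMSEQ_D[OF assms, of "e / 2"] e by auto
  define B where "B = (\<Sum>i = 1..m. \<bar>a i - l\<bar>)"
  obtain n0 :: nat where n0: "2 * B / e < real n0" using reals_Archimedean2 by blast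
  have "norm ((\<Sum>i = 1..n. a i) / real n - l) < e" if n: "n \<ge> max 1 (max m n0)" for n
  proof -
    have n1: "real n > 0" using n by simp
    have "(\<Sum>i = 1..n. a i) / real n - l = (\<Sum>i = 1..n. a i - l) / real n"
      using n1 by (simp add: sum_subtractf field_simps)
    moreover have "\<bar>\<Sum>i = 1..n. a i - l\<bar> \<le> B + real n * (e / 2)"
    proof -
      have "\<bar>\<Sum>i = 1..n. a i - l\<bar> \<le> (\<Sum>i = 1..n. \<bar>a i - l\<bar>)" by (rule sum_abs)
      also have "\<dots> = B + (\<Sum>i = Suc m..n. \<bar>a i - l\<bar>)"
        unfolding B_def using n sum.ub_add_nat[of 1 m "\<lambda>i. \<bar>a i - l\<bar>" "n - m"] by simp
      also have "(\<Sum>i = Suc m..n. \<bar>a i - l\<bar>) \<le> (\<Sum>i = Suc m..n. e / 2)"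
        using m by (intro sum_mono less_imp_le) auto
      also have "\<dots> \<le> real n * (e / 2)" using e by (simp add: field_simps)
      finally show ?thesis by simp
    qed
    moreover have "B < real n * (e / 2)"
    proof -
      have "2 * B / e < real n" using n0 n by linarith
      then show ?thesis using e by (simp add: field_simps)
    qed
    ultimately show ?thesis using n1 by (simp add: field_simps)
  qed
  then show "\<exists>no. \<forall>n\<ge>no. norm ((\<Sum>i = 1..n. a i) / real n - l) < e" by blast
qed

section \<open>From geometric subsequences to all averages\<close>

lemma nat_floor_power_bounds:
  fixes \<alpha> :: real
  assumes "\<alpha> > 1"
  shows "1 \<le> nat \<lfloor>\<alpha> ^ n\<rfloor>" "real (nat \<lfloor>\<alpha> ^ n\<rfloor>) \<le> \<alpha> ^ n" "\<alpha> ^ n - 1 < real (nat \<lfloor>\<alpha> ^ n\<rfloor>)"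
proof -
  have 1: "\<alpha> ^ n \<ge> 1" using assms by (simp add: one_le_power)
  show "1 \<le> nat \<lfloor>\<alpha> ^ n\<rfloor>" using 1 by (simp add: le_nat_iff le_floor_iff)
  show "real (nat \<lfloor>\<alpha> ^ n\<rfloor>) \<le> \<alpha> ^ n" using 1 by simp
  show "\<alpha> ^ n - 1 < real (nat \<lfloor>\<alpha> ^ n\<rfloor>)" using 1 by (simp add: of_nat_nat)
qed

lemma ex_power_bracket:
  fixes \<alpha> x :: real
  assumes "\<alpha> > 1" "x \<ge> 1"
  obtains j where "\<alpha> ^ j \<le> x" "x < \<alpha> ^ Suc j"
proof -
  define i where "i = (LEAST i. x < \<alpha> ^ i)"
  have "\<exists>i. x < \<alpha> ^ i" using assms(1) real_arch_pow by blast
  then have i: "x < \<alpha> ^ i" unfolding i_def by (rule LeastI_ex)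
  then have "i \<noteq> 0" using assms by (intro notI) auto
  then obtain j where j: "i = Suc j" by (cases i) auto
  then have "\<not> x < \<alpha> ^ j" unfolding i_def by (metis lessI not_less_Least)
  then show thesis using that[of j] i j by (simp add: not_less)
qed

text \<open>Monotonicity of \<open>S\<close> interpolates between consecutive terms of \<open>\<lfloor>\<alpha> ^ n\<rfloor>\<close> at the cost of a factor
  at most \<open>\<alpha>\<^sup>2\<close>.\<close>

lemma tendsto_average_from_geometric_subsequences:
  fixes S :: "nat \<Rightarrow> real"
  assumes mono: "incseq S" and nonneg: "\<And>n. S n \<ge> 0"
    and lim: "\<And>m::nat. (\<lambda>n. S (nat \<lfloor>(1 + 1 / real (Suc m)) ^ n\<rfloor>) / real (nat \<lfloor>(1 + 1 / real (Suc m)) ^ n\<rfloor>)) \<longlonglongrightarrow> l"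
  shows "(\<lambda>n. S n / real n) \<longlonglongrightarrow> l"
proof -
  define al where "al m = 1 + 1 / real (Suc m)" for m
  have al1: "al m > 1" for m by (simp add: al_def)
  have al_lim: "al \<longlonglongrightarrow> 1"
    unfolding al_def using tendsto_add[OF tendsto_const[of 1] LIMSEQ_inverse_real_of_nat]
    by (simp add: inverse_eq_divide)
  have bounds: "\<forall>\<^sub>F n in sequentially. b \<le> S n / real n * al m ^ 2 \<and> S n / real n \<le> al m * c"
    if bc: "b < l" "l < c" for m b c
  proof -
    define k where "k n = nat \<lfloor>al m ^ n\<rfloor>" for n
    have k: "1 \<le> k n" "real (k n) \<le> al m ^ n" "al m ^ n - 1 < real (k n)" for n
      unfolding k_def using nat_floor_power_bounds[OF al1[of m]] by blast+
    have kl: "(\<lambda>n. S (k n) / real (k n)) \<longlonglongrightarrow> l"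
      unfolding k_def using lim[of m] by (simp add: al_def)
    have "\<forall>\<^sub>F n in sequentially. b < S (k n) / real (k n)" "\<forall>\<^sub>F n in sequentially. S (k n) / real (k n) < c"
      using order_tendstoD[OF kl] bc by auto
    \<comment> \<open>Equivalent to \<open>al m ^ n - 1 \<ge> al m ^ n / al m\<close>: from such an
      \<open>n\<close> on, rounding down loses at most one factor \<open>al m\<close>.\<close>
    moreover have "\<forall>\<^sub>F n in sequentially. 1 / (1 - 1 / al m) \<le> al m ^ n"
    proof -
      obtain n0 where n0: "1 / (1 - 1 / al m) < al m ^ n0" using real_arch_pow[OF al1[of m]] by blast
      have "1 / (1 - 1 / al m) \<le> al m ^ n" if "n0 \<le> n" for n
        using n0 power_increasing[OF that, of "al m"] al1[of m] by linarith
      then show ?thesis by (auto simp: eventually_sequentially)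
    qed
    ultimately have "\<forall>\<^sub>F n in sequentially. b < S (k n) / real (k n) \<and> S (k n) / real (k n) < c
        \<and> 1 / (1 - 1 / al m) \<le> al m ^ n"
      by (simp add: eventually_conj_iff)
    then obtain J where J: "\<And>j. j \<ge> J \<Longrightarrow> b < S (k j) / real (k j) \<and> S (k j) / real (k j) < c
        \<and> 1 / (1 - 1 / al m) \<le> al m ^ j"
      by (auto simp: eventually_sequentially)
    have "b \<le> S n / real n * al m ^ 2 \<and> S n / real n \<le> al m * c"
      if n: "n \<ge> nat \<lceil>al m ^ J\<rceil>" "n \<ge> 1" for n
    proof -
      obtain j where j: "al m ^ j \<le> real n" "real n < al m ^ Suc j"
        using ex_power_bracket[OF al1[of m], of "real n"] n by auto
      have "al m ^ J < al m ^ Suc j" using n j by linarith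
      then have Jj: "J \<le> j" using al1[of m] by (metis less_Suc_eq_le power_less_imp_less_exp)
      have kn: "k j \<le> n" using k(2)[of j] j by linarith
      have "int n \<le> \<lfloor>al m ^ Suc j\<rfloor>" using j by (simp add: le_floor_iff del: power_Suc)
      then have nk: "n \<le> k (Suc j)" unfolding k_def by linarith
      have n0: "real n > 0" using n by simp
      have aj: "al m ^ j > 0" using al1[of m] by simp
      have "b \<le> S (k j) / real (k j)" using J[OF Jj] by simp
      also have "\<dots> \<le> S n / (real n / al m ^ 2)"
      proof (rule frac_le)
        show "S (k j) \<le> S n" using mono kn by (simp add: incseqD)
        show "0 < real n / al m ^ 2" using n0 al1[of m] by simp
        have "1 / (1 - 1 / al m) \<le> al m ^ j" using J[OF Jj] by simp
        then have "1 \<le> al m ^ j * (1 - 1 / al m)" using al1[of m] by (simp add: field_simps)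
        then have "al m ^ j / al m \<le> real (k j)" using k(3)[of j] by (simp add: algebra_simps)
        moreover have "real n / al m ^ 2 \<le> al m ^ Suc j / al m ^ 2"
          using j al1[of m] by (intro divide_right_mono) auto
        moreover have "al m ^ Suc j / al m ^ 2 = al m ^ j / al m"
          using al1[of m] by (simp add: power2_eq_square)
        ultimately show "real n / al m ^ 2 \<le> real (k j)" by linarith
      qed (use nonneg in auto)
      finally have 1: "b \<le> S n / real n * al m ^ 2" by simp
      have "S n / real n \<le> S (k (Suc j)) / (real (k (Suc j)) / al m)"
      proof (rule frac_le)
        show "S n \<le> S (k (Suc j))" using mono nk by (simp add: incseqD)
        show "0 < real (k (Suc j)) / al m" using k(1)[of "Suc j"] al1[of m] by simp
        have "real (k (Suc j)) / al m \<le> al m ^ Suc j / al m"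
          using k(2)[of "Suc j"] al1[of m] by (intro divide_right_mono) auto
        also have "\<dots> = al m ^ j" using al1[of m] by simp
        finally show "real (k (Suc j)) / al m \<le> real n" using j by linarith
      qed (use nonneg in auto)
      also have "\<dots> = al m * (S (k (Suc j)) / real (k (Suc j)))" by simp
      also have "\<dots> \<le> al m * c"
        using J[of "Suc j"] Jj al1[of m] by (intro mult_left_mono) auto
      finally show ?thesis using 1 by blast
    qed
    then show ?thesis
      by (auto simp: eventually_sequentially intro!: exI[of _ "max 1 (nat \<lceil>al m ^ J\<rceil>)"])
  qed
  show ?thesis
  proof (rule order_tendstoI)
    fix a assume a: "a < l"
    show "\<forall>\<^sub>F n in sequentially. a < S n / real n"
    proof (cases "a < 0")
      case True
      then have "a < S n / real n" for n
        using divide_nonneg_nonneg[OF nonneg[of n] of_nat_0_le_iff[of n]] by linarith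
      then show ?thesis by simp
    next
      case False
      define b where "b = (a + l) / 2"
      have ab: "a < b" "b < l" using a by (auto simp: b_def)
      have "(\<lambda>m. a * al m ^ 2) \<longlonglongrightarrow> a * 1 ^ 2" by (intro tendsto_intros al_lim)
      then have "\<forall>\<^sub>F m in sequentially. a * al m ^ 2 < b"
        using ab by (intro order_tendstoD) auto
      then obtain m where m: "a * al m ^ 2 < b" by (auto simp: eventually_sequentially)
      have "\<forall>\<^sub>F n in sequentially. b \<le> S n / real n * al m ^ 2"
        using bounds[OF ab(2), of "l + 1" m] by (simp add: eventually_conj_iff)
      then show ?thesis
      proof (rule eventually_mono)
        fix n assume "b \<le> S n / real n * al m ^ 2"
        then have "a * al m ^ 2 < S n / real n * al m ^ 2" using m by linarith
        then show "a < S n / real n" by (rule mult_right_less_imp_less) simp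
      qed
    qed
  next
    fix a assume a: "l < a"
    define c where "c = (a + l) / 2"
    have ac: "l < c" "c < a" using a by (auto simp: c_def)
    have "(\<lambda>m. al m * c) \<longlonglongrightarrow> 1 * c" by (intro tendsto_intros al_lim)
    then have "\<forall>\<^sub>F m in sequentially. al m * c < a"
      using ac by (intro order_tendstoD) auto
    then obtain m where m: "al m * c < a" by (auto simp: eventually_sequentially)
    have "\<forall>\<^sub>F n in sequentially. S n / real n \<le> al m * c"
      using bounds[of "l - 1", OF _ ac(1), of m] by (simp add: eventually_conj_iff)
    then show "\<forall>\<^sub>F n in sequentially. S n / real n < a"
      by (rule eventually_mono) (use m in linarith)
  qed
qed

section \<open>Truncation and moment estimates\<close>

lemma sum_inverse_powers_above:
  fixes \<alpha> y :: real
  assumes "\<alpha> > 1" "y > 0"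
  shows "(\<Sum>n<N. if y \<le> \<alpha> ^ n then 1 / \<alpha> ^ n else 0) \<le> \<alpha> / (\<alpha> - 1) / y"
proof -
  \<comment> \<open>\<open>D / \<alpha> ^ N\<close> is the tail of the geometric series from
    exponent \<open>N\<close> on. The induction carries this missing tail as a negative term, which
    makes the sum telescope.\<close>
  define D where "D = \<alpha> / (\<alpha> - 1)"
  have D: "D > 0" using assms by (simp add: D_def)
  have "(\<Sum>n<N. if y \<le> \<alpha> ^ n then 1 / \<alpha> ^ n else 0) \<le> (if y \<le> \<alpha> ^ N then D / y - D / \<alpha> ^ N else 0)"
  proof (induction N)
    case 0
    then show ?case using assms D by (auto simp: field_simps)
  next
    case (Suc N)
    have tele: "D / \<alpha> ^ N - D / \<alpha> ^ Suc N = 1 / \<alpha> ^ N"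
    proof -
      have "D * (\<alpha> - 1) = \<alpha>" using assms by (simp add: D_def)
      then have "D - D / \<alpha> = 1" using assms by (simp add: field_simps)
      moreover have "D / \<alpha> ^ N - D / \<alpha> ^ Suc N = (D - D / \<alpha>) / \<alpha> ^ N"
        using assms by (simp add: field_simps)
      ultimately show ?thesis by simp
    qed
    have up: "\<alpha> ^ N \<le> \<alpha> ^ Suc N" using assms by simp
    show ?case
    proof (cases "y \<le> \<alpha> ^ N")
      case True
      then show ?thesis using Suc tele up by (simp del: power_Suc)
    next
      case False
      moreover have "0 \<le> D / y - D / \<alpha> ^ Suc N" if "y \<le> \<alpha> ^ Suc N"
        using frac_le[of D D y "\<alpha> ^ Suc N"] D assms that by simp
      ultimately show ?thesis using Suc by (auto simp del: power_Suc)
    qed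
  qed
  also have "\<dots> \<le> D / y" using assms D by simp
  finally show ?thesis by (simp add: D_def)
qed

text \<open>One-sided, as it is applied to nonnegative variables. Values above the level become 0
  rather than \<open>K\<close>, so truncation at a level \<open>K \<ge> 0\<close> changes a variable
  exactly when it exceeds \<open>K\<close>.\<close>

definition truncate_above :: "real \<Rightarrow> real \<Rightarrow> real" where
  "truncate_above K x = (if x \<le> K then x else 0)"

lemma truncate_above_measurable [measurable]: "truncate_above K \<in> borel_measurable borel"
  unfolding truncate_above_def[abs_def] by measurable

text \<open>Pointwise form of the second-moment estimate: after integration the left side bounds the
  summed variances of the truncated averages along the indices
  \<open>\<lfloor>\<alpha> ^ n\<rfloor>\<close>, and the right side is a multiple of the mean. Only
  \<open>n\<close> with \<open>y \<le> \<alpha> ^ n\<close> contribute; rounding down costs the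
  factor 2.\<close>

lemma sum_truncated_squares:
  fixes \<alpha> y :: real
  assumes "\<alpha> > 1" "y \<ge> 0"
  shows "(\<Sum>n<N. (truncate_above (real (nat \<lfloor>\<alpha> ^ n\<rfloor>)) y)\<^sup>2 / real (nat \<lfloor>\<alpha> ^ n\<rfloor>)) \<le> 2 * (\<alpha> / (\<alpha> - 1)) * y"
proof (cases "y = 0")
  case True
  then show ?thesis by (simp add: truncate_above_def)
next
  case False
  then have y: "y > 0" using assms by simp
  have "(\<Sum>n<N. (truncate_above (real (nat \<lfloor>\<alpha> ^ n\<rfloor>)) y)\<^sup>2 / real (nat \<lfloor>\<alpha> ^ n\<rfloor>))
      \<le> (\<Sum>n<N. 2 * y\<^sup>2 * (if y \<le> \<alpha> ^ n then 1 / \<alpha> ^ n else 0))"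
  proof (rule sum_mono)
    fix n
    define k where "k = real (nat \<lfloor>\<alpha> ^ n\<rfloor>)"
    have k: "1 \<le> k" "k \<le> \<alpha> ^ n" "\<alpha> ^ n - 1 < k"
      using nat_floor_power_bounds[OF assms(1), of n] by (auto simp: k_def)
    have "\<alpha> ^ n \<le> 2 * k" using k by linarith
    then have "1 / k \<le> 2 / \<alpha> ^ n" using k assms by (simp add: field_simps)
    then have "y\<^sup>2 * (1 / k) \<le> y\<^sup>2 * (2 / \<alpha> ^ n)" by (intro mult_left_mono) auto
    then have "(truncate_above k y)\<^sup>2 / k \<le> 2 * y\<^sup>2 * (if y \<le> \<alpha> ^ n then 1 / \<alpha> ^ n else 0)"
      using k assms by (auto simp: truncate_above_def mult.commute)
    then show "(truncate_above (real (nat \<lfloor>\<alpha> ^ n\<rfloor>)) y)\<^sup>2 / real (nat \<lfloor>\<alpha> ^ n\<rfloor>)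
        \<le> 2 * y\<^sup>2 * (if y \<le> \<alpha> ^ n then 1 / \<alpha> ^ n else 0)"
      by (simp add: k_def)
  qed
  also have "\<dots> = 2 * y\<^sup>2 * (\<Sum>n<N. if y \<le> \<alpha> ^ n then 1 / \<alpha> ^ n else 0)"
    by (simp only: sum_distrib_left)
  also have "\<dots> \<le> 2 * y\<^sup>2 * (\<alpha> / (\<alpha> - 1) / y)"
    using sum_inverse_powers_above[OF assms(1) y] by (intro mult_left_mono) auto
  also have "\<dots> = 2 * (\<alpha> / (\<alpha> - 1)) * y" using y by (simp add: power2_eq_square)
  finally show ?thesis .
qed

text \<open>After integration this bounds the sum of the tail probabilities by the mean, as the
  Borel-Cantelli lemma requires.\<close>

lemma sum_indicator_less_le:
  fixes y :: real
  assumes "y \<ge> 0"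
  shows "(\<Sum>i = 1..n. if real i < y then 1 else 0) \<le> y"
proof -
  have "(\<Sum>i = 1..n. if real i < y then 1 else 0) \<le> real n \<and> (\<Sum>i = 1..n. if real i < y then 1 else 0) \<le> y"
    using assms by (induction n) auto
  then show ?thesis by blast
qed

section \<open>Second moments under pairwise independence and the strong law\<close>

lemma (in prob_space) expectation_square_sum_pairwise_indep:
  fixes Z :: "nat \<Rightarrow> 'a \<Rightarrow> real"
  assumes I: "finite I"
    and indep: "\<And>i j. i \<in> I \<Longrightarrow> j \<in> I \<Longrightarrow> i \<noteq> j \<Longrightarrow> indep_var borel (Z i) borel (Z j)"
    and rv: "\<And>i. i \<in> I \<Longrightarrow> random_variable borel (Z i)"
    and bnd: "\<And>i \<omega>. i \<in> I \<Longrightarrow> \<bar>Z i \<omega>\<bar> \<le> B"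
  shows "expectation (\<lambda>\<omega>. (\<Sum>i\<in>I. Z i \<omega> - expectation (Z i))\<^sup>2) \<le> (\<Sum>i\<in>I. expectation (\<lambda>\<omega>. (Z i \<omega>)\<^sup>2))"
proof -
  define c where "c i = expectation (Z i)" for i
  define A where "A i \<omega> = Z i \<omega> - c i" for i \<omega>
  have intZ: "integrable M (Z i)" if "i \<in> I" for i
    using rv[OF that] bnd[OF that] by (intro integrable_const_bound[of _ B]) auto
  have Abnd: "\<bar>A i \<omega>\<bar> \<le> B + \<bar>c i\<bar>" if "i \<in> I" for i \<omega>
    using bnd[OF that, of \<omega>] unfolding A_def by linarith
  have rvA: "random_variable borel (A i)" if "i \<in> I" for i
    using rv[OF that] unfolding A_def[abs_def] by measurable
  have intAA: "integrable M (\<lambda>\<omega>. A i \<omega> * A j \<omega>)" if ij: "i \<in> I" "j \<in> I" for i j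
  proof (rule integrable_const_bound[of _ "(B + \<bar>c i\<bar>) * (B + \<bar>c j\<bar>)"])
    show "AE \<omega> in M. norm (A i \<omega> * A j \<omega>) \<le> (B + \<bar>c i\<bar>) * (B + \<bar>c j\<bar>)"
    proof (rule AE_I2)
      fix \<omega>
      have "0 \<le> B + \<bar>c i\<bar>" using Abnd[OF ij(1), of \<omega>] by linarith
      then show "norm (A i \<omega> * A j \<omega>) \<le> (B + \<bar>c i\<bar>) * (B + \<bar>c j\<bar>)"
        using Abnd[OF ij(1), of \<omega>] Abnd[OF ij(2), of \<omega>] by (simp add: abs_mult mult_mono)
    qed
    show "(\<lambda>\<omega>. A i \<omega> * A j \<omega>) \<in> borel_measurable M" using rvA ij by simp
  qed
  have off: "expectation (\<lambda>\<omega>. A i \<omega> * A j \<omega>) = 0" if ij: "i \<in> I" "j \<in> I" "i \<noteq> j" for i j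
  proof -
    have "indep_var borel ((\<lambda>x. x - c i) \<circ> Z i) borel ((\<lambda>x. x - c j) \<circ> Z j)"
      using indep[OF ij] by (rule indep_var_compose) simp_all
    then have "indep_var borel (A i) borel (A j)" by (simp add: A_def[abs_def] o_def)
    moreover have "integrable M (A k) \<and> expectation (A k) = 0" if "k \<in> I" for k
      using intZ[OF that] by (simp add: A_def[abs_def] c_def prob_space)
    ultimately show ?thesis
      using ij by (simp add: indep_var_lebesgue_integral)
  qed
  have "expectation (\<lambda>\<omega>. (\<Sum>i\<in>I. A i \<omega>)\<^sup>2) = expectation (\<lambda>\<omega>. \<Sum>i\<in>I. \<Sum>j\<in>I. A i \<omega> * A j \<omega>)"
    by (simp add: power2_eq_square sum_product)
  also have "\<dots> = (\<Sum>i\<in>I. \<Sum>j\<in>I. expectation (\<lambda>\<omega>. A i \<omega> * A j \<omega>))"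
    using intAA by (simp add: Bochner_Integration.integral_sum)
  also have "\<dots> = (\<Sum>i\<in>I. expectation (\<lambda>\<omega>. A i \<omega> * A i \<omega>))"
  proof (rule sum.cong[OF refl])
    fix i assume i: "i \<in> I"
    have "(\<Sum>j\<in>I. expectation (\<lambda>\<omega>. A i \<omega> * A j \<omega>))
        = (\<Sum>j\<in>I. if j = i then expectation (\<lambda>\<omega>. A i \<omega> * A i \<omega>) else 0)"
      using off i by (intro sum.cong) auto
    then show "(\<Sum>j\<in>I. expectation (\<lambda>\<omega>. A i \<omega> * A j \<omega>)) = expectation (\<lambda>\<omega>. A i \<omega> * A i \<omega>)"
      using I i by simp
  qed
  also have "\<dots> \<le> (\<Sum>i\<in>I. expectation (\<lambda>\<omega>. (Z i \<omega>)\<^sup>2))"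
  proof (rule sum_mono)
    fix i assume i: "i \<in> I"
    have "integrable M (\<lambda>\<omega>. (Z i \<omega>)\<^sup>2)"
    proof (rule integrable_const_bound[of _ "B\<^sup>2"])
      show "AE \<omega> in M. norm ((Z i \<omega>)\<^sup>2) \<le> B\<^sup>2"
        using bnd[OF i] by (intro AE_I2) (metis abs_ge_zero norm_power power_mono real_norm_def)
    qed (use rv[OF i] in simp)
    then have "variance (Z i) = expectation (\<lambda>\<omega>. (Z i \<omega>)\<^sup>2) - (expectation (Z i))\<^sup>2"
      using intZ[OF i] by (rule variance_eq[rotated])
    then show "expectation (\<lambda>\<omega>. A i \<omega> * A i \<omega>) \<le> expectation (\<lambda>\<omega>. (Z i \<omega>)\<^sup>2)"
      by (simp add: A_def c_def power2_eq_square)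
  qed
  finally show ?thesis by (simp add: A_def c_def)
qed

lemma (in prob_space) identically_distributed_transfer:
  fixes X Y :: "'a \<Rightarrow> real" and f :: "real \<Rightarrow> real"
  assumes "random_variable borel X" "random_variable borel Y" "distr M borel X = distr M borel Y"
    "f \<in> borel_measurable borel"
  shows "expectation (\<lambda>\<omega>. f (X \<omega>)) = expectation (\<lambda>\<omega>. f (Y \<omega>))"
  using assms integral_distr[of X M borel f] integral_distr[of Y M borel f] by simp

text \<open>The \<open>i\<close>-th variable is truncated at level \<open>i\<close>: the level is
  exceeded finitely often, the truncated means converge, and the centred truncated averages have
  summable second moments along every geometric subsequence. Nonnegativity makes partial sums
  monotone, which closes the gaps between the indices of a subsequence.\<close>

lemma (in prob_space) strong_law_nonneg:
  fixes X :: "nat \<Rightarrow> 'a \<Rightarrow> real" and Y :: "'a \<Rightarrow> real"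
  assumes rv: "\<And>i. i \<ge> 1 \<Longrightarrow> random_variable borel (X i)"
    and indep: "\<And>i j. i \<ge> 1 \<Longrightarrow> j \<ge> 1 \<Longrightarrow> i \<noteq> j \<Longrightarrow> indep_var borel (X i) borel (X j)"
    and distr: "\<And>i. i \<ge> 1 \<Longrightarrow> distr M borel (X i) = distr M borel Y"
    and Y: "integrable M Y"
    and X0: "\<And>i \<omega>. X i \<omega> \<ge> 0" and Y0: "\<And>\<omega>. Y \<omega> \<ge> 0"
  shows "AE \<omega> in M. (\<lambda>n. (\<Sum>i = 1..n. X i \<omega>) / real n) \<longlonglongrightarrow> expectation Y"
proof -
  have rvY [measurable]: "random_variable borel Y" using Y by simp
  define Z where "Z i \<omega> = truncate_above (real i) (X i \<omega>)" for i \<omega>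
  define \<mu> where "\<mu> i = expectation (Z i)" for i
  have rvZ: "random_variable borel (Z i)" if "i \<ge> 1" for i
  proof -
    note rv[OF that, measurable]
    show ?thesis unfolding Z_def[abs_def] by measurable
  qed
  have Zbnd: "0 \<le> Z i \<omega>" "Z i \<omega> \<le> real i" "\<bar>Z i \<omega>\<bar> \<le> real i" for i \<omega>
    using X0 by (auto simp: Z_def truncate_above_def)
  have indepZ: "indep_var borel (Z i) borel (Z j)" if "i \<ge> 1" "j \<ge> 1" "i \<noteq> j" for i j
  proof -
    have "indep_var borel (truncate_above (real i) \<circ> X i) borel (truncate_above (real j) \<circ> X j)"
      using indep[OF that] by (rule indep_var_compose) simp_all
    then show ?thesis by (simp add: Z_def[abs_def] o_def)
  qed

  have \<mu>_lim: "\<mu> \<longlonglongrightarrow> expectation Y"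
  proof -
    have "(\<lambda>i. expectation (\<lambda>\<omega>. truncate_above (real i) (Y \<omega>))) \<longlonglongrightarrow> expectation Y"
    proof (rule integral_dominated_convergence[where w = Y])
      show "AE \<omega> in M. (\<lambda>i. truncate_above (real i) (Y \<omega>)) \<longlonglongrightarrow> Y \<omega>"
      proof (rule AE_I2)
        fix \<omega>
        obtain n :: nat where "Y \<omega> \<le> real n" using real_arch_simple by blast
        then have "\<forall>\<^sub>F i in sequentially. truncate_above (real i) (Y \<omega>) = Y \<omega>"
          by (auto simp: eventually_sequentially truncate_above_def intro!: exI[of _ n])
        then show "(\<lambda>i. truncate_above (real i) (Y \<omega>)) \<longlonglongrightarrow> Y \<omega>"
          by (rule tendsto_eventually)
      qed
      show "AE \<omega> in M. norm (truncate_above (real i) (Y \<omega>)) \<le> Y \<omega>" for i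
        using Y0 by (auto simp: truncate_above_def)
    qed (use Y in simp_all)
    moreover have "\<forall>\<^sub>F i in sequentially. expectation (\<lambda>\<omega>. truncate_above (real i) (Y \<omega>)) = \<mu> i"
      using identically_distributed_transfer[OF rv rvY distr truncate_above_measurable]
      by (auto simp: eventually_sequentially \<mu>_def Z_def[abs_def] intro!: exI[of _ 1])
    ultimately show ?thesis by (rule Lim_transform_eventually)
  qed

  have XZ: "AE \<omega> in M. \<forall>\<^sub>F i in sequentially. X i \<omega> - Z i \<omega> = 0"
  proof -
    \<comment> \<open>The clause \<open>i \<ge> 1\<close> makes \<open>A 0\<close> empty, since
      \<open>X 0\<close> need not be measurable.\<close>
    define A where "A i = {\<omega> \<in> space M. real i < X i \<omega> \<and> i \<ge> 1}" for i
    have A: "A i \<in> sets M" for i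
    proof (cases "i \<ge> 1")
      case True
      note rv[OF True, measurable]
      show ?thesis unfolding A_def by measurable
    qed (simp add: A_def)
    have pA: "prob (A i) = prob {\<omega> \<in> space M. real i < Y \<omega>}" if i: "i \<ge> 1" for i
    proof -
      have "measure (distr M borel (X i)) {real i<..} = measure (distr M borel Y) {real i<..}"
        using distr[OF i] by simp
      then show ?thesis
        using rv[OF i] i by (simp add: measure_distr A_def vimage_def Int_def conj_commute)
    qed
    have "summable (\<lambda>i. prob (A i))"
    proof (rule summableI_nonneg_bounded)
      fix n
      have "(\<Sum>i<n. prob (A i)) \<le> (\<Sum>i\<in>{1..n} \<union> {0}. prob (A i))"
        by (intro sum_mono2) auto
      also have "\<dots> = (\<Sum>i = 1..n. prob {\<omega> \<in> space M. real i < Y \<omega>})"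
        using pA by (subst sum.union_disjoint) (auto simp: A_def)
      also have "\<dots> = (\<Sum>i = 1..n. expectation (indicator {\<omega> \<in> space M. real i < Y \<omega>}))"
        by (intro sum.cong refl) (auto intro!: arg_cong[of _ _ prob])
      also have "\<dots> = expectation (\<lambda>\<omega>. \<Sum>i = 1..n. indicator {\<omega> \<in> space M. real i < Y \<omega>} \<omega>)"
        by (rule Bochner_Integration.integral_sum[symmetric]) (auto simp: less_top[symmetric])
      also have "\<dots> \<le> expectation Y"
      proof (rule integral_mono)
        show "integrable M (\<lambda>\<omega>. \<Sum>i = 1..n. indicator {\<omega> \<in> space M. real i < Y \<omega>} \<omega> :: real)"
          by (auto simp: less_top[symmetric])
        fix \<omega> assume \<omega>: "\<omega> \<in> space M"
        have "(\<Sum>i = 1..n. indicator {\<omega> \<in> space M. real i < Y \<omega>} \<omega>)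
            = (\<Sum>i = 1..n. if real i < Y \<omega> then 1 else 0 :: real)"
          using \<omega> by (intro sum.cong) (auto simp: indicator_def)
        then show "(\<Sum>i = 1..n. indicator {\<omega> \<in> space M. real i < Y \<omega>} \<omega>) \<le> Y \<omega>"
          using sum_indicator_less_le[OF Y0[of \<omega>], of n] by simp
      qed (rule Y)
      finally show "(\<Sum>i<n. prob (A i)) \<le> expectation Y" .
    qed simp
    then have "AE \<omega> in M. \<forall>\<^sub>F i in sequentially. \<omega> \<in> space M - A i"
      using A by (intro borel_cantelli_AE1) (auto simp: less_top[symmetric])
    then show ?thesis
    proof (rule AE_mp, intro AE_I2 impI)
      fix \<omega> assume "\<omega> \<in> space M" "\<forall>\<^sub>F i in sequentially. \<omega> \<in> space M - A i"
      then obtain n where "\<And>i. i \<ge> n \<Longrightarrow> \<omega> \<in> space M - A i"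
        by (auto simp: eventually_sequentially)
      then have "X i \<omega> - Z i \<omega> = 0" if "i \<ge> max n 1" for i
        using that by (fastforce simp: A_def Z_def truncate_above_def)
      then show "\<forall>\<^sub>F i in sequentially. X i \<omega> - Z i \<omega> = 0"
        unfolding eventually_sequentially by blast
    qed
  qed

  have var: "AE \<omega> in M. (\<lambda>n. (\<Sum>i = 1..nat \<lfloor>\<alpha> ^ n\<rfloor>. Z i \<omega> - \<mu> i) / real (nat \<lfloor>\<alpha> ^ n\<rfloor>)) \<longlonglongrightarrow> 0"
    if \<alpha>: "\<alpha> > 1" for \<alpha> :: real
  proof -
    define k where "k n = nat \<lfloor>\<alpha> ^ n\<rfloor>" for n
    have k1: "k n \<ge> 1" for n unfolding k_def using nat_floor_power_bounds[OF \<alpha>] by blast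
    define V where "V n \<omega> = ((\<Sum>i = 1..k n. Z i \<omega> - \<mu> i) / real (k n))\<^sup>2" for n \<omega>
    have rvV [measurable]: "random_variable borel (V n)" for n
    proof -
      have "random_variable borel (\<lambda>\<omega>. \<Sum>i = 1..k n. Z i \<omega> - \<mu> i)"
        using rvZ by (intro borel_measurable_sum borel_measurable_diff) auto
      then show ?thesis unfolding V_def[abs_def] by measurable
    qed
    have V0: "V n \<omega> \<ge> 0" for n \<omega> by (simp add: V_def)
    define q where "q n \<omega> = (truncate_above (real (k n)) (Y \<omega>))\<^sup>2 / real (k n)" for n \<omega>
    have intq: "integrable M (q n)" for n
    proof (rule integrable_const_bound[of _ "(real (k n))\<^sup>2 / real (k n)"])
      show "AE \<omega> in M. norm (q n \<omega>) \<le> (real (k n))\<^sup>2 / real (k n)"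
        using Y0 by (intro AE_I2) (auto simp: q_def truncate_above_def intro!: divide_right_mono power_mono)
    qed (simp add: q_def[abs_def])
    have intV: "integrable M (V n)" for n
    proof -
      define B where "B = (\<Sum>i = 1..k n. real i + \<bar>\<mu> i\<bar>) / real (k n)"
      have "\<bar>(\<Sum>i = 1..k n. Z i \<omega> - \<mu> i) / real (k n)\<bar> \<le> B" for \<omega>
      proof -
        have "\<bar>\<Sum>i = 1..k n. Z i \<omega> - \<mu> i\<bar> \<le> (\<Sum>i = 1..k n. \<bar>Z i \<omega> - \<mu> i\<bar>)" by (rule sum_abs)
        also have "\<dots> \<le> (\<Sum>i = 1..k n. real i + \<bar>\<mu> i\<bar>)"
        proof (rule sum_mono)
          fix i show "\<bar>Z i \<omega> - \<mu> i\<bar> \<le> real i + \<bar>\<mu> i\<bar>" using Zbnd(3)[of i \<omega>] by linarith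
        qed
        finally show ?thesis by (simp add: B_def divide_right_mono)
      qed
      then have "norm (V n \<omega>) \<le> B\<^sup>2" for \<omega>
        unfolding V_def by (metis abs_ge_zero norm_power power_mono real_norm_def)
      then show ?thesis by (intro integrable_const_bound[of _ "B\<^sup>2"]) auto
    qed
    have EV: "expectation (V n) \<le> expectation (q n)" for n
    proof -
      have "expectation (\<lambda>\<omega>. (\<Sum>i\<in>{1..k n}. Z i \<omega> - expectation (Z i))\<^sup>2)
          \<le> (\<Sum>i\<in>{1..k n}. expectation (\<lambda>\<omega>. (Z i \<omega>)\<^sup>2))"
      proof (rule expectation_square_sum_pairwise_indep[where B = "real (k n)"])
        fix i \<omega> assume "i \<in> {1..k n}"
        then show "\<bar>Z i \<omega>\<bar> \<le> real (k n)" using Zbnd(3)[of i \<omega>] by simp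
      qed (use indepZ rvZ in auto)
      also have "\<dots> \<le> (\<Sum>i\<in>{1..k n}. expectation (\<lambda>\<omega>. (truncate_above (real (k n)) (Y \<omega>))\<^sup>2))"
      proof (rule sum_mono)
        fix i assume i: "i \<in> {1..k n}"
        have "expectation (\<lambda>\<omega>. (Z i \<omega>)\<^sup>2) = expectation (\<lambda>\<omega>. (truncate_above (real i) (Y \<omega>))\<^sup>2)"
          unfolding Z_def using i
          by (intro identically_distributed_transfer[OF rv rvY distr, of i "\<lambda>x. (truncate_above (real i) x)\<^sup>2"]) auto
        also have "\<dots> \<le> expectation (\<lambda>\<omega>. (truncate_above (real (k n)) (Y \<omega>))\<^sup>2)"
        proof (rule integral_mono)
          have int: "integrable M (\<lambda>\<omega>. (truncate_above (real j) (Y \<omega>))\<^sup>2)" for j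
            using Y0 by (intro integrable_const_bound[of _ "(real j)\<^sup>2"] AE_I2)
              (auto simp: truncate_above_def intro!: power_mono)
          show "integrable M (\<lambda>\<omega>. (truncate_above (real i) (Y \<omega>))\<^sup>2)"
            "integrable M (\<lambda>\<omega>. (truncate_above (real (k n)) (Y \<omega>))\<^sup>2)"
            by (rule int)+
          show "(truncate_above (real i) (Y \<omega>))\<^sup>2 \<le> (truncate_above (real (k n)) (Y \<omega>))\<^sup>2" for \<omega>
            using i by (auto simp: truncate_above_def)
        qed
        finally show "expectation (\<lambda>\<omega>. (Z i \<omega>)\<^sup>2) \<le> expectation (\<lambda>\<omega>. (truncate_above (real (k n)) (Y \<omega>))\<^sup>2)" .
      qed
      also have "\<dots> = real (k n) * expectation (\<lambda>\<omega>. (truncate_above (real (k n)) (Y \<omega>))\<^sup>2)"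
        by simp
      finally have "expectation (\<lambda>\<omega>. (\<Sum>i\<in>{1..k n}. Z i \<omega> - \<mu> i)\<^sup>2) / (real (k n))\<^sup>2
          \<le> real (k n) * expectation (\<lambda>\<omega>. (truncate_above (real (k n)) (Y \<omega>))\<^sup>2) / (real (k n))\<^sup>2"
        unfolding \<mu>_def by (rule divide_right_mono) simp
      then show ?thesis
        using k1[of n] by (simp add: V_def[abs_def] q_def[abs_def] power_divide power2_eq_square)
    qed
    define C where "C = 2 * (\<alpha> / (\<alpha> - 1)) * expectation Y"
    \<comment> \<open>Bounded partial sums give the series of the \<open>V n\<close> a finite
      expectation; it then converges almost everywhere and its terms tend to 0.\<close>
    have partial: "(\<Sum>n<N. expectation (V n)) \<le> C" for N
    proof -
      have "(\<Sum>n<N. expectation (V n)) \<le> (\<Sum>n<N. expectation (q n))" by (intro sum_mono EV)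
      also have "\<dots> = expectation (\<lambda>\<omega>. \<Sum>n<N. q n \<omega>)"
        using intq by (simp add: Bochner_Integration.integral_sum)
      also have "\<dots> \<le> expectation (\<lambda>\<omega>. 2 * (\<alpha> / (\<alpha> - 1)) * Y \<omega>)"
      proof (rule integral_mono)
        show "(\<Sum>n<N. q n \<omega>) \<le> 2 * (\<alpha> / (\<alpha> - 1)) * Y \<omega>" for \<omega>
          unfolding q_def k_def by (rule sum_truncated_squares[OF \<alpha> Y0])
      qed (use intq Y in auto)
      finally show ?thesis by (simp add: C_def)
    qed
    have "(\<integral>\<^sup>+\<omega>. (\<Sum>n. ennreal (V n \<omega>)) \<partial>M) = (\<Sum>n. \<integral>\<^sup>+\<omega>. ennreal (V n \<omega>) \<partial>M)"
      by (rule nn_integral_suminf) simp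
    also have "\<dots> = (\<Sum>n. ennreal (expectation (V n)))"
      using intV V0 by (simp add: nn_integral_eq_integral)
    also have "\<dots> \<le> ennreal C"
    proof (rule suminf_le_const)
      show "(\<Sum>n<N. ennreal (expectation (V n))) \<le> ennreal C" for N
        using partial[of N] V0 by (subst sum_ennreal) (auto intro!: ennreal_leI)
    qed simp
    finally have "(\<integral>\<^sup>+\<omega>. (\<Sum>n. ennreal (V n \<omega>)) \<partial>M) \<noteq> \<infinity>"
      by (auto simp: top_unique)
    then have "AE \<omega> in M. (\<Sum>n. ennreal (V n \<omega>)) \<noteq> \<infinity>"
      by (intro nn_integral_PInf_AE) simp_all
    then have "AE \<omega> in M. (\<lambda>n. (\<Sum>i = 1..k n. Z i \<omega> - \<mu> i) / real (k n)) \<longlonglongrightarrow> 0"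
    proof (rule AE_mp, intro AE_I2 impI)
      fix \<omega> assume "(\<Sum>n. ennreal (V n \<omega>)) \<noteq> \<infinity>"
      then have "summable (\<lambda>n. V n \<omega>)" using V0 by (intro summable_suminf_not_top) auto
      then have "(\<lambda>n. V n \<omega>) \<longlonglongrightarrow> 0" by (rule summable_LIMSEQ_zero)
      then have "(\<lambda>n. sqrt (V n \<omega>)) \<longlonglongrightarrow> sqrt 0" by (rule tendsto_real_sqrt)
      then show "(\<lambda>n. (\<Sum>i = 1..k n. Z i \<omega> - \<mu> i) / real (k n)) \<longlonglongrightarrow> 0"
        by (simp add: V_def tendsto_rabs_zero_iff flip: abs_divide)
    qed
    then show ?thesis by (simp add: k_def)
  qed
  have "AE \<omega> in M. \<forall>m::nat. (\<lambda>n. (\<Sum>i = 1..nat \<lfloor>(1 + 1 / real (Suc m)) ^ n\<rfloor>. Z i \<omega> - \<mu> i)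
      / real (nat \<lfloor>(1 + 1 / real (Suc m)) ^ n\<rfloor>)) \<longlonglongrightarrow> 0"
    unfolding AE_all_countable by (intro allI var) simp
  with XZ show ?thesis
  proof (eventually_elim)
    case (elim \<omega>)
    show ?case
    proof (rule tendsto_average_from_geometric_subsequences)
      show "incseq (\<lambda>n. \<Sum>i = 1..n. X i \<omega>)"
        using X0 by (intro incseq_SucI) simp
      show "0 \<le> (\<Sum>i = 1..n. X i \<omega>)" for n using X0 by (simp add: sum_nonneg)
      fix m :: nat
      define \<alpha> where "\<alpha> = 1 + 1 / real (Suc m)"
      have \<alpha>: "\<alpha> > 1" by (simp add: \<alpha>_def)
      define k where "k n = nat \<lfloor>\<alpha> ^ n\<rfloor>" for n
      have k: "filterlim k at_top sequentially"
        unfolding filterlim_at_top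
      proof
        fix c :: nat
        obtain n0 where n0: "real c + 1 < \<alpha> ^ n0" using real_arch_pow[OF \<alpha>] by blast
        have "c \<le> k n" if "n0 \<le> n" for n
          using n0 power_increasing[OF that, of \<alpha>] \<alpha> nat_floor_power_bounds(3)[OF \<alpha>, of n]
          unfolding k_def by linarith
        then show "\<forall>\<^sub>F n in sequentially. c \<le> k n" by (auto simp: eventually_sequentially)
      qed
      have 1: "(\<lambda>n. (\<Sum>i = 1..k n. Z i \<omega> - \<mu> i) / real (k n)) \<longlonglongrightarrow> 0"
        using elim(2) by (simp add: k_def \<alpha>_def)
      have 2: "(\<lambda>n. (\<Sum>i = 1..k n. \<mu> i) / real (k n)) \<longlonglongrightarrow> expectation Y"
        using filterlim_compose[OF tendsto_cesaro_mean[OF \<mu>_lim] k] .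
      have "(\<lambda>i. X i \<omega> - Z i \<omega>) \<longlonglongrightarrow> 0" using elim(1) by (rule tendsto_eventually)
      then have 3: "(\<lambda>n. (\<Sum>i = 1..k n. X i \<omega> - Z i \<omega>) / real (k n)) \<longlonglongrightarrow> 0"
        by (rule filterlim_compose[OF tendsto_cesaro_mean k])
      have "(\<lambda>n. (\<Sum>i = 1..k n. X i \<omega> - Z i \<omega>) / real (k n) + ((\<Sum>i = 1..k n. Z i \<omega> - \<mu> i) / real (k n)
          + (\<Sum>i = 1..k n. \<mu> i) / real (k n))) \<longlonglongrightarrow> 0 + (0 + expectation Y)"
        by (intro tendsto_add 1 2 3)
      then have "(\<lambda>n. (\<Sum>i = 1..k n. X i \<omega>) / real (k n)) \<longlonglongrightarrow> expectation Y"
        by (simp add: sum_subtractf flip: add_divide_distrib)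
      then show "(\<lambda>n. (\<Sum>i = 1..nat \<lfloor>(1 + 1 / real (Suc m)) ^ n\<rfloor>. X i \<omega>)
          / real (nat \<lfloor>(1 + 1 / real (Suc m)) ^ n\<rfloor>)) \<longlonglongrightarrow> expectation Y"
        by (simp add: k_def \<alpha>_def)
    qed
  qed
qed

theorem (in prob_space) strong_law_of_large_numbers:
  fixes X :: "nat \<Rightarrow> 'a \<Rightarrow> real" and Y :: "'a \<Rightarrow> real"
  assumes rv: "\<And>i. i \<ge> 1 \<Longrightarrow> random_variable borel (X i)"
    and indep: "\<And>i j. i \<ge> 1 \<Longrightarrow> j \<ge> 1 \<Longrightarrow> i \<noteq> j \<Longrightarrow> indep_var borel (X i) borel (X j)"
    and distr: "\<And>i. i \<ge> 1 \<Longrightarrow> distr M borel (X i) = distr M borel Y"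
    and Y: "integrable M Y"
  shows "AE \<omega> in M. (\<lambda>n. (\<Sum>i = 1..n. X i \<omega>) / real n) \<longlonglongrightarrow> expectation Y"
proof -
  \<comment> \<open>Used for the positive and for the negative part, whose difference is the
    variable itself; measurable images preserve independence and equality in law.\<close>
  have part: "AE \<omega> in M. (\<lambda>n. (\<Sum>i = 1..n. f (X i \<omega>)) / real n) \<longlonglongrightarrow> expectation (\<lambda>\<omega>. f (Y \<omega>))"
    if f [measurable]: "f \<in> borel_measurable borel" and f0: "\<And>x. 0 \<le> f x" "\<And>x. f x \<le> \<bar>x\<bar>" for f :: "real \<Rightarrow> real"
  proof (rule strong_law_nonneg)
    show "random_variable borel (\<lambda>\<omega>. f (X i \<omega>))" if "i \<ge> 1" for i
      using rv[OF that] by measurable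
    show "indep_var borel (\<lambda>\<omega>. f (X i \<omega>)) borel (\<lambda>\<omega>. f (X j \<omega>))" if "i \<ge> 1" "j \<ge> 1" "i \<noteq> j" for i j
      using indep_var_compose[OF indep[OF that] f f] by (simp add: o_def)
    show "distr M borel (\<lambda>\<omega>. f (X i \<omega>)) = distr M borel (\<lambda>\<omega>. f (Y \<omega>))" if "i \<ge> 1" for i
      using distr_distr[OF f rv[OF that]] distr_distr[OF f borel_measurable_integrable[OF Y]] distr[OF that]
      by (simp add: o_def)
    show "integrable M (\<lambda>\<omega>. f (Y \<omega>))"
      using Y f0 by (intro Bochner_Integration.integrable_bound[OF Y]) (auto intro!: AE_I2)
  qed (use f0 in auto)
  have "AE \<omega> in M. (\<lambda>n. (\<Sum>i = 1..n. max 0 (X i \<omega>)) / real n) \<longlonglongrightarrow> expectation (\<lambda>\<omega>. max 0 (Y \<omega>))"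
    by (rule part) auto
  moreover have "AE \<omega> in M. (\<lambda>n. (\<Sum>i = 1..n. max 0 (- X i \<omega>)) / real n) \<longlonglongrightarrow> expectation (\<lambda>\<omega>. max 0 (- Y \<omega>))"
    by (rule part) auto
  ultimately show ?thesis
  proof eventually_elim
    case (elim \<omega>)
    have "(\<lambda>n. (\<Sum>i = 1..n. max 0 (X i \<omega>)) / real n - (\<Sum>i = 1..n. max 0 (- X i \<omega>)) / real n)
        \<longlonglongrightarrow> expectation (\<lambda>\<omega>. max 0 (Y \<omega>)) - expectation (\<lambda>\<omega>. max 0 (- Y \<omega>))"
      by (intro tendsto_diff elim)
    moreover have "(\<Sum>i = 1..n. max 0 (X i \<omega>)) / real n - (\<Sum>i = 1..n. max 0 (- X i \<omega>)) / real n
        = (\<Sum>i = 1..n. X i \<omega>) / real n" for n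
      by (simp add: sum_subtractf[symmetric] max_def flip: diff_divide_distrib)
        (auto intro!: arg_cong[of _ _ "\<lambda>x. x / real n"] sum.cong)
    moreover have "expectation (\<lambda>\<omega>. max 0 (Y \<omega>)) - expectation (\<lambda>\<omega>. max 0 (- Y \<omega>)) = expectation Y"
    proof -
      have "expectation (\<lambda>\<omega>. max 0 (Y \<omega>)) - expectation (\<lambda>\<omega>. max 0 (- Y \<omega>))
          = expectation (\<lambda>\<omega>. max 0 (Y \<omega>) - max 0 (- Y \<omega>))"
        using Y by (intro Bochner_Integration.integral_diff[symmetric]) auto
      also have "(\<lambda>\<omega>. max 0 (Y \<omega>) - max 0 (- Y \<omega>)) = Y" by (auto simp: max_def)
      finally show ?thesis .
    qed
    ultimately show ?case by simp
  qed
qed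

section \<open>Linear decision rules near a point of the support\<close>

text \<open>Local coordinates: \<open>\<zeta> = z + \<tau> v\<close> with directions
  \<open>v\<close> in the fixed set \<open>V\<close>, where \<open>b\<close> stands for the
  right-hand side at the centre \<open>z\<close>. Because \<open>Y\<close> acts on \<open>v\<close>
  and not on \<open>\<zeta>\<close>, it absorbs the scale, and the conditions are jointly linear in
  \<open>b\<close>, \<open>\<tau>\<close>, \<open>t\<close>, \<open>y0\<close> and \<open>Y\<close>.
  At \<open>\<tau> = 0\<close> a recourse decision for the centre gives a constant solution.\<close>

definition scaled_policy ::
  "(real ^ 'd) set \<Rightarrow> real ^ 'r ^ 'm \<Rightarrow> real ^ 'd ^ 'm \<Rightarrow> real ^ 'r \<Rightarrow> real ^ 'm \<Rightarrow> real \<Rightarrow> real \<Rightarrow> bool" where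
  "scaled_policy V W H q b \<tau> t \<longleftrightarrow> (\<exists>y0 Y. \<forall>v\<in>V.
     (\<forall>i. b $ i + \<tau> * (H *v v) $ i \<le> (W *v (y0 + Y *v v)) $ i) \<and> q \<bullet> (y0 + Y *v v) \<le> t)"

text \<open>For fixed \<open>V\<close>, the triples admitting a policy form a polyhedral cone, so by its finite description
  the price of enlarging the scale from \<open>0\<close> to \<open>\<tau>\<close> is linear in \<open>\<tau>\<close>, uniformly in \<open>b\<close>.\<close>

lemma scaled_policy_uniform_cost:
  fixes V :: "(real ^ 'd) set" and W :: "real ^ 'r ^ 'm"
  assumes "finite V"
  shows "\<exists>C\<ge>0. \<forall>b1 b2 \<theta> \<tau> \<tau>' t t1 t2.
    0 \<le> \<theta> \<and> \<theta> \<le> 1 \<and> 0 \<le> \<tau> \<and> \<tau> \<le> \<theta> * \<tau>' \<and> scaled_policy V W H q b1 0 t1 \<and> scaled_policy V W H q b2 \<tau>' t2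
    \<and> scaled_policy V W H q ((1 - \<theta>) *\<^sub>R b1 + \<theta> *\<^sub>R b2) 0 t
    \<longrightarrow> scaled_policy V W H q ((1 - \<theta>) *\<^sub>R b1 + \<theta> *\<^sub>R b2) \<tau> (t + C * \<tau>)"
proof -
  define S where "S = {x :: ((real ^ 'm) \<times> real) \<times> real. \<exists>y :: (real ^ 'r) \<times> (real ^ 'd ^ 'r). \<forall>v\<in>V.
    (\<forall>i. fst (fst x) $ i + snd (fst x) * (H *v v) $ i \<le> (W *v (fst y + snd y *v v)) $ i)
      \<and> q \<bullet> (fst y + snd y *v v) \<le> snd x}"
  have S: "((b, \<tau>), t) \<in> S \<longleftrightarrow> scaled_policy V W H q b \<tau> t" for b \<tau> t
    by (simp add: S_def scaled_policy_def)
  have lin: "linear (\<lambda>z :: (((real ^ 'm) \<times> real) \<times> real) \<times> ((real ^ 'r) \<times> (real ^ 'd ^ 'r)).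
      fst (snd z) + snd (snd z) *v v)" for v
    by (auto intro!: linearI simp: matrix_vector_mult_add_rdistrib scaleR_matrix_vector_assoc algebra_simps)
  have pS: "polyhedral_cone S"
    unfolding S_def
    using linear_compose[OF lin bounded_linear.linear[OF bounded_linear_inner_right[of q]]]
    by (intro polyhedral_cone_ex polyhedral_cone_conj polyhedral_cone_all polyhedral_cone_ball
        polyhedral_cone_le linear_mult_vec_nth lin assms)
      (auto intro!: linearI simp: o_def algebra_simps)
  have up: "(0, 1) \<in> S" unfolding S_def by (auto intro!: exI[of _ 0])
  obtain R L where RL: "finite R" "finite L"
    "\<And>s t. (s, t) \<in> S \<longleftrightarrow> (\<forall>r\<in>R. r \<bullet> s \<le> 0) \<and> (\<forall>l\<in>L. l \<bullet> s \<le> t)"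
    using polyhedral_cone_epigraph[OF pS up] by blast
  have rows: "scaled_policy V W H q b \<tau> t \<longleftrightarrow>
      (\<forall>r\<in>R. fst r \<bullet> b + snd r * \<tau> \<le> 0) \<and> (\<forall>l\<in>L. fst l \<bullet> b + snd l * \<tau> \<le> t)" for b \<tau> t
    using S[of b \<tau> t] RL(3)[of "(b, \<tau>)" t] by (simp add: inner_prod_def)
  define C where "C = (\<Sum>l\<in>L. \<bar>snd l\<bar>)"
  show ?thesis
  proof (intro exI[of _ C] conjI allI impI)
    show "C \<ge> 0" by (simp add: C_def sum_nonneg)
    fix b1 b2 \<theta> \<tau> \<tau>' t t1 t2
    assume *: "0 \<le> \<theta> \<and> \<theta> \<le> 1 \<and> 0 \<le> \<tau> \<and> \<tau> \<le> \<theta> * \<tau>' \<and> scaled_policy V W H q b1 0 t1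
      \<and> scaled_policy V W H q b2 \<tau>' t2 \<and> scaled_policy V W H q ((1 - \<theta>) *\<^sub>R b1 + \<theta> *\<^sub>R b2) 0 t"
    define b where "b = (1 - \<theta>) *\<^sub>R b1 + \<theta> *\<^sub>R b2"
    have "fst r \<bullet> b + snd r * \<tau> \<le> 0" if r: "r \<in> R" for r
    proof -
      have b0: "fst r \<bullet> b \<le> 0" using * r unfolding rows b_def by simp
      \<comment> \<open>Combining the rows of the two given policies yields the row at scale
        \<open>\<theta> * \<tau>'\<close>, and \<open>b0\<close> is the row at scale 0. Being affine
        in the scale, it holds in between.\<close>
      have "(1 - \<theta>) * (fst r \<bullet> b1) \<le> 0" "\<theta> * (fst r \<bullet> b2 + snd r * \<tau>') \<le> 0"
        using * r unfolding rows by (auto intro!: mult_nonneg_nonpos)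
      then have b1: "fst r \<bullet> b + snd r * (\<theta> * \<tau>') \<le> 0"
        by (simp add: b_def inner_add_right algebra_simps)
      show ?thesis
      proof (cases "snd r \<le> 0")
        case True
        then have "snd r * \<tau> \<le> 0" using * by (simp add: mult_nonpos_nonneg)
        then show ?thesis using b0 by simp
      next
        case False
        then have "snd r * \<tau> \<le> snd r * (\<theta> * \<tau>')" using * by (intro mult_left_mono) auto
        then show ?thesis using b1 by simp
      qed
    qed
    \<comment> \<open>The price is measured from the value \<open>t\<close> at scale 0, so it does
      not depend on how expensive the policy for \<open>b2\<close> is.\<close>
    moreover have "fst l \<bullet> b + snd l * \<tau> \<le> t + C * \<tau>" if l: "l \<in> L" for l
    proof -
      have "fst l \<bullet> b \<le> t" using * l unfolding rows b_def by simp
      moreover have "\<bar>snd l\<bar> \<le> C" unfolding C_def using l RL(2) by (intro member_le_sum) auto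
      then have "snd l * \<tau> \<le> C * \<tau>" using * by (intro mult_right_mono) auto
      ultimately show ?thesis by simp
    qed
    ultimately show "scaled_policy V W H q ((1 - \<theta>) *\<^sub>R b1 + \<theta> *\<^sub>R b2) \<tau> (t + C * \<tau>)"
      unfolding rows b_def by blast
  qed
qed

section \<open>The second stage in dual form\<close>

locale two_stage =
  fixes q :: "real ^ 'r" and T :: "real ^ 'n ^ 'm" and W :: "real ^ 'r ^ 'm"
    and h0 :: "real ^ 'm" and H :: "real ^ 'd ^ 'm" and G :: "real ^ 'd ^ 'k" and g :: "real ^ 'k"
    and R L :: "(real ^ 'm) set"
  assumes finite_R: "finite R" and finite_L: "finite L" and L_nonempty: "L \<noteq> {}"
    and lp_value: "\<And>b t. (\<exists>y. b \<le> W *v y \<and> q \<bullet> y \<le> t) \<longleftrightarrow> (\<forall>r\<in>R. r \<bullet> b \<le> 0) \<and> (\<forall>l\<in>L. l \<bullet> b \<le> t)"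
begin

definition rhs :: "real ^ 'n \<Rightarrow> real ^ 'd \<Rightarrow> real ^ 'm" where
  "rhs x \<zeta> = h0 + H *v \<zeta> - T *v x"

definition feasible_at :: "real ^ 'n \<Rightarrow> real ^ 'd \<Rightarrow> bool" where
  "feasible_at x \<zeta> \<longleftrightarrow> (\<forall>r\<in>R. r \<bullet> rhs x \<zeta> \<le> 0)"

text \<open>The same maximum is taken where the second stage is infeasible. The function is
  therefore real-valued and Lipschitz everywhere, and infeasibility is recorded by
  \<open>feasible_at\<close> alone.\<close>

definition dual_value :: "real ^ 'n \<Rightarrow> real ^ 'd \<Rightarrow> real" where
  "dual_value x \<zeta> = Max ((\<lambda>l. l \<bullet> rhs x \<zeta>) ` L)"

definition lip :: real where "lip = (\<Sum>l\<in>L. norm l)"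

lemma lip_nonneg: "lip \<ge> 0"
  by (simp add: lip_def sum_nonneg)

lemma dual_value_le_iff: "dual_value x \<zeta> \<le> t \<longleftrightarrow> (\<forall>l\<in>L. l \<bullet> rhs x \<zeta> \<le> t)"
  using finite_L L_nonempty by (simp add: dual_value_def)

lemma le_dual_value: "l \<in> L \<Longrightarrow> l \<bullet> rhs x \<zeta> \<le> dual_value x \<zeta>"
  using dual_value_le_iff[of x \<zeta> "dual_value x \<zeta>"] by simp

lemma recourse_iff:
  "(\<exists>y. rhs x \<zeta> \<le> W *v y \<and> q \<bullet> y \<le> t) \<longleftrightarrow> feasible_at x \<zeta> \<and> dual_value x \<zeta> \<le> t"
  using lp_value[of "rhs x \<zeta>" t] by (simp add: feasible_at_def dual_value_le_iff)

lemma rhs_le_iff: "rhs x \<zeta> \<le> b \<longleftrightarrow> h0 + H *v \<zeta> \<le> T *v x + b"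
  by (simp add: rhs_def less_eq_vec_def algebra_simps)

lemma rhs_convex_comb:
  "rhs ((1 - \<theta>) *\<^sub>R x + \<theta> *\<^sub>R y) \<zeta> = (1 - \<theta>) *\<^sub>R rhs x \<zeta> + \<theta> *\<^sub>R rhs y \<zeta>"
  by (simp add: rhs_def matrix_vector_right_distrib matrix_vector_mult_scaleR algebra_simps)

lemma feasible_at_convex_comb:
  assumes "feasible_at x \<zeta>" "feasible_at y \<zeta>" "0 \<le> \<theta>" "\<theta> \<le> 1"
  shows "feasible_at ((1 - \<theta>) *\<^sub>R x + \<theta> *\<^sub>R y) \<zeta>"
  unfolding feasible_at_def
proof
  fix r assume r: "r \<in> R"
  have "(1 - \<theta>) * (r \<bullet> rhs x \<zeta>) \<le> 0" "\<theta> * (r \<bullet> rhs y \<zeta>) \<le> 0"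
    using assms r by (auto simp: feasible_at_def intro!: mult_nonneg_nonpos)
  then show "r \<bullet> rhs ((1 - \<theta>) *\<^sub>R x + \<theta> *\<^sub>R y) \<zeta> \<le> 0"
    by (simp add: rhs_convex_comb inner_add_right)
qed

lemma dual_value_convex_comb:
  assumes "0 \<le> \<theta>" "\<theta> \<le> 1"
  shows "dual_value ((1 - \<theta>) *\<^sub>R x + \<theta> *\<^sub>R y) \<zeta> \<le> (1 - \<theta>) * dual_value x \<zeta> + \<theta> * dual_value y \<zeta>"
  unfolding dual_value_le_iff rhs_convex_comb inner_add_right inner_scaleR_right
  using assms by (intro ballI add_mono mult_left_mono le_dual_value) auto

lemma dual_value_diff_le: "dual_value x \<zeta> \<le> dual_value y \<zeta>' + lip * norm (rhs x \<zeta> - rhs y \<zeta>')"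
  unfolding dual_value_le_iff
proof
  fix l assume l: "l \<in> L"
  have "l \<bullet> rhs x \<zeta> = l \<bullet> rhs y \<zeta>' + l \<bullet> (rhs x \<zeta> - rhs y \<zeta>')" by (simp add: inner_diff_right)
  also have "l \<bullet> (rhs x \<zeta> - rhs y \<zeta>') \<le> norm l * norm (rhs x \<zeta> - rhs y \<zeta>')" by (rule norm_cauchy_schwarz)
  also have "\<dots> \<le> lip * norm (rhs x \<zeta> - rhs y \<zeta>')"
    unfolding lip_def using l finite_L by (intro mult_right_mono member_le_sum) auto
  finally show "l \<bullet> rhs x \<zeta> \<le> dual_value y \<zeta>' + lip * norm (rhs x \<zeta> - rhs y \<zeta>')"
    using le_dual_value[OF l, of y \<zeta>'] by linarith
qed

text \<open>A ray \<open>r\<close> that some point of the support violates at \<open>x\<close> has positive slack to gain by moving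
  towards \<open>xb\<close>, which is feasible on the whole support.\<close>

lemma feasible_near_feasible:
  assumes xb: "\<And>\<zeta>. g \<le> G *v \<zeta> \<Longrightarrow> feasible_at xb \<zeta>" and \<theta>: "0 < \<theta>" "\<theta> \<le> 1"
  shows "\<exists>d>0. \<forall>\<xi> \<zeta>. g \<le> G *v \<zeta> \<and> feasible_at x \<xi> \<and> norm (\<zeta> - \<xi>) \<le> d
    \<longrightarrow> feasible_at ((1 - \<theta>) *\<^sub>R x + \<theta> *\<^sub>R xb) \<zeta>"
proof -
  obtain B where B: "B > 0" "\<And>v. norm (H *v v) \<le> B * norm v"
    using linear_bounded_pos[OF matrix_vector_mul_linear[of H]] by blast
  have "\<exists>d>0. \<forall>\<xi> \<zeta>. g \<le> G *v \<zeta> \<and> feasible_at x \<xi> \<and> norm (\<zeta> - \<xi>) \<le> d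
      \<longrightarrow> r \<bullet> rhs ((1 - \<theta>) *\<^sub>R x + \<theta> *\<^sub>R xb) \<zeta> \<le> 0" if r: "r \<in> R" for r
  proof (cases "\<forall>\<zeta>. g \<le> G *v \<zeta> \<longrightarrow> r \<bullet> rhs x \<zeta> \<le> 0")
    case True
    have "r \<bullet> rhs ((1 - \<theta>) *\<^sub>R x + \<theta> *\<^sub>R xb) \<zeta> \<le> 0" if "g \<le> G *v \<zeta>" for \<zeta>
    proof -
      have "(1 - \<theta>) * (r \<bullet> rhs x \<zeta>) \<le> 0" "\<theta> * (r \<bullet> rhs xb \<zeta>) \<le> 0"
        using True xb[OF that] that r \<theta> by (auto simp: feasible_at_def intro!: mult_nonneg_nonpos)
      then show ?thesis by (simp add: rhs_convex_comb inner_add_right)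
    qed
    then show ?thesis by (intro exI[of _ 1]) auto
  next
    case False
    then obtain \<zeta>0 where \<zeta>0: "g \<le> G *v \<zeta>0" "r \<bullet> rhs x \<zeta>0 > 0" by (auto simp: not_le)
    \<comment> \<open>The gain is the same at every point of the support, because \<open>rhs\<close>
      separates the decision from the uncertainty.\<close>
    define \<delta> where "\<delta> = r \<bullet> (T *v xb) - r \<bullet> (T *v x)"
    have "\<delta> > 0"
    proof -
      have "r \<bullet> rhs xb \<zeta>0 \<le> 0" using xb[OF \<zeta>0(1)] r by (simp add: feasible_at_def)
      then show ?thesis using \<zeta>0(2) by (simp add: \<delta>_def rhs_def inner_diff_right inner_add_right)
    qed
    \<comment> \<open>Moving the uncertainty by at most \<open>d\<close> changes the row by at most
      \<open>\<theta> * \<delta>\<close>, the gain from the mixture; the added 1 keeps the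
      denominator positive.\<close>
    define d where "d = \<theta> * \<delta> / (norm r * B + 1)"
    have nB: "norm r * B + 1 > 0" using B(1) by (simp add: add_nonneg_pos)
    have "d > 0" using \<open>\<delta> > 0\<close> \<theta> nB by (simp add: d_def)
    moreover have "r \<bullet> rhs ((1 - \<theta>) *\<^sub>R x + \<theta> *\<^sub>R xb) \<zeta> \<le> 0"
      if "feasible_at x \<xi>" "norm (\<zeta> - \<xi>) \<le> d" for \<xi> \<zeta>
    proof -
      have "r \<bullet> rhs ((1 - \<theta>) *\<^sub>R x + \<theta> *\<^sub>R xb) \<zeta> = r \<bullet> rhs x \<xi> + r \<bullet> (H *v (\<zeta> - \<xi>)) - \<theta> * \<delta>"
        by (simp add: rhs_def \<delta>_def matrix_vector_right_distrib matrix_vector_mult_scaleR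
            matrix_vector_mult_diff_distrib algebra_simps inner_simps)
      moreover have "r \<bullet> rhs x \<xi> \<le> 0" using that r by (simp add: feasible_at_def)
      moreover have "r \<bullet> (H *v (\<zeta> - \<xi>)) \<le> \<theta> * \<delta>"
      proof -
        have "r \<bullet> (H *v (\<zeta> - \<xi>)) \<le> norm r * norm (H *v (\<zeta> - \<xi>))" by (rule norm_cauchy_schwarz)
        also have "\<dots> \<le> norm r * (B * d)"
          using order_trans[OF B(2) mult_left_mono[OF that(2) less_imp_le[OF B(1)]]]
          by (intro mult_left_mono) auto
        also have "\<dots> \<le> (norm r * B + 1) * d" using \<open>d > 0\<close> by (simp add: algebra_simps)
        also have "\<dots> = \<theta> * \<delta>" using nB by (simp add: d_def)
        finally show ?thesis .
      qed
      ultimately show ?thesis by linarith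
    qed
    ultimately show ?thesis by blast
  qed
  then obtain f where f: "\<And>r. r \<in> R \<Longrightarrow> f r > 0 \<and> (\<forall>\<xi> \<zeta>. g \<le> G *v \<zeta> \<and> feasible_at x \<xi> \<and> norm (\<zeta> - \<xi>) \<le> f r
      \<longrightarrow> r \<bullet> rhs ((1 - \<theta>) *\<^sub>R x + \<theta> *\<^sub>R xb) \<zeta> \<le> 0)"
    by metis
  \<comment> \<open>The element 1 covers the case of an empty \<open>R\<close>.\<close>
  define d where "d = Min (insert 1 (f ` R))"
  have "d > 0" using f finite_R by (auto simp: d_def)
  moreover have "d \<le> f r" if "r \<in> R" for r using that finite_R by (auto simp: d_def)
  ultimately show ?thesis
    using f unfolding feasible_at_def[of "(1 - \<theta>) *\<^sub>R x + \<theta> *\<^sub>R xb"] by (meson order_trans)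
qed

text \<open>At a point of the support with active constraints \<open>I\<close> these are the
  directions that keep them satisfied, cut off by the unit box so that finitely many generators
  suffice for checking a rule.\<close>

lemma face_directions_polytope:
  "\<exists>V. finite V \<and> {v. (\<forall>j\<in>I. 0 \<le> (G *v v) $ j) \<and> (\<forall>i. \<bar>v $ i\<bar> \<le> 1)} = convex hull V"
proof -
  have "polyhedral_cone {v. \<forall>j\<in>I. 0 \<le> (G *v v) $ j}"
    by (intro polyhedral_cone_ball polyhedral_cone_le linear_mult_vec_nth) (auto intro!: linearI)
  then have "polytope (cbox (- 1) (1 :: real ^ 'd) \<inter> {v. \<forall>j\<in>I. 0 \<le> (G *v v) $ j})"
    by (simp add: polyhedral_cone_def polytope_Int_polyhedron polytope_interval)
  also have "cbox (- 1) (1 :: real ^ 'd) \<inter> {v. \<forall>j\<in>I. 0 \<le> (G *v v) $ j}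
      = {v. (\<forall>j\<in>I. 0 \<le> (G *v v) $ j) \<and> (\<forall>i. \<bar>v $ i\<bar> \<le> 1)}"
    by (auto simp: mem_box_cart abs_le_iff minus_le_iff)
  finally show ?thesis by (simp add: polytope_def)
qed

lemma scaled_policy_zero:
  assumes "feasible_at x \<zeta>" "dual_value x \<zeta> \<le> t"
  shows "scaled_policy V W H q (rhs x \<zeta>) 0 t"
proof -
  obtain y where "rhs x \<zeta> \<le> W *v y" "q \<bullet> y \<le> t" using assms recourse_iff by blast
  then show ?thesis
    unfolding scaled_policy_def by (intro exI[of _ y] exI[of _ 0]) (auto simp: less_eq_vec_def)
qed

lemma rhs_shift: "rhs x (z + \<tau> *\<^sub>R v) $ i = rhs x z $ i + \<tau> * (H *v v) $ i"
  by (simp add: rhs_def matrix_vector_right_distrib matrix_vector_mult_scaleR)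

text \<open>Substituting \<open>\<zeta> = z + \<tau> v\<close> turns a rule on the uncertainty into
  one on directions. The crude \<open>t\<close> is enough: the result only certifies solvability at
  this scale.\<close>

lemma scaled_policy_of_linear_rule:
  assumes "y \<in> linear_decision_rules" "finite V"
    and "\<And>v. v \<in> V \<Longrightarrow> rhs x (z + \<tau> *\<^sub>R v) \<le> W *v y (z + \<tau> *\<^sub>R v)"
  shows "\<exists>t. scaled_policy V W H q (rhs x z) \<tau> t"
proof -
  obtain a A where y: "y = (\<lambda>\<zeta>. a + A *v \<zeta>)" using assms(1) by (auto simp: linear_decision_rules_def)
  have eq: "a + A *v z + (\<tau> *\<^sub>R A) *v v = y (z + \<tau> *\<^sub>R v)" for v
    by (simp add: y matrix_vector_right_distrib matrix_vector_mult_scaleR scaleR_matrix_vector_assoc algebra_simps)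
  define t where "t = (\<Sum>v\<in>V. \<bar>q \<bullet> y (z + \<tau> *\<^sub>R v)\<bar>)"
  have "q \<bullet> y (z + \<tau> *\<^sub>R v) \<le> t" if "v \<in> V" for v
  proof -
    have "\<bar>q \<bullet> y (z + \<tau> *\<^sub>R v)\<bar> \<le> t"
      unfolding t_def using that assms(2) by (intro member_le_sum) auto
    then show ?thesis by linarith
  qed
  then have "scaled_policy V W H q (rhs x z) \<tau> t"
    unfolding scaled_policy_def
    using assms(3)
    by (intro exI[of _ "a + A *v z"] exI[of _ "\<tau> *\<^sub>R A"]) (simp add: eq less_eq_vec_def rhs_shift)
  then show ?thesis by blast
qed

text \<open>Division by \<open>\<tau>\<close> turns directions back into uncertainties. All
  conditions are affine in \<open>v\<close>, so they extend from the generators to the convex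
  hull.\<close>

lemma linear_rule_of_scaled_policy:
  assumes "scaled_policy V W H q (rhs x z) \<tau> t" "\<tau> > 0"
  obtains y where "y \<in> linear_decision_rules"
    "\<And>v. v \<in> convex hull V \<Longrightarrow>
      rhs x (z + \<tau> *\<^sub>R v) \<le> W *v y (z + \<tau> *\<^sub>R v) \<and> q \<bullet> y (z + \<tau> *\<^sub>R v) \<le> t"
proof -
  obtain y0 Y where yY: "\<And>v i. v \<in> V \<Longrightarrow> rhs x z $ i + \<tau> * (H *v v) $ i \<le> (W *v (y0 + Y *v v)) $ i"
    "\<And>v. v \<in> V \<Longrightarrow> q \<bullet> (y0 + Y *v v) \<le> t"
    using assms(1) unfolding scaled_policy_def by blast
  define y where "y \<zeta> = (y0 - Y *v (z /\<^sub>R \<tau>)) + (Y /\<^sub>R \<tau>) *v \<zeta>" for \<zeta>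
  have y: "y (z + \<tau> *\<^sub>R v) = y0 + Y *v v" for v
    using assms(2)
    by (simp add: y_def matrix_vector_right_distrib matrix_vector_mult_scaleR
        scaleR_matrix_vector_assoc[symmetric] scaleR_add_right)
  let ?A = "{v. (\<forall>i. rhs x z $ i + \<tau> * (H *v v) $ i \<le> (W *v (y0 + Y *v v)) $ i) \<and> q \<bullet> (y0 + Y *v v) \<le> t}"
  have "convex ?A"
  proof (rule convexI)
    fix u v :: "real ^ 'd" and a b :: real
    assume u: "u \<in> ?A" and v: "v \<in> ?A" and ab: "0 \<le> a" "0 \<le> b" "a + b = 1"
    have y0: "y0 = a *\<^sub>R y0 + b *\<^sub>R y0" using ab by (simp flip: scaleR_add_left)
    have eq: "y0 + Y *v (a *\<^sub>R u + b *\<^sub>R v) = a *\<^sub>R (y0 + Y *v u) + b *\<^sub>R (y0 + Y *v v)"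
      by (subst y0) (simp add: matrix_vector_right_distrib matrix_vector_mult_scaleR algebra_simps)
    have "rhs x z $ i + \<tau> * (H *v (a *\<^sub>R u + b *\<^sub>R v)) $ i
        \<le> (W *v (y0 + Y *v (a *\<^sub>R u + b *\<^sub>R v))) $ i" for i
    proof -
      have r: "rhs x z $ i = a * rhs x z $ i + b * rhs x z $ i" using ab by (simp flip: distrib_right)
      have "rhs x z $ i + \<tau> * (H *v (a *\<^sub>R u + b *\<^sub>R v)) $ i
          = a * (rhs x z $ i + \<tau> * (H *v u) $ i) + b * (rhs x z $ i + \<tau> * (H *v v) $ i)"
        by (subst r) (simp add: matrix_vector_right_distrib matrix_vector_mult_scaleR algebra_simps)
      also have "\<dots> \<le> a * (W *v (y0 + Y *v u)) $ i + b * (W *v (y0 + Y *v v)) $ i"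
        using u v ab by (intro add_mono mult_left_mono) auto
      also have "\<dots> = (W *v (y0 + Y *v (a *\<^sub>R u + b *\<^sub>R v))) $ i"
        unfolding eq by (simp add: matrix_vector_right_distrib matrix_vector_mult_scaleR)
      finally show ?thesis .
    qed
    moreover have "q \<bullet> (y0 + Y *v (a *\<^sub>R u + b *\<^sub>R v)) \<le> t"
    proof -
      have "q \<bullet> (y0 + Y *v (a *\<^sub>R u + b *\<^sub>R v)) = a * (q \<bullet> (y0 + Y *v u)) + b * (q \<bullet> (y0 + Y *v v))"
        unfolding eq by (simp only: inner_add_right[of q "a *\<^sub>R _"] inner_scaleR_right)
      also have "\<dots> \<le> a * t + b * t" using u v ab by (intro add_mono mult_left_mono) auto
      also have "\<dots> = t" using ab by (simp flip: distrib_right)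
      finally show ?thesis .
    qed
    ultimately show "a *\<^sub>R u + b *\<^sub>R v \<in> ?A" by blast
  qed
  then have "convex hull V \<subseteq> ?A"
    using yY by (intro hull_minimal) auto
  then have "rhs x (z + \<tau> *\<^sub>R v) \<le> W *v y (z + \<tau> *\<^sub>R v) \<and> q \<bullet> y (z + \<tau> *\<^sub>R v) \<le> t"
    if "v \<in> convex hull V" for v
    using that by (auto simp: y less_eq_vec_def rhs_shift)
  moreover have "y \<in> linear_decision_rules"
    unfolding linear_decision_rules_def y_def[abs_def] by blast
  ultimately show thesis using that by blast
qed

end

context two_stage
begin

text \<open>Around a well-separated point \<open>z\<close> near \<open>\<xi>\<close> the support looks at scale \<open>\<rho>\<close> like one of the finitely
  many cones of face directions, and the uniform cost bound applies to that cone.\<close>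

lemma local_linear_rule:
  fixes e :: real and x xb :: "real ^ 'n" and p :: ereal
  assumes p: "p \<ge> 1" and e: "e > 0" and \<theta>: "0 < \<theta>" "\<theta> \<le> 1"
    and xb: "\<And>z. g \<le> G *v z \<Longrightarrow> \<exists>y\<in>linear_decision_rules.
      \<forall>\<zeta>\<in>lp_ball p z e. g \<le> G *v \<zeta> \<longrightarrow> rhs xb \<zeta> \<le> W *v y \<zeta>"
    and x'_def: "x' = (1 - \<theta>) *\<^sub>R x + \<theta> *\<^sub>R xb" and x''_def: "x'' = (1 - \<theta>) *\<^sub>R x' + \<theta> *\<^sub>R xb"
  shows "\<exists>C d0. C \<ge> 0 \<and> d0 > 0 \<and> (\<forall>\<xi> d. g \<le> G *v \<xi> \<and> feasible_at x \<xi> \<and> 0 < d \<and> d \<le> d0 \<longrightarrow>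
    (\<exists>y\<in>linear_decision_rules. \<forall>\<zeta>. g \<le> G *v \<zeta> \<and> norm (\<zeta> - \<xi>) \<le> d \<longrightarrow>
      rhs x'' \<zeta> \<le> W *v y \<zeta> \<and> q \<bullet> y \<zeta> \<le> dual_value x'' \<xi> + C * d))"
proof -
  have xb_feas: "feasible_at xb \<zeta>" if \<zeta>: "g \<le> G *v \<zeta>" for \<zeta>
  proof -
    obtain y where "\<forall>\<zeta>'\<in>lp_ball p \<zeta> e. g \<le> G *v \<zeta>' \<longrightarrow> rhs xb \<zeta>' \<le> W *v y \<zeta>'"
      using xb[OF \<zeta>] by blast
    then have "rhs xb \<zeta> \<le> W *v y \<zeta>" using \<zeta> p e by (simp add: lp_ball_def)
    then show ?thesis using recourse_iff[of xb \<zeta> "q \<bullet> y \<zeta>"] by blast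
  qed
  \<comment> \<open>Purpose of the first mixture: \<open>x\<close> is known to be feasible at
    \<open>\<xi>\<close> only, whereas \<open>x'\<close> is feasible at nearby points of the
    support, in particular at the centre \<open>z\<close> below.\<close>
  obtain d1 where d1: "d1 > 0" "\<And>\<xi> \<zeta>. g \<le> G *v \<zeta> \<Longrightarrow> feasible_at x \<xi> \<Longrightarrow> norm (\<zeta> - \<xi>) \<le> d1 \<Longrightarrow> feasible_at x' \<zeta>"
    using feasible_near_feasible[OF xb_feas \<theta>, of x] unfolding x'_def by blast
  define n where "n = real CARD('d)"
  have n: "n \<ge> 1" by (simp add: n_def Suc_le_eq)
  obtain BH where BH: "BH > 0" "\<And>v. norm (H *v v) \<le> BH * norm v"
    using linear_bounded_pos[OF matrix_vector_mul_linear[of H]] by blast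
  obtain BG where BG: "BG > 0" "\<And>v. norm (G *v v) \<le> BG * norm v"
    using linear_bounded_pos[OF matrix_vector_mul_linear[of G]] by blast
  define D where "D I = {v. (\<forall>j\<in>I. 0 \<le> (G *v v) $ j) \<and> (\<forall>i. \<bar>v $ i\<bar> \<le> 1)}" for I
  obtain V where V: "\<And>I. finite (V I)" "\<And>I. D I = convex hull (V I)"
    using face_directions_polytope unfolding D_def by metis
  have D_norm: "norm v \<le> n" if "v \<in> D I" for v I
  proof -
    have "norm v \<le> (\<Sum>i\<in>UNIV. \<bar>v $ i\<bar>)" by (rule norm_le_l1_cart)
    also have "\<dots> \<le> (\<Sum>i\<in>(UNIV::'d set). 1)" using that by (intro sum_mono) (auto simp: D_def)
    finally show ?thesis by (simp add: n_def)
  qed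
  obtain Cf where Cf: "\<And>I. Cf I \<ge> 0" "\<And>I b1 b2 \<theta> \<tau> \<tau>' t t1 t2.
      0 \<le> \<theta> \<Longrightarrow> \<theta> \<le> 1 \<Longrightarrow> 0 \<le> \<tau> \<Longrightarrow> \<tau> \<le> \<theta> * \<tau>' \<Longrightarrow> scaled_policy (V I) W H q b1 0 t1 \<Longrightarrow>
      scaled_policy (V I) W H q b2 \<tau>' t2 \<Longrightarrow> scaled_policy (V I) W H q ((1 - \<theta>) *\<^sub>R b1 + \<theta> *\<^sub>R b2) 0 t \<Longrightarrow>
      scaled_policy (V I) W H q ((1 - \<theta>) *\<^sub>R b1 + \<theta> *\<^sub>R b2) \<tau> (t + Cf I * \<tau>)"
    using scaled_policy_uniform_cost[OF V(1), of _ W H q] by metis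
  define Cm where "Cm = (\<Sum>I\<in>UNIV. Cf I)"
  have Cm: "Cf I \<le> Cm" "0 \<le> Cm" for I
  proof -
    show "Cf I \<le> Cm" unfolding Cm_def using Cf(1) by (intro member_le_sum) auto
    then show "0 \<le> Cm" using Cf(1)[of I] by linarith
  qed
  \<comment> \<open>Chosen so that \<open>K * \<rho>\<close> equals
    \<open>\<tau>' * (BG * n)\<close>, a bound for the change of any constraint over displacements
    of scale \<open>\<tau>' = 2 * \<rho> / \<theta>\<close>; constraints inactive at
    \<open>z\<close> thus stay satisfied.\<close>
  define K where "K = (2 / \<theta>) * (BG * n)"
  have K: "K \<ge> 0" using \<theta> BG n by (simp add: K_def)
  obtain C1 d2 where C1: "C1 \<ge> 1" and d2: "d2 > 0" and sep: "\<And>x d. g \<le> G *v x \<Longrightarrow> 0 < d \<Longrightarrow> d \<le> d2 \<Longrightarrow>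
      \<exists>z \<rho>. g \<le> G *v z \<and> d \<le> \<rho> \<and> \<rho> \<le> C1 * d \<and> norm (z - x) \<le> \<rho> \<and>
        (\<forall>j. (G *v z) $ j = g $ j \<or> K * \<rho> \<le> (G *v z) $ j - g $ j)"
    using polyhedron_well_separated_point[OF K, of g G] by metis
  \<comment> \<open>Keeps displacements of scale \<open>\<tau>'\<close> in the ball of radius
    \<open>e\<close> where the rule for \<open>xb\<close> is valid. One factor \<open>n\<close>
    bounds the directions, the other compares the norms.\<close>
  define d3 where "d3 = e * \<theta> / (2 * n\<^sup>2)"
  have d3: "d3 > 0" using e \<theta> n by (simp add: d3_def)
  define d0 where "d0 = Min {d2, d1 / C1, d3 / C1}"
  \<comment> \<open>The first term pays for the move from \<open>\<xi>\<close> to \<open>z\<close>,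
    the second for the scale \<open>\<tau> \<le> 2 * C1 * d\<close>.\<close>
  define C where "C = lip * BH * C1 + 2 * Cm * C1"
  have "C \<ge> 0" using lip_nonneg BH Cm C1 by (simp add: C_def)
  moreover have "d0 > 0" using d1 d2 d3 C1 by (simp add: d0_def)
  moreover have "\<exists>y\<in>linear_decision_rules. \<forall>\<zeta>. g \<le> G *v \<zeta> \<and> norm (\<zeta> - \<xi>) \<le> d \<longrightarrow>
      rhs x'' \<zeta> \<le> W *v y \<zeta> \<and> q \<bullet> y \<zeta> \<le> dual_value x'' \<xi> + C * d"
    if \<xi>: "g \<le> G *v \<xi>" "feasible_at x \<xi>" and d: "0 < d" "d \<le> d0" for \<xi> d
  proof -
    have dd: "d \<le> d2" "C1 * d \<le> d1" "C1 * d \<le> d3"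
      using d C1 by (auto simp: d0_def field_simps)
    obtain z \<rho> where z: "g \<le> G *v z" "d \<le> \<rho>" "\<rho> \<le> C1 * d" "norm (z - \<xi>) \<le> \<rho>"
      "\<And>j. (G *v z) $ j = g $ j \<or> K * \<rho> \<le> (G *v z) $ j - g $ j"
      using sep[OF \<xi>(1) d(1) dd(1)] by blast
    have \<rho>: "\<rho> > 0" using z d by linarith
    define I where "I = {j. (G *v z) $ j = g $ j}"
    \<comment> \<open>One \<open>\<rho>\<close> for the distance from \<open>\<xi>\<close> to
      \<open>z\<close>, the other for the radius \<open>d \<le> \<rho>\<close> around
      \<open>\<xi>\<close>.\<close>
    define \<tau> where "\<tau> = 2 * \<rho>"
    \<comment> \<open>The scale at which \<open>xb\<close> needs a policy so that a mixture with
      weight \<open>\<theta>\<close> has one at scale \<open>\<tau>\<close>.\<close>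
    define \<tau>' where "\<tau>' = \<tau> / \<theta>"
    have \<tau>: "\<tau> > 0" "\<tau>' > 0" "\<tau> = \<theta> * \<tau>'" using \<rho> \<theta> by (auto simp: \<tau>_def \<tau>'_def)
    have x'z: "feasible_at x' z" using d1(2)[OF z(1) \<xi>(2)] z(3,4) dd by linarith
    have x''z: "feasible_at x'' z"
      unfolding x''_def using x'z xb_feas[OF z(1)] \<theta> by (intro feasible_at_convex_comb) auto
    have inside: "g \<le> G *v (z + \<tau>' *\<^sub>R v)" if v: "v \<in> D I" for v
    proof -
      have "g $ j \<le> (G *v (z + \<tau>' *\<^sub>R v)) $ j" for j
      proof (cases "j \<in> I")
        case True
        then have "0 \<le> \<tau>' * (G *v v) $ j" "(G *v z) $ j = g $ j" using v \<tau> by (auto simp: D_def I_def)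
        then show ?thesis by (simp add: matrix_vector_right_distrib matrix_vector_mult_scaleR)
      next
        case False
        then have "K * \<rho> \<le> (G *v z) $ j - g $ j" using z(5)[of j] by (auto simp: I_def)
        moreover have "\<bar>(G *v v) $ j\<bar> \<le> BG * n"
          using component_le_norm_cart[of "G *v v" j] BG(2)[of v]
            mult_left_mono[OF D_norm[OF v] less_imp_le[OF BG(1)]] by linarith
        then have "\<tau>' * \<bar>(G *v v) $ j\<bar> \<le> \<tau>' * (BG * n)" using \<tau> by (intro mult_left_mono) auto
        moreover have "\<tau>' * (BG * n) = K * \<rho>" by (simp add: \<tau>'_def \<tau>_def K_def)
        moreover have "- (\<tau>' * (G *v v) $ j) \<le> \<tau>' * \<bar>(G *v v) $ j\<bar>"
          using \<tau> by (simp add: abs_if)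
        ultimately show ?thesis by (simp add: matrix_vector_right_distrib matrix_vector_mult_scaleR)
      qed
      then show ?thesis by (simp add: less_eq_vec_def)
    qed
    have in_ball: "z + \<tau>' *\<^sub>R v \<in> lp_ball p z e" if v: "v \<in> D I" for v
    proof -
      have "lp_norm p (\<tau>' *\<^sub>R v) \<le> n * norm (\<tau>' *\<^sub>R v)"
        unfolding n_def using lp_norm_bounds(2)[OF p] .
      also have "\<dots> \<le> n * (\<tau>' * n)"
        using \<tau> D_norm[OF v] n by (intro mult_left_mono) auto
      also have "\<dots> = (2 * n\<^sup>2 / \<theta>) * \<rho>" by (simp add: \<tau>'_def \<tau>_def power2_eq_square)
      also have "\<dots> \<le> (2 * n\<^sup>2 / \<theta>) * d3"
        using z dd \<theta> by (intro mult_left_mono) auto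
      also have "\<dots> = e" using \<theta> n by (simp add: d3_def)
      finally show ?thesis by (simp add: lp_ball_def)
    qed
    obtain yb where yb: "yb \<in> linear_decision_rules"
      "\<And>\<zeta>. \<zeta> \<in> lp_ball p z e \<Longrightarrow> g \<le> G *v \<zeta> \<Longrightarrow> rhs xb \<zeta> \<le> W *v yb \<zeta>"
      using xb[OF z(1)] by blast
    have "V I \<subseteq> D I" using V(2)[of I] hull_subset by metis
    then obtain t2 where t2: "scaled_policy (V I) W H q (rhs xb z) \<tau>' t2"
      using scaled_policy_of_linear_rule[OF yb(1) V(1), of I xb z \<tau>'] yb(2) in_ball inside by blast
    \<comment> \<open>Purpose of the second mixture: \<open>x'\<close> contributes feasibility at
      scale 0 and \<open>xb\<close> a policy at scale \<open>\<tau>'\<close>, so \<open>x''\<close>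
      has one at scale \<open>\<tau>\<close> with a surcharge linear in
      \<open>\<tau>\<close>.\<close>
    have "scaled_policy (V I) W H q (rhs x'' z) \<tau> (dual_value x'' z + Cf I * \<tau>)"
      unfolding x''_def rhs_convex_comb
    proof (rule Cf(2))
      show "scaled_policy (V I) W H q (rhs x' z) 0 (dual_value x' z)"
        by (rule scaled_policy_zero[OF x'z order_refl])
      show "scaled_policy (V I) W H q ((1 - \<theta>) *\<^sub>R rhs x' z + \<theta> *\<^sub>R rhs xb z) 0
          (dual_value ((1 - \<theta>) *\<^sub>R x' + \<theta> *\<^sub>R xb) z)"
        using scaled_policy_zero[OF x''z order_refl] unfolding x''_def rhs_convex_comb .
    qed (use t2 \<theta> \<tau> in auto)
    then obtain y where y: "y \<in> linear_decision_rules"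
      "\<And>v. v \<in> D I \<Longrightarrow> rhs x'' (z + \<tau> *\<^sub>R v) \<le> W *v y (z + \<tau> *\<^sub>R v)
          \<and> q \<bullet> y (z + \<tau> *\<^sub>R v) \<le> dual_value x'' z + Cf I * \<tau>"
      using linear_rule_of_scaled_policy[OF _ \<tau>(1)] V(2) by metis
    have cost: "dual_value x'' z + Cf I * \<tau> \<le> dual_value x'' \<xi> + C * d"
    proof -
      have "dual_value x'' z \<le> dual_value x'' \<xi> + lip * norm (rhs x'' z - rhs x'' \<xi>)"
        by (rule dual_value_diff_le)
      moreover have "norm (rhs x'' z - rhs x'' \<xi>) \<le> BH * (C1 * d)"
      proof -
        have "rhs x'' z - rhs x'' \<xi> = H *v (z - \<xi>)"
          by (simp add: rhs_def matrix_vector_mult_diff_distrib)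
        then have "norm (rhs x'' z - rhs x'' \<xi>) \<le> BH * norm (z - \<xi>)" using BH(2) by simp
        also have "\<dots> \<le> BH * (C1 * d)" using BH z by (intro mult_left_mono) auto
        finally show ?thesis .
      qed
      then have "lip * norm (rhs x'' z - rhs x'' \<xi>) \<le> lip * (BH * (C1 * d))"
        using lip_nonneg by (rule mult_left_mono)
      moreover have "Cf I * \<tau> \<le> Cm * (2 * (C1 * d))"
        using Cm Cf(1) z \<rho> by (intro mult_mono) (auto simp: \<tau>_def)
      ultimately show ?thesis by (simp add: C_def algebra_simps)
    qed
    have "rhs x'' \<zeta> \<le> W *v y \<zeta> \<and> q \<bullet> y \<zeta> \<le> dual_value x'' \<xi> + C * d"
      if \<zeta>: "g \<le> G *v \<zeta>" "norm (\<zeta> - \<xi>) \<le> d" for \<zeta>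
    proof -
      \<comment> \<open>The local coordinate of \<open>\<zeta>\<close>. A constraint active at
        \<open>z\<close> and satisfied at \<open>\<zeta>\<close> cannot decrease along
        \<open>v\<close>, and \<open>\<tau>\<close> was chosen to put \<open>v\<close> in the unit
        box.\<close>
      define v where "v = (\<zeta> - z) /\<^sub>R \<tau>"
      have zv: "z + \<tau> *\<^sub>R v = \<zeta>" using \<tau>(1) by (simp add: v_def)
      have "norm (\<zeta> - z) \<le> norm (\<zeta> - \<xi>) + norm (z - \<xi>)"
        using norm_triangle_ineq4[of "\<zeta> - \<xi>" "z - \<xi>"] by simp
      then have "norm (\<zeta> - z) \<le> \<tau>" using \<zeta> z by (simp add: \<tau>_def)
      then have "norm v \<le> 1" using \<tau>(1) by (simp add: v_def divide_inverse_commute[symmetric])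
      then have "\<bar>v $ i\<bar> \<le> 1" for i using component_le_norm_cart[of v i] by linarith
      moreover have "0 \<le> (G *v v) $ j" if "j \<in> I" for j
      proof -
        have "(G *v v) $ j = ((G *v \<zeta>) $ j - g $ j) / \<tau>"
          using that by (simp add: v_def I_def matrix_vector_mult_scaleR matrix_vector_mult_diff_distrib divide_inverse_commute)
        then show ?thesis using \<zeta>(1) \<tau> by (simp add: less_eq_vec_def)
      qed
      ultimately have "v \<in> D I" by (simp add: D_def)
      from y(2)[OF this] show ?thesis using cost unfolding zv by linarith
    qed
    then show ?thesis using y(1) by blast
  qed
  ultimately show ?thesis by blast
qed

end

section \<open>Convergence of minimal values\<close>

text \<open>The domains are closed and decreasing, so a limit of points from ever later ones lies in
  all of them. The Lipschitz bound, uniform in \<open>N\<close>, exchanges the values at the moving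
  points \<open>u j\<close> for values at \<open>a\<close>, where pointwise convergence
  applies.\<close>

lemma limit_of_approximate_minimizers:
  fixes FN :: "nat \<Rightarrow> 'a::real_normed_vector \<Rightarrow> real"
  assumes lip: "\<And>N x y. N \<ge> 1 \<Longrightarrow> FN N x \<le> FN N y + B * norm (x - y)"
    and lim: "\<And>x. (\<lambda>N. FN N x) \<longlonglongrightarrow> F x"
    and closed: "\<And>N. closed (XN N)" and dec: "decseq XN" and sub: "(\<Inter>N. XN N) \<subseteq> X"
    and k: "filterlim k at_top sequentially" and u: "u \<longlonglongrightarrow> a"
    and mem: "\<forall>\<^sub>F j in sequentially. u j \<in> XN (k j)"
    and le: "\<And>\<eta>. \<eta> > 0 \<Longrightarrow> \<forall>\<^sub>F j in sequentially. FN (k j) (u j) \<le> w + \<eta>"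
  shows "a \<in> X \<and> F a \<le> w"
proof
  have "a \<in> XN M" for M
  proof (rule Lim_in_closed_set[OF closed _ trivial_limit_sequentially u])
    have "\<forall>\<^sub>F j in sequentially. M \<le> k j" using k by (simp add: filterlim_at_top)
    with mem show "\<forall>\<^sub>F j in sequentially. u j \<in> XN M"
      by eventually_elim (use dec decseqD in blast)
  qed
  then show "a \<in> X" using sub by blast
  have "F a \<le> w + \<eta>" if "\<eta> > 0" for \<eta>
  proof (rule tendsto_upperbound)
    have "(\<lambda>j. FN (k j) a - B * norm (a - u j)) \<longlonglongrightarrow> F a - B * norm (a - a)"
      by (intro tendsto_intros filterlim_compose[OF lim k] u)
    then show "(\<lambda>j. FN (k j) a - B * norm (a - u j)) \<longlonglongrightarrow> F a" by simp
    have "\<forall>\<^sub>F j in sequentially. 1 \<le> k j" using k by (simp add: filterlim_at_top)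
    with le[OF that] show "\<forall>\<^sub>F j in sequentially. FN (k j) a - B * norm (a - u j) \<le> w + \<eta>"
    proof eventually_elim
      case (elim j)
      then show ?case using lip[of "k j" a "u j"] by linarith
    qed
  qed simp
  then show "F a \<le> w" by (rule field_le_epsilon)
qed

text \<open>Points of value below \<open>v - \<eta>\<close> are pulled back along the segment to the optimal point \<open>x0\<close> into a
  ball containing all optimal points in its interior; by convexity this keeps their value at most
  \<open>v + o(1)\<close>, and a limit point on the sphere would be an optimal point.\<close>

lemma convergence_of_minimal_values:
  fixes FN :: "nat \<Rightarrow> real ^ 'n \<Rightarrow> real" and VN :: "nat \<Rightarrow> real ^ 'n \<Rightarrow> ereal"
  assumes conv: "\<And>N x y \<theta>. 0 \<le> \<theta> \<Longrightarrow> \<theta> \<le> 1 \<Longrightarrow>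
      FN N ((1 - \<theta>) *\<^sub>R x + \<theta> *\<^sub>R y) \<le> (1 - \<theta>) * FN N x + \<theta> * FN N y"
    and lip: "\<And>N x y. N \<ge> 1 \<Longrightarrow> FN N x \<le> FN N y + B * norm (x - y)"
    and lim: "\<And>x. (\<lambda>N. FN N x) \<longlonglongrightarrow> F x"
    and closed: "\<And>N. closed (XN N)" and convX: "\<And>N. convex (XN N)"
    and dec: "decseq XN" and sub: "(\<Inter>N. XN N) \<subseteq> X"
    and x0: "\<And>N. x0 \<in> XN N" "F x0 = v" and opt: "\<And>x. x \<in> X \<Longrightarrow> v \<le> F x"
    and bdd: "bounded {x \<in> X. F x \<le> v}"
    and lower: "\<And>N x. N \<ge> 1 \<Longrightarrow> (if x \<in> XN N then ereal (FN N x) else \<infinity>) \<le> VN N x"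
    and upper: "\<And>\<eta>. \<eta> > 0 \<Longrightarrow> \<exists>x. \<forall>\<^sub>F N in sequentially. VN N x \<le> ereal (v + \<eta>)"
  shows "(\<lambda>N. INF x. VN N x) \<longlonglongrightarrow> ereal v"
    and "\<And>xh a. \<forall>\<^sub>F N in sequentially. xh N \<in> optimal_decisions (VN N) \<Longrightarrow> accumulation_point xh a \<Longrightarrow>
      a \<in> X \<and> F a \<le> v"
proof -
  have up: "\<forall>\<^sub>F N in sequentially. (INF x. VN N x) \<le> ereal (v + \<eta>)" if \<eta>: "\<eta> > 0" for \<eta>
  proof -
    obtain x where "\<forall>\<^sub>F N in sequentially. VN N x \<le> ereal (v + \<eta>)" using upper[OF \<eta>] by blast
    then show ?thesis by eventually_elim (auto intro: INF_lower2)
  qed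
  have low: "\<forall>\<^sub>F N in sequentially. ereal (v - \<eta>) \<le> (INF x. VN N x)" if \<eta>: "\<eta> > 0" for \<eta>
  proof (rule ccontr)
    assume contra: "\<not> ?thesis"
    \<comment> \<open>The clause \<open>N \<ge> 1\<close> has to survive the extraction of a
      subsequence, since \<open>lower\<close> is stated for such \<open>N\<close>.\<close>
    have "\<not> (\<forall>\<^sub>F N in sequentially. N \<ge> 1 \<longrightarrow> ereal (v - \<eta>) \<le> (INF x. VN N x))"
    proof
      assume "\<forall>\<^sub>F N in sequentially. N \<ge> 1 \<longrightarrow> ereal (v - \<eta>) \<le> (INF x. VN N x)"
      with eventually_ge_at_top[of 1]
      have "\<forall>\<^sub>F N in sequentially. ereal (v - \<eta>) \<le> (INF x. VN N x)"
        by eventually_elim simp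
      with contra show False ..
    qed
    from not_eventually_sequentiallyD[OF this]
    obtain k :: "nat \<Rightarrow> nat" where k: "strict_mono k" "\<And>j. \<not> (k j \<ge> 1 \<longrightarrow> ereal (v - \<eta>) \<le> (INF x. VN (k j) x))"
      by blast
    have "\<exists>x. VN (k j) x < ereal (v - \<eta>)" for j
      using k(2)[of j] by (auto simp: not_le INF_less_iff)
    then obtain xs where xs: "\<And>j. VN (k j) (xs j) < ereal (v - \<eta>)" by metis
    have xsX: "xs j \<in> XN (k j) \<and> FN (k j) (xs j) \<le> v - \<eta>" for j
    proof -
      have "k j \<ge> 1" using k(2)[of j] by blast
      then have "(if xs j \<in> XN (k j) then ereal (FN (k j) (xs j)) else \<infinity>) < ereal (v - \<eta>)"
        using lower[of "k j" "xs j"] xs[of j] by (rule_tac le_less_trans)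
      then show ?thesis by (auto split: if_splits)
    qed
    obtain b where b: "\<And>a. a \<in> X \<Longrightarrow> F a \<le> v \<Longrightarrow> norm a \<le> b" using bdd by (auto simp: bounded_iff)
    define r where "r = \<bar>b\<bar> + norm x0 + 1"
    have r0: "r > 0" by (simp add: r_def add_nonneg_pos)
    have r: "norm (a - x0) < r" if "a \<in> X" "F a \<le> v" for a
      using b[OF that] norm_triangle_ineq4[of a x0] by (simp add: r_def)
    define s where "s j = (if norm (xs j - x0) \<le> r then 1 else r / norm (xs j - x0))" for j
    define u where "u j = (1 - s j) *\<^sub>R x0 + s j *\<^sub>R xs j" for j
    have s: "0 \<le> s j" "s j \<le> 1" for j using r0 by (auto simp: s_def divide_le_eq_1)
    have norm_u: "norm (u j - x0) = s j * norm (xs j - x0)" for j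
    proof -
      have "u j - x0 = s j *\<^sub>R (xs j - x0)" by (simp add: u_def algebra_simps)
      then show ?thesis using s by simp
    qed
    have u_ball: "u j \<in> cball x0 r" for j
      using norm_u[of j] r0 by (auto simp: s_def dist_norm norm_minus_commute)
    have u_eq: "u j = xs j" if "norm (u j - x0) < r" for j
      using norm_u[of j] that r0 by (auto simp: s_def u_def split: if_splits)
    obtain a m where m: "strict_mono m" "(u \<circ> m) \<longlonglongrightarrow> a"
      using compact_imp_seq_compact[OF compact_cball, of x0 r] u_ball unfolding seq_compact_def by metis
    have km: "filterlim (k \<circ> m) at_top sequentially"
      using k(1) m(1) by (intro filterlim_subseq strict_mono_o)
    have uX: "u j \<in> XN (k j)" for j
      unfolding u_def using convexD[OF convX x0(1), of "xs j" "k j" "1 - s j" "s j"] xsX[of j] s[of j] by simp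
    \<comment> \<open>Value at most \<open>v\<close> makes \<open>a\<close> optimal, hence interior
      to the ball. Along the subsequence the points are then eventually not pulled back, and their
      values stay below \<open>v - \<eta>\<close>.\<close>
    have a: "a \<in> X \<and> F a \<le> v"
    proof (rule limit_of_approximate_minimizers[OF lip lim closed dec sub km m(2)])
      show "\<forall>\<^sub>F j in sequentially. (u \<circ> m) j \<in> XN ((k \<circ> m) j)" using uX by simp
      fix \<eta>' :: real assume \<eta>': "\<eta>' > 0"
      have "(\<lambda>j. FN ((k \<circ> m) j) x0) \<longlonglongrightarrow> v" using filterlim_compose[OF lim[of x0] km] unfolding x0(2) .
      then have "\<forall>\<^sub>F j in sequentially. FN ((k \<circ> m) j) x0 < v + \<eta>'"
        using \<eta>' by (intro order_tendstoD) auto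
      then show "\<forall>\<^sub>F j in sequentially. FN ((k \<circ> m) j) ((u \<circ> m) j) \<le> v + \<eta>'"
      proof eventually_elim
        case (elim j)
        have "FN (k (m j)) (u (m j)) \<le> (1 - s (m j)) * FN (k (m j)) x0 + s (m j) * FN (k (m j)) (xs (m j))"
          unfolding u_def by (rule conv[OF s])
        also have "\<dots> \<le> (1 - s (m j)) * (v + \<eta>') + s (m j) * (v + \<eta>')"
          using s[of "m j"] elim xsX[of "m j"] \<eta> \<eta>' by (intro add_mono mult_left_mono) auto
        finally show ?case by (simp add: algebra_simps)
      qed
    qed
    have "(\<lambda>j. norm ((u \<circ> m) j - x0)) \<longlonglongrightarrow> norm (a - x0)" by (intro tendsto_intros m(2))
    then have "\<forall>\<^sub>F j in sequentially. norm ((u \<circ> m) j - x0) < r"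
      using r a by (intro order_tendstoD) auto
    then have ev: "\<forall>\<^sub>F j in sequentially. FN ((k \<circ> m) j) ((u \<circ> m) j) \<le> v - \<eta>"
    proof eventually_elim
      case (elim j)
      then have "u (m j) = xs (m j)" by (intro u_eq) simp
      then show ?case using xsX[of "m j"] by simp
    qed
    have "a \<in> X \<and> F a \<le> v - \<eta>"
    proof (rule limit_of_approximate_minimizers[OF lip lim closed dec sub km m(2)])
      show "\<forall>\<^sub>F j in sequentially. (u \<circ> m) j \<in> XN ((k \<circ> m) j)" using uX by simp
      fix \<eta>' :: real assume "\<eta>' > 0"
      from ev show "\<forall>\<^sub>F j in sequentially. FN ((k \<circ> m) j) ((u \<circ> m) j) \<le> v - \<eta> + \<eta>'"
        by (rule eventually_mono) (use \<open>\<eta>' > 0\<close> in linarith)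
    qed
    then show False using opt[of a] \<eta> by linarith
  qed
  show "(\<lambda>N. INF x. VN N x) \<longlonglongrightarrow> ereal v"
  proof (rule order_tendstoI)
    fix y assume y: "y < ereal v"
    then obtain w where w: "y < ereal w" "w < v" using ereal_dense2 by (metis ereal_less(1) less_ereal.simps(1))
    have "\<forall>\<^sub>F N in sequentially. ereal (v - (v - w)) \<le> (INF x. VN N x)" using w by (intro low) simp
    then show "\<forall>\<^sub>F N in sequentially. y < (INF x. VN N x)"
      by eventually_elim (use w in \<open>auto intro: less_le_trans\<close>)
  next
    fix y assume y: "ereal v < y"
    then obtain w where w: "ereal w < y" "v < w" using ereal_dense2 by (metis ereal_less(1) less_ereal.simps(1))
    have "\<forall>\<^sub>F N in sequentially. (INF x. VN N x) \<le> ereal (v + (w - v))" using w by (intro up) simp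
    then show "\<forall>\<^sub>F N in sequentially. (INF x. VN N x) < y"
      by eventually_elim (use w in \<open>auto intro: le_less_trans\<close>)
  qed
  fix xh a assume xh: "\<forall>\<^sub>F N in sequentially. xh N \<in> optimal_decisions (VN N)"
    and "accumulation_point xh a"
  then obtain k where k: "strict_mono k" "(xh \<circ> k) \<longlonglongrightarrow> a" by (auto simp: accumulation_point_def)
  \<comment> \<open>By \<open>lower\<close>, minimizers of \<open>VN N\<close> lie in
    \<open>XN N\<close> and are nearly optimal for \<open>FN N\<close>, so the limit lemma applies
    to them directly.\<close>
  have ev: "\<forall>\<^sub>F N in sequentially. xh N \<in> XN N \<and> FN N (xh N) \<le> v + \<eta>" if "\<eta> > 0" for \<eta>
    using xh up[OF that] eventually_ge_at_top[of 1]
  proof eventually_elim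
    case (elim N)
    have "VN N (xh N) \<le> (INF x. VN N x)"
      using elim(1) by (intro INF_greatest) (auto simp: optimal_decisions_def is_arg_min_def not_less)
    then have "(if xh N \<in> XN N then ereal (FN N (xh N)) else \<infinity>) \<le> ereal (v + \<eta>)"
      using lower[OF elim(3), of "xh N"] elim(2) by order
    then show ?case by (auto split: if_splits)
  qed
  have kf: "filterlim k at_top sequentially" using k(1) by (rule filterlim_subseq)
  have ev': "\<forall>\<^sub>F j in sequentially. xh (k j) \<in> XN (k j) \<and> FN (k j) (xh (k j)) \<le> v + \<eta>" if "\<eta> > 0" for \<eta>
    using eventually_compose_filterlim[OF ev[OF that] kf] .
  show "a \<in> X \<and> F a \<le> v"
  proof (rule limit_of_approximate_minimizers[OF lip lim closed dec sub kf k(2)])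
    show "\<forall>\<^sub>F j in sequentially. (xh \<circ> k) j \<in> XN (k j)"
      using ev'[OF zero_less_one] by eventually_elim auto
    show "\<forall>\<^sub>F j in sequentially. FN (k j) ((xh \<circ> k) j) \<le> v + \<eta>" if "\<eta> > 0" for \<eta>
      using ev'[OF that] by eventually_elim auto
  qed
qed

section \<open>Sample robust, multi-policy and expected costs\<close>

lemma sum_if_infinity_ereal:
  fixes a :: "'i \<Rightarrow> real"
  assumes "finite I"
  shows "(\<Sum>i\<in>I. if P i then ereal (a i) else \<infinity>) = (if \<forall>i\<in>I. P i then ereal (\<Sum>i\<in>I. a i) else \<infinity>)"
  using assms by (induction I rule: finite_induct) auto

text \<open>At each point of its uncertainty set a feasible policy is a feasible recourse decision,
  hence at least as expensive as the optimal one.\<close>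

lemma sample_robust_le_multi_policy:
  "sample_robust_cost c q T W h N U x \<le> multi_policy_cost Pol c q T W h N U x"
  unfolding sample_robust_cost_def multi_policy_cost_def
proof (rule INF_greatest)
  fix y assume y: "y \<in> {y. \<forall>i\<in>{1..N}. y i \<in> Pol \<and> (\<forall>\<zeta>\<in>U i. h \<zeta> \<le> T *v x + W *v y i \<zeta>)}"
  have "(SUP \<zeta>\<in>U i. second_stage_cost q T W h x \<zeta>) \<le> (SUP \<zeta>\<in>U i. ereal (q \<bullet> y i \<zeta>))" if "i \<in> {1..N}" for i
  proof (rule SUP_mono)
    fix \<zeta> assume \<zeta>: "\<zeta> \<in> U i"
    then have "second_stage_cost q T W h x \<zeta> \<le> ereal (q \<bullet> y i \<zeta>)"
      unfolding second_stage_cost_def using y that by (intro INF_lower) auto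
    then show "\<exists>\<zeta>'\<in>U i. second_stage_cost q T W h x \<zeta> \<le> ereal (q \<bullet> y i \<zeta>')"
      using \<zeta> by blast
  qed
  then have "(\<Sum>i = 1..N. SUP \<zeta>\<in>U i. second_stage_cost q T W h x \<zeta>) \<le> (\<Sum>i = 1..N. SUP \<zeta>\<in>U i. ereal (q \<bullet> y i \<zeta>))"
    by (rule sum_mono)
  then show "ereal (c \<bullet> x) + ereal (1 / real N) * (\<Sum>i = 1..N. SUP \<zeta>\<in>U i. second_stage_cost q T W h x \<zeta>)
      \<le> ereal (c \<bullet> x) + ereal (1 / real N) * (\<Sum>i = 1..N. SUP \<zeta>\<in>U i. ereal (q \<bullet> y i \<zeta>))"
    by (intro add_left_mono ereal_mult_left_mono) auto
qed

section \<open>Sample averages as bounds for the robust and multi-policy costs\<close>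

context two_stage
begin

lemma second_stage_cost_eq:
  "second_stage_cost q T W (\<lambda>\<zeta>. h0 + H *v \<zeta>) x \<zeta> = (if feasible_at x \<zeta> then ereal (dual_value x \<zeta>) else \<infinity>)"
proof (cases "feasible_at x \<zeta>")
  case True
  then obtain y where y: "rhs x \<zeta> \<le> W *v y" "q \<bullet> y \<le> dual_value x \<zeta>"
    using recourse_iff[of x \<zeta> "dual_value x \<zeta>"] by auto
  have "second_stage_cost q T W (\<lambda>\<zeta>. h0 + H *v \<zeta>) x \<zeta> \<le> ereal (dual_value x \<zeta>)"
    unfolding second_stage_cost_def using y by (intro INF_lower2[of y]) (auto simp: rhs_le_iff)
  moreover have "ereal (dual_value x \<zeta>) \<le> second_stage_cost q T W (\<lambda>\<zeta>. h0 + H *v \<zeta>) x \<zeta>"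
    unfolding second_stage_cost_def
  proof (rule INF_greatest)
    fix y assume "y \<in> {y. h0 + H *v \<zeta> \<le> T *v x + W *v y}"
    then show "ereal (dual_value x \<zeta>) \<le> ereal (q \<bullet> y)"
      using recourse_iff[of x \<zeta> "q \<bullet> y"] by (auto simp: rhs_le_iff)
  qed
  ultimately show ?thesis using True by simp
next
  case False
  then have "\<not> h0 + H *v \<zeta> \<le> T *v x + W *v y" for y
    using recourse_iff[of x \<zeta> "q \<bullet> y"] by (auto simp: rhs_le_iff)
  then show ?thesis using False by (simp add: second_stage_cost_def top_ereal_def)
qed

text \<open>Built from \<open>dual_value\<close>, hence real-valued and convex on the whole space;
  infeasibility at a sample is kept apart in \<open>sample_feasible\<close>.\<close>

definition sample_average :: "real ^ 'n \<Rightarrow> (nat \<Rightarrow> real ^ 'd) \<Rightarrow> nat \<Rightarrow> real ^ 'n \<Rightarrow> real" where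
  "sample_average c s N x = c \<bullet> x + (\<Sum>i = 1..N. dual_value x (s i)) / real N"

definition sample_feasible :: "(nat \<Rightarrow> real ^ 'd) \<Rightarrow> nat \<Rightarrow> (real ^ 'n) set" where
  "sample_feasible s N = {x. \<forall>i\<in>{1..N}. feasible_at x (s i)}"

text \<open>Each sample belongs to its own uncertainty set, so the supremum is at least the cost at
  the sample.\<close>

lemma sample_robust_ge_sample_average:
  assumes "N \<ge> 1" "\<And>i. i \<in> {1..N} \<Longrightarrow> s i \<in> U i"
  shows "(if x \<in> sample_feasible s N then ereal (sample_average c s N x) else \<infinity>)
    \<le> sample_robust_cost c q T W (\<lambda>\<zeta>. h0 + H *v \<zeta>) N U x"
proof -
  let ?Q = "second_stage_cost q T W (\<lambda>\<zeta>. h0 + H *v \<zeta>) x"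
  have "(if x \<in> sample_feasible s N then ereal (sample_average c s N x) else \<infinity>)
      = ereal (c \<bullet> x) + ereal (1 / real N) * (\<Sum>i = 1..N. ?Q (s i))"
    using assms(1)
    by (simp add: second_stage_cost_eq sum_if_infinity_ereal sample_feasible_def sample_average_def)
  also have "\<dots> \<le> ereal (c \<bullet> x) + ereal (1 / real N) * (\<Sum>i = 1..N. SUP \<zeta>\<in>U i. ?Q \<zeta>)"
    using assms(2) by (intro add_left_mono ereal_mult_left_mono sum_mono SUP_upper) auto
  finally show ?thesis by (simp add: sample_robust_cost_def)
qed

lemma multi_policy_le_sample_average:
  assumes N: "N \<ge> 1"
    and rule: "\<And>i. i \<in> {1..N} \<Longrightarrow> \<exists>y\<in>linear_decision_rules. \<forall>\<zeta>\<in>U i.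
      rhs x \<zeta> \<le> W *v y \<zeta> \<and> q \<bullet> y \<zeta> \<le> dual_value x (s i) + \<delta>"
  shows "multi_policy_cost linear_decision_rules c q T W (\<lambda>\<zeta>. h0 + H *v \<zeta>) N U x
    \<le> ereal (sample_average c s N x + \<delta>)"
proof -
  obtain y where y: "\<And>i. i \<in> {1..N} \<Longrightarrow> y i \<in> linear_decision_rules"
    "\<And>i \<zeta>. i \<in> {1..N} \<Longrightarrow> \<zeta> \<in> U i \<Longrightarrow> rhs x \<zeta> \<le> W *v y i \<zeta> \<and> q \<bullet> y i \<zeta> \<le> dual_value x (s i) + \<delta>"
    using rule by metis
  have "multi_policy_cost linear_decision_rules c q T W (\<lambda>\<zeta>. h0 + H *v \<zeta>) N U x
      \<le> ereal (c \<bullet> x) + ereal (1 / real N) * (\<Sum>i = 1..N. SUP \<zeta>\<in>U i. ereal (q \<bullet> y i \<zeta>))"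
    unfolding multi_policy_cost_def
  proof (rule INF_lower)
    show "y \<in> {y. \<forall>i\<in>{1..N}. y i \<in> linear_decision_rules \<and> (\<forall>\<zeta>\<in>U i. h0 + H *v \<zeta> \<le> T *v x + W *v y i \<zeta>)}"
      using y rhs_le_iff by blast
  qed
  also have "\<dots> \<le> ereal (c \<bullet> x) + ereal (1 / real N) * (\<Sum>i = 1..N. ereal (dual_value x (s i) + \<delta>))"
    using y(2) by (intro add_left_mono ereal_mult_left_mono sum_mono SUP_least) auto
  also have "\<dots> = ereal (c \<bullet> x + (1 / real N) * (\<Sum>i = 1..N. dual_value x (s i) + \<delta>))"
    by simp
  also have "c \<bullet> x + (1 / real N) * (\<Sum>i = 1..N. dual_value x (s i) + \<delta>) = sample_average c s N x + \<delta>"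
    using N by (simp add: sample_average_def sum.distrib field_simps)
  finally show ?thesis .
qed

text \<open>The decision enters \<open>rhs\<close> apart from \<open>\<zeta>\<close>, so the
  constant is uniform over the uncertainty; this makes all sample averages equi-Lipschitz.\<close>

lemma dual_value_lipschitz:
  obtains B where "B \<ge> 0" "\<And>x y \<zeta>. dual_value x \<zeta> \<le> dual_value y \<zeta> + B * norm (x - y)"
proof -
  obtain BT where BT: "BT > 0" "\<And>v. norm (T *v v) \<le> BT * norm v"
    using linear_bounded_pos[OF matrix_vector_mul_linear[of T]] by blast
  have "dual_value x \<zeta> \<le> dual_value y \<zeta> + (lip * BT) * norm (x - y)" for x y \<zeta>
  proof -
    have "rhs x \<zeta> - rhs y \<zeta> = T *v (y - x)" by (simp add: rhs_def matrix_vector_mult_diff_distrib)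
    then have "norm (rhs x \<zeta> - rhs y \<zeta>) \<le> BT * norm (x - y)"
      using BT(2)[of "y - x"] by (simp add: norm_minus_commute)
    then have "lip * norm (rhs x \<zeta> - rhs y \<zeta>) \<le> lip * (BT * norm (x - y))"
      by (rule mult_left_mono[OF _ lip_nonneg])
    then show ?thesis using dual_value_diff_le[of x \<zeta> y \<zeta>] by (simp add: mult.assoc)
  qed
  then show thesis using that[of "lip * BT"] BT lip_nonneg by simp
qed

text \<open>Reduces integrability of the second-stage value to the finite first moment of the
  uncertainty.\<close>

lemma dual_value_linear_growth:
  obtains A B where "\<And>\<zeta>. \<bar>dual_value x \<zeta>\<bar> \<le> A + B * norm \<zeta>"
proof -
  obtain BH where BH: "BH > 0" "\<And>v. norm (H *v v) \<le> BH * norm v"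
    using linear_bounded_pos[OF matrix_vector_mul_linear[of H]] by blast
  have diff: "norm (rhs x \<zeta> - rhs x \<zeta>') \<le> BH * norm (\<zeta> - \<zeta>')" for \<zeta> \<zeta>'
    using BH(2)[of "\<zeta> - \<zeta>'"] by (simp add: rhs_def matrix_vector_mult_diff_distrib)
  have "\<bar>dual_value x \<zeta>\<bar> \<le> \<bar>dual_value x 0\<bar> + (lip * BH) * norm \<zeta>" for \<zeta>
    using dual_value_diff_le[of x \<zeta> x 0] dual_value_diff_le[of x 0 x \<zeta>]
      mult_left_mono[OF diff[of \<zeta> 0] lip_nonneg] mult_left_mono[OF diff[of 0 \<zeta>] lip_nonneg]
    by (simp add: mult.assoc)
  then show thesis using that by blast
qed

lemma sample_average_convex_comb:
  assumes "0 \<le> \<theta>" "\<theta> \<le> 1"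
  shows "sample_average c s N ((1 - \<theta>) *\<^sub>R x + \<theta> *\<^sub>R y) \<le> (1 - \<theta>) * sample_average c s N x + \<theta> * sample_average c s N y"
proof -
  have "(\<Sum>i = 1..N. dual_value ((1 - \<theta>) *\<^sub>R x + \<theta> *\<^sub>R y) (s i))
      \<le> (\<Sum>i = 1..N. (1 - \<theta>) * dual_value x (s i) + \<theta> * dual_value y (s i))"
    using assms by (intro sum_mono dual_value_convex_comb)
  then have "(\<Sum>i = 1..N. dual_value ((1 - \<theta>) *\<^sub>R x + \<theta> *\<^sub>R y) (s i)) / real N
      \<le> ((1 - \<theta>) * (\<Sum>i = 1..N. dual_value x (s i)) + \<theta> * (\<Sum>i = 1..N. dual_value y (s i))) / real N"
    by (intro divide_right_mono) (simp_all add: sum.distrib sum_distrib_left)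
  then show ?thesis
    by (simp add: sample_average_def inner_add_right add_divide_distrib diff_divide_distrib algebra_simps)
qed

lemma sample_average_lipschitz:
  obtains B where "B \<ge> 0" "\<And>s N x y. N \<ge> 1 \<Longrightarrow> sample_average c s N x \<le> sample_average c s N y + B * norm (x - y)"
proof -
  obtain B where B: "B \<ge> 0" "\<And>x y \<zeta>. dual_value x \<zeta> \<le> dual_value y \<zeta> + B * norm (x - y)"
    using dual_value_lipschitz by blast
  have "sample_average c s N x \<le> sample_average c s N y + (norm c + B) * norm (x - y)" if N: "N \<ge> 1" for s N x y
  proof -
    have "(\<Sum>i = 1..N. dual_value x (s i)) \<le> (\<Sum>i = 1..N. dual_value y (s i) + B * norm (x - y))"
      by (intro sum_mono B(2))
    then have "(\<Sum>i = 1..N. dual_value x (s i)) / real N \<le> (\<Sum>i = 1..N. dual_value y (s i) + B * norm (x - y)) / real N"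
      by (intro divide_right_mono) auto
    also have "\<dots> = (\<Sum>i = 1..N. dual_value y (s i)) / real N + B * norm (x - y)"
      using N by (simp add: sum.distrib add_divide_distrib)
    finally have "(\<Sum>i = 1..N. dual_value x (s i)) / real N \<le> \<dots>" .
    moreover have "c \<bullet> x - c \<bullet> y \<le> norm c * norm (x - y)"
      using norm_cauchy_schwarz[of c "x - y"] by (simp add: inner_diff_right)
    ultimately show ?thesis by (simp add: sample_average_def algebra_simps)
  qed
  then show thesis using that[of "norm c + B"] B(1) by simp
qed

lemma closed_sample_feasible: "closed (sample_feasible s N)"
proof -
  have "sample_feasible s N = (\<Inter>i\<in>{1..N}. \<Inter>r\<in>R. {x. r \<bullet> rhs x (s i) \<le> 0})"
    by (auto simp: sample_feasible_def feasible_at_def)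
  moreover have "closed {x. r \<bullet> rhs x (s i) \<le> 0}" for r i
    unfolding rhs_def
    by (intro closed_Collect_le continuous_intros linear_continuous_on
        matrix_vector_mul_linear[THEN linear_conv_bounded_linear[THEN iffD1]])
  ultimately show ?thesis by (auto intro!: closed_INT)
qed

lemma convex_sample_feasible: "convex (sample_feasible s N)"
proof (rule convexI)
  fix x y and u v :: real
  assume *: "x \<in> sample_feasible s N" "y \<in> sample_feasible s N" "0 \<le> u" "0 \<le> v" "u + v = 1"
  then have u: "u = 1 - v" by simp
  show "u *\<^sub>R x + v *\<^sub>R y \<in> sample_feasible s N"
    unfolding u using * by (auto simp: sample_feasible_def intro!: feasible_at_convex_comb)
qed

lemma decseq_sample_feasible: "decseq (sample_feasible s)"
  by (auto simp: decseq_def sample_feasible_def)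

end

section \<open>Eventual upper bound for the multi-policy cost, and measurability\<close>

context two_stage
begin

lemma multi_policy_eventually_le:
  fixes x xb :: "real ^ 'n" and p :: ereal and s :: "nat \<Rightarrow> real ^ 'd"
  assumes p: "p \<ge> 1" and e: "e > 0" and \<theta>: "0 < \<theta>" "\<theta> \<le> 1"
    and xb: "\<And>z. g \<le> G *v z \<Longrightarrow> \<exists>y\<in>linear_decision_rules.
      \<forall>\<zeta>\<in>lp_ball p z e. g \<le> G *v \<zeta> \<longrightarrow> rhs xb \<zeta> \<le> W *v y \<zeta>"
    and x'_def: "x' = (1 - \<theta>) *\<^sub>R x + \<theta> *\<^sub>R xb" and x''_def: "x'' = (1 - \<theta>) *\<^sub>R x' + \<theta> *\<^sub>R xb"
    and s: "\<And>i. i \<ge> 1 \<Longrightarrow> g \<le> G *v s i" "\<And>i. i \<ge> 1 \<Longrightarrow> feasible_at x (s i)"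
    and eps: "\<And>N. N \<ge> 1 \<Longrightarrow> eps N \<ge> 0" "eps \<longlonglongrightarrow> 0"
    and lim: "(\<lambda>N. sample_average c s N x'') \<longlonglongrightarrow> f" and \<eta>: "\<eta> > 0"
  shows "\<forall>\<^sub>F N in sequentially. multi_policy_cost linear_decision_rules c q T W (\<lambda>\<zeta>. h0 + H *v \<zeta>) N
      (\<lambda>i. lp_ball p (s i) (eps N) \<inter> {\<zeta>. g \<le> G *v \<zeta>}) x'' \<le> ereal (f + \<eta>)"
proof -
  obtain C d0 where C: "C \<ge> 0" and d0: "d0 > 0" and rule: "\<And>\<xi> d. g \<le> G *v \<xi> \<Longrightarrow> feasible_at x \<xi> \<Longrightarrow> 0 < d \<Longrightarrow> d \<le> d0 \<Longrightarrow>
    (\<exists>y\<in>linear_decision_rules. \<forall>\<zeta>. g \<le> G *v \<zeta> \<and> norm (\<zeta> - \<xi>) \<le> d \<longrightarrow>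
      rhs x'' \<zeta> \<le> W *v y \<zeta> \<and> q \<bullet> y \<zeta> \<le> dual_value x'' \<xi> + C * d)"
    using local_linear_rule[OF p e \<theta> xb x'_def x''_def] by blast
  define n where "n = real CARD('d)"
  \<comment> \<open>The factor \<open>n\<close> passes from \<open>lp_norm\<close> to the Euclidean
    norm; \<open>1 / real N\<close> keeps the radius positive when \<open>eps N = 0\<close>.\<close>
  define d where "d N = n * eps N + 1 / real N" for N
  have "d \<longlonglongrightarrow> n * 0 + 0"
    unfolding d_def using lim_1_over_n by (intro tendsto_intros eps(2))
  then have d: "d \<longlonglongrightarrow> 0" by simp
  have "(\<lambda>N. sample_average c s N x'' + C * d N) \<longlonglongrightarrow> f + C * 0"
    by (intro tendsto_intros lim d)
  then have "\<forall>\<^sub>F N in sequentially. sample_average c s N x'' + C * d N < f + \<eta>"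
    using \<eta> by (intro order_tendstoD) auto
  moreover have "\<forall>\<^sub>F N in sequentially. d N < d0" using d d0 by (intro order_tendstoD) auto
  ultimately show ?thesis
    using eventually_ge_at_top[of 1]
  proof eventually_elim
    case (elim N)
    have dN: "d N > 0" using elim(3) eps(1)[of N] by (simp add: d_def n_def add_nonneg_pos)
    have "multi_policy_cost linear_decision_rules c q T W (\<lambda>\<zeta>. h0 + H *v \<zeta>) N
        (\<lambda>i. lp_ball p (s i) (eps N) \<inter> {\<zeta>. g \<le> G *v \<zeta>}) x'' \<le> ereal (sample_average c s N x'' + C * d N)"
    proof (rule multi_policy_le_sample_average[OF elim(3)])
      fix i assume "i \<in> {1..N}"
      then have i: "i \<ge> 1" by simp
      obtain y where y: "y \<in> linear_decision_rules" "\<And>\<zeta>. g \<le> G *v \<zeta> \<Longrightarrow> norm (\<zeta> - s i) \<le> d N \<Longrightarrow>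
          rhs x'' \<zeta> \<le> W *v y \<zeta> \<and> q \<bullet> y \<zeta> \<le> dual_value x'' (s i) + C * d N"
        using rule[OF s(1)[OF i] s(2)[OF i] dN less_imp_le[OF elim(2)]] by blast
      have "norm (\<zeta> - s i) \<le> d N" if "\<zeta> \<in> lp_ball p (s i) (eps N)" for \<zeta>
      proof -
        have "norm (\<zeta> - s i) \<le> n * lp_norm p (\<zeta> - s i)" unfolding n_def by (rule lp_norm_bounds(1)[OF p])
        also have "\<dots> \<le> n * eps N" using that by (intro mult_left_mono) (auto simp: lp_ball_def n_def)
        also have "\<dots> \<le> d N" by (simp add: d_def)
        finally show ?thesis .
      qed
      then show "\<exists>y\<in>linear_decision_rules. \<forall>\<zeta>\<in>lp_ball p (s i) (eps N) \<inter> {\<zeta>. g \<le> G *v \<zeta>}.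
          rhs x'' \<zeta> \<le> W *v y \<zeta> \<and> q \<bullet> y \<zeta> \<le> dual_value x'' (s i) + C * d N"
        using y by (intro bexI[of _ y]) auto
    qed
    also have "\<dots> \<le> ereal (f + \<eta>)" using elim(1) by simp
    finally show ?case .
  qed
qed

lemma closed_feasible_at: "closed {\<zeta>. feasible_at x \<zeta>}"
proof -
  have "{\<zeta>. feasible_at x \<zeta>} = (\<Inter>r\<in>R. {\<zeta>. r \<bullet> rhs x \<zeta> \<le> 0})"
    by (auto simp: feasible_at_def)
  moreover have "closed {\<zeta>. r \<bullet> rhs x \<zeta> \<le> 0}" for r
    unfolding rhs_def
    by (intro closed_Collect_le continuous_intros linear_continuous_on
        matrix_vector_mul_linear[THEN linear_conv_bounded_linear[THEN iffD1]])
  ultimately show ?thesis by (auto intro!: closed_INT)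
qed

lemma dual_value_measurable [measurable]: "dual_value x \<in> borel_measurable borel"
  unfolding borel_measurable_iff_le
proof
  fix a
  have "{\<zeta>. dual_value x \<zeta> \<le> a} = (\<Inter>l\<in>L. {\<zeta>. l \<bullet> rhs x \<zeta> \<le> a})"
    by (auto simp: dual_value_le_iff)
  moreover have "closed {\<zeta>. l \<bullet> rhs x \<zeta> \<le> a}" for l
    unfolding rhs_def
    by (intro closed_Collect_le continuous_intros linear_continuous_on
        matrix_vector_mul_linear[THEN linear_conv_bounded_linear[THEN iffD1]])
  ultimately have "closed {\<zeta>. dual_value x \<zeta> \<le> a}" by (auto intro!: closed_INT)
  then show "{w \<in> space borel. dual_value x w \<le> a} \<in> sets borel" by simp
qed

end

section \<open>Expectations of extended-real functions\<close>

lemma enn2ereal_eq_ereal_enn2real: "z \<noteq> top \<Longrightarrow> enn2ereal z = ereal (enn2real z)"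
  by (cases z) (auto simp: enn2real_ennreal enn2ereal_ennreal)

context prob_space
begin

text \<open>The value \<open>\<infinity>\<close> is taken with positive probability, so the positive
  part has infinite integral, and in \<open>ereal\<close> this outweighs even an infinite negative
  part.\<close>

lemma ereal_expectation_infinite:
  assumes P: "{\<omega> \<in> space M. P \<omega>} \<in> sets M" "\<not> (AE \<omega> in M. P \<omega>)"
    and f: "\<And>\<omega>. \<not> P \<omega> \<Longrightarrow> f \<omega> = \<infinity>"
  shows "ereal_expectation M f = \<infinity>"
proof -
  let ?B = "{\<omega> \<in> space M. \<not> P \<omega>}"
  have B: "?B \<in> sets M"
    using sets.compl_sets[OF P(1)] by (rule back_subst[of "\<lambda>A. A \<in> sets M"]) auto
  have "emeasure M ?B \<noteq> 0"
    using P(2) AE_iff_measurable[OF B, of P] by auto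
  then have "(\<infinity> :: ennreal) = \<infinity> * emeasure M ?B" by (simp add: ennreal_top_mult)
  also have "\<dots> = (\<integral>\<^sup>+\<omega>. \<infinity> * indicator ?B \<omega> \<partial>M)"
    using B by (simp add: nn_integral_cmult_indicator)
  also have "\<dots> \<le> (\<integral>\<^sup>+\<omega>. e2ennreal (f \<omega>) \<partial>M)"
    by (intro nn_integral_mono) (auto simp: indicator_def f e2ennreal_infty)
  finally have "(\<integral>\<^sup>+\<omega>. e2ennreal (f \<omega>) \<partial>M) = \<infinity>" by (simp add: top_unique)
  then show ?thesis by (simp add: ereal_expectation_def)
qed

lemma ereal_expectation_minus_infinite:
  assumes "AE \<omega> in M. f \<omega> = - \<infinity>"
  shows "ereal_expectation M f = - \<infinity>"
proof -
  have "(\<integral>\<^sup>+\<omega>. e2ennreal (f \<omega>) \<partial>M) = (\<integral>\<^sup>+\<omega>. 0 \<partial>M)"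
    using assms by (intro nn_integral_cong_AE) (auto elim!: eventually_mono simp: e2ennreal_neg)
  moreover have "(\<integral>\<^sup>+\<omega>. e2ennreal (- f \<omega>) \<partial>M) = (\<integral>\<^sup>+\<omega>. \<infinity> \<partial>M)"
    using assms by (intro nn_integral_cong_AE) (auto elim!: eventually_mono simp: e2ennreal_infty)
  ultimately show ?thesis
    by (simp add: ereal_expectation_def emeasure_space_1 zero_ennreal.rep_eq)
qed

lemma ereal_expectation_finite:
  assumes a: "integrable M a" and f: "AE \<omega> in M. f \<omega> = ereal (a \<omega>)"
  shows "ereal_expectation M f = ereal (expectation a)"
proof -
  have 1: "(\<integral>\<^sup>+\<omega>. e2ennreal (f \<omega>) \<partial>M) = (\<integral>\<^sup>+\<omega>. ennreal (a \<omega>) \<partial>M)"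
    "(\<integral>\<^sup>+\<omega>. e2ennreal (- f \<omega>) \<partial>M) = (\<integral>\<^sup>+\<omega>. ennreal (- a \<omega>) \<partial>M)"
    using f by (auto intro!: nn_integral_cong_AE elim!: eventually_mono simp: ennreal.abs_eq e2ennreal_ereal)
  have 2: "(\<integral>\<^sup>+\<omega>. ennreal (a \<omega>) \<partial>M) \<noteq> top" "(\<integral>\<^sup>+\<omega>. ennreal (- a \<omega>) \<partial>M) \<noteq> top"
    using a by (auto simp: real_integrable_def)
  show ?thesis
    unfolding ereal_expectation_def 1 real_lebesgue_integral_def[OF a]
    using 2 by (simp add: enn2ereal_eq_ereal_enn2real)
qed

lemma indep_var_of_indep_vars:
  assumes "indep_vars (\<lambda>_. borel) X I" "i \<in> I" "j \<in> I" "i \<noteq> j"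
  shows "indep_var borel (X i) borel (X j)"
proof -
  have "indep_var borel ((\<lambda>g. g i) \<circ> (\<lambda>\<omega>. restrict (\<lambda>k. X k \<omega>) {i})) borel ((\<lambda>g. g j) \<circ> (\<lambda>\<omega>. restrict (\<lambda>k. X k \<omega>) {j}))"
    using assms by (intro indep_var_compose[OF indep_var_restrict[OF assms(1)]]) auto
  then show ?thesis by (simp add: o_def)
qed

end

section \<open>Almost sure properties of independent samples\<close>

locale iid_samples = prob_space M for M :: "'w measure" +
  fixes Z :: "'w \<Rightarrow> real ^ 'd" and X :: "nat \<Rightarrow> 'w \<Rightarrow> real ^ 'd"
  assumes Z [measurable]: "Z \<in> borel_measurable M"
    and indep: "indep_vars (\<lambda>_. borel) X {1..}"
    and distr: "\<And>i. i \<ge> 1 \<Longrightarrow> distr M borel (X i) = distr M borel Z"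
begin

lemma sample_measurable: "i \<ge> 1 \<Longrightarrow> X i \<in> borel_measurable M"
  using indep by (simp add: indep_vars_def)

lemma strong_law_samples:
  assumes f [measurable]: "f \<in> borel_measurable borel" and int: "integrable M (\<lambda>\<omega>. f (Z \<omega>) :: real)"
  shows "AE \<omega> in M. (\<lambda>n. (\<Sum>i = 1..n. f (X i \<omega>)) / real n) \<longlonglongrightarrow> expectation (\<lambda>\<omega>. f (Z \<omega>))"
proof (rule strong_law_of_large_numbers)
  show "random_variable borel (\<lambda>\<omega>. f (X i \<omega>))" if "i \<ge> 1" for i
    using sample_measurable[OF that] by measurable
  show "indep_var borel (\<lambda>\<omega>. f (X i \<omega>)) borel (\<lambda>\<omega>. f (X j \<omega>))" if "i \<ge> 1" "j \<ge> 1" "i \<noteq> j" for i j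
    using indep_var_compose[OF indep_var_of_indep_vars[OF indep, of i j] f f] that by (simp add: o_def)
  show "distr M borel (\<lambda>\<omega>. f (X i \<omega>)) = distr M borel (\<lambda>\<omega>. f (Z \<omega>))" if "i \<ge> 1" for i
    using distr_distr[OF f sample_measurable[OF that]] distr_distr[OF f Z] distr[OF that] by (simp add: o_def)
qed (rule int)

lemma AE_samples_closed:
  assumes A: "closed A" and Z_A: "AE \<omega> in M. Z \<omega> \<in> A"
  shows "AE \<omega> in M. \<forall>i\<ge>1. X i \<omega> \<in> A"
proof -
  have "AE \<omega> in M. X i \<omega> \<in> A" if i: "i \<ge> 1" for i
  proof -
    have "AE x in distr M borel Z. x \<in> A" using A Z_A by (subst AE_distr_iff) auto
    then have "AE x in distr M borel (X i). x \<in> A" by (simp only: distr[OF i])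
    then show ?thesis using A sample_measurable[OF i] by (subst (asm) AE_distr_iff) auto
  qed
  then have "AE \<omega> in M. i \<ge> 1 \<longrightarrow> X i \<omega> \<in> A" for i by (cases "i \<ge> 1") auto
  then show ?thesis by (simp add: AE_all_countable)
qed

text \<open>The rational thresholds make the exceptional null set independent of \<open>b\<close>.\<close>

lemma AE_samples_exceed:
  assumes f [measurable]: "f \<in> borel_measurable borel"
  shows "AE \<omega> in M. \<forall>b::real. (\<forall>i\<ge>1. f (X i \<omega>) \<le> b) \<longrightarrow> (AE \<omega>' in M. f (Z \<omega>') \<le> b)"
proof -
  \<comment> \<open>The strong law for the indicator of exceeding \<open>t\<close>: if no sample
    exceeded \<open>t\<close>, all relative frequencies would vanish, although their limit is
    positive.\<close>
  have hit: "AE \<omega> in M. prob {\<omega> \<in> space M. f (Z \<omega>) > t} > 0 \<longrightarrow> (\<exists>i\<ge>1. f (X i \<omega>) > t)" for t :: real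
  proof -
    let ?g = "\<lambda>z. indicator {z. f z > t} z :: real"
    have g: "?g \<in> borel_measurable borel" by measurable
    have E: "expectation (\<lambda>\<omega>. ?g (Z \<omega>)) = prob {\<omega> \<in> space M. f (Z \<omega>) > t}"
    proof -
      have "expectation (\<lambda>\<omega>. ?g (Z \<omega>)) = expectation (indicator {\<omega> \<in> space M. f (Z \<omega>) > t})"
        by (intro Bochner_Integration.integral_cong) (auto simp: indicator_def)
      then show ?thesis by (simp add: Int_absorb2 subset_eq)
    qed
    have "AE \<omega> in M. (\<lambda>n. (\<Sum>i = 1..n. ?g (X i \<omega>)) / real n) \<longlonglongrightarrow> expectation (\<lambda>\<omega>. ?g (Z \<omega>))"
      by (intro strong_law_samples g integrable_const_bound[of _ 1] AE_I2) (auto simp: indicator_def)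
    then show ?thesis
    proof eventually_elim
      case (elim \<omega>)
      show ?case
      proof
        assume pos: "prob {\<omega> \<in> space M. f (Z \<omega>) > t} > 0"
        show "\<exists>i\<ge>1. f (X i \<omega>) > t"
        proof (rule ccontr)
          assume "\<not> (\<exists>i\<ge>1. f (X i \<omega>) > t)"
          then have "(\<Sum>i = 1..n. ?g (X i \<omega>)) = 0" for n by (intro sum.neutral) auto
          then have "(\<lambda>n::nat. 0 :: real) \<longlonglongrightarrow> prob {\<omega> \<in> space M. f (Z \<omega>) > t}"
            using elim unfolding E by simp
          then show False using pos LIMSEQ_unique[OF tendsto_const] by fastforce
        qed
      qed
    qed
  qed
  have "AE \<omega> in M. \<forall>t::rat. prob {\<omega> \<in> space M. f (Z \<omega>) > of_rat t} > 0 \<longrightarrow> (\<exists>i\<ge>1. f (X i \<omega>) > of_rat t)"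
    unfolding AE_all_countable using hit by blast
  then show ?thesis
  proof eventually_elim
    case (elim \<omega>)
    show ?case
    proof (intro allI impI)
      fix b :: real assume b: "\<forall>i\<ge>1. f (X i \<omega>) \<le> b"
      have "AE \<omega>' in M. of_rat t > b \<longrightarrow> f (Z \<omega>') \<le> of_rat t" for t
      proof (cases "of_rat t > b")
        case True
        then have "\<not> prob {\<omega> \<in> space M. f (Z \<omega>) > of_rat t} > 0" using elim b by force
        then have "prob {\<omega> \<in> space M. f (Z \<omega>) > of_rat t} = 0" using measure_nonneg[of M] by (simp add: order_antisym not_less)
        then have "AE \<omega>' in M. \<omega>' \<notin> {\<omega> \<in> space M. f (Z \<omega>) > of_rat t}" by (subst (asm) prob_eq_0) auto
        then show ?thesis using AE_space by eventually_elim auto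
      qed simp
      then have "AE \<omega>' in M. \<forall>t::rat. of_rat t > b \<longrightarrow> f (Z \<omega>') \<le> of_rat t"
        unfolding AE_all_countable by blast
      then show "AE \<omega>' in M. f (Z \<omega>') \<le> b"
      proof eventually_elim
        case (elim \<omega>')
        show ?case
        proof (rule ccontr)
          assume "\<not> ?thesis"
          then obtain t where "b < of_rat t" "of_rat t < f (Z \<omega>')" using of_rat_dense[of b "f (Z \<omega>')"] by auto
          then show False using elim by force
        qed
      qed
    qed
  qed
qed

end

section \<open>Almost sure convergence for the two-stage problem\<close>

locale stochastic_two_stage = two_stage q T W h0 H G g R L + iid_samples M Z X
  for q :: "real ^ 'r" and T :: "real ^ 'n ^ 'm" and W :: "real ^ 'r ^ 'm"
    and h0 :: "real ^ 'm" and H :: "real ^ 'd ^ 'm" and G :: "real ^ 'd ^ 'k" and g :: "real ^ 'k"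
    and R L :: "(real ^ 'm) set" and M :: "'w measure" and Z :: "'w \<Rightarrow> real ^ 'd"
    and X :: "nat \<Rightarrow> 'w \<Rightarrow> real ^ 'd" +
  fixes c :: "real ^ 'n"
  assumes integrable_norm: "integrable M (\<lambda>\<omega>. norm (Z \<omega>))"
    and support: "AE \<omega> in M. g \<le> G *v Z \<omega>"
begin

definition expected_cost :: "real ^ 'n \<Rightarrow> real" where
  "expected_cost x = c \<bullet> x + expectation (\<lambda>\<omega>. dual_value x (Z \<omega>))"

definition feasible_decisions :: "(real ^ 'n) set" where
  "feasible_decisions = {x. AE \<omega> in M. feasible_at x (Z \<omega>)}"

lemma integrable_dual_value: "integrable M (\<lambda>\<omega>. dual_value x (Z \<omega>))"
proof -
  obtain A B where AB: "\<And>\<zeta>. \<bar>dual_value x \<zeta>\<bar> \<le> A + B * norm \<zeta>"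
    using dual_value_linear_growth by blast
  show ?thesis
  proof (rule Bochner_Integration.integrable_bound)
    show "integrable M (\<lambda>\<omega>. A + B * norm (Z \<omega>))" using integrable_norm by simp
    show "AE \<omega> in M. norm (dual_value x (Z \<omega>)) \<le> norm (A + B * norm (Z \<omega>))"
      using AB by (intro AE_I2) (metis abs_ge_self order_trans real_norm_def)
  qed measurable
qed

lemma stochastic_cost_eq:
  "stochastic_cost M Z c q T W (\<lambda>\<zeta>. h0 + H *v \<zeta>) x
    = (if x \<in> feasible_decisions then ereal (expected_cost x) else \<infinity>)"
proof (cases "x \<in> feasible_decisions")
  case True
  then have "AE \<omega> in M. second_stage_cost q T W (\<lambda>\<zeta>. h0 + H *v \<zeta>) x (Z \<omega>) = ereal (dual_value x (Z \<omega>))"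
    unfolding feasible_decisions_def second_stage_cost_eq by auto
  then show ?thesis
    using ereal_expectation_finite[OF integrable_dual_value] True
    by (simp add: stochastic_cost_def expected_cost_def)
next
  case False
  have "{\<omega> \<in> space M. feasible_at x (Z \<omega>)} = Z -` {\<zeta>. feasible_at x \<zeta>} \<inter> space M" by auto
  also have "\<dots> \<in> sets M"
    using closed_feasible_at by (intro measurable_sets[OF Z]) auto
  finally have "ereal_expectation M (\<lambda>\<omega>. second_stage_cost q T W (\<lambda>\<zeta>. h0 + H *v \<zeta>) x (Z \<omega>)) = \<infinity>"
    using False
    by (intro ereal_expectation_infinite[of "\<lambda>\<omega>. feasible_at x (Z \<omega>)"])
      (auto simp: feasible_decisions_def second_stage_cost_eq)
  then show ?thesis using False by (simp add: stochastic_cost_def)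
qed

lemma expected_cost_convex_comb:
  assumes "0 \<le> \<theta>" "\<theta> \<le> 1"
  shows "expected_cost ((1 - \<theta>) *\<^sub>R x + \<theta> *\<^sub>R y) \<le> (1 - \<theta>) * expected_cost x + \<theta> * expected_cost y"
proof -
  have "expectation (\<lambda>\<omega>. dual_value ((1 - \<theta>) *\<^sub>R x + \<theta> *\<^sub>R y) (Z \<omega>))
      \<le> expectation (\<lambda>\<omega>. (1 - \<theta>) * dual_value x (Z \<omega>) + \<theta> * dual_value y (Z \<omega>))"
    using assms by (intro integral_mono dual_value_convex_comb) (auto intro!: integrable_dual_value)
  also have "\<dots> = (1 - \<theta>) * expectation (\<lambda>\<omega>. dual_value x (Z \<omega>)) + \<theta> * expectation (\<lambda>\<omega>. dual_value y (Z \<omega>))"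
    using integrable_dual_value by simp
  finally show ?thesis by (simp add: expected_cost_def inner_add_right algebra_simps)
qed

text \<open>The strong law has a separate null set for each decision. Countably many decisions share
  one, and the uniform Lipschitz bound carries convergence from a countable dense set to all
  decisions.\<close>

lemma AE_sample_average_tendsto:
  "AE \<omega> in M. \<forall>x. (\<lambda>N. sample_average c (\<lambda>i. X i \<omega>) N x) \<longlonglongrightarrow> expected_cost x"
proof -
  obtain B where B: "B \<ge> 0" "\<And>s N x y. N \<ge> 1 \<Longrightarrow> sample_average c s N x \<le> sample_average c s N y + B * norm (x - y)"
    using sample_average_lipschitz by blast
  obtain D :: "(real ^ 'n) set" where D: "countable D" "\<And>S. open S \<Longrightarrow> S \<noteq> {} \<Longrightarrow> \<exists>d\<in>D. d \<in> S"
    using countable_dense_setE by blast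
  have pt: "AE \<omega> in M. (\<lambda>N. sample_average c (\<lambda>i. X i \<omega>) N x) \<longlonglongrightarrow> expected_cost x" for x
    using strong_law_samples[OF dual_value_measurable integrable_dual_value, of x]
    by eventually_elim (simp add: sample_average_def expected_cost_def tendsto_add)
  \<comment> \<open>The limit inherits the Lipschitz bound. The inequality does not involve the
    outcome, so holding almost surely means holding.\<close>
  have elip: "expected_cost x \<le> expected_cost y + B * norm (x - y)" for x y
  proof -
    have "AE \<omega> in M. expected_cost x \<le> expected_cost y + B * norm (x - y)"
      using pt[of x] pt[of y]
    proof eventually_elim
      case (elim \<omega>)
      show ?case
      proof (rule LIMSEQ_le[OF elim(1) tendsto_add[OF elim(2) tendsto_const]])
        show "\<exists>N. \<forall>n\<ge>N. sample_average c (\<lambda>i. X i \<omega>) n x \<le> sample_average c (\<lambda>i. X i \<omega>) n y + B * norm (x - y)"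
          using B(2) by blast
      qed
    qed
    then show ?thesis by simp
  qed
  have "AE \<omega> in M. \<forall>x\<in>D. (\<lambda>N. sample_average c (\<lambda>i. X i \<omega>) N x) \<longlonglongrightarrow> expected_cost x"
    using D(1) pt by (simp add: AE_ball_countable)
  then show ?thesis
  proof eventually_elim
    case (elim \<omega>)
    show ?case
    proof
      fix x
      let ?s = "\<lambda>N. sample_average c (\<lambda>i. X i \<omega>) N"
      show "(\<lambda>N. ?s N x) \<longlonglongrightarrow> expected_cost x"
      proof (rule LIMSEQ_I)
        fix r :: real assume r: "r > 0"
        define \<delta> where "\<delta> = r / (3 * (B + 1))"
        have \<delta>: "\<delta> > 0" "B * \<delta> < r / 3" using r B(1) by (auto simp: \<delta>_def field_simps)
        obtain y where y: "y \<in> D" "y \<in> ball x \<delta>" using D(2)[of "ball x \<delta>"] \<delta> by auto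
        then have "norm (x - y) \<le> \<delta>" by (simp add: dist_norm)
        then have n: "B * norm (x - y) < r / 3" "B * norm (y - x) < r / 3"
          using mult_left_mono[OF _ B(1), of "norm (x - y)" \<delta>] \<delta>(2) by (auto simp: norm_minus_commute)
        obtain N where N: "\<And>n. n \<ge> N \<Longrightarrow> norm (?s n y - expected_cost y) < r / 3"
          using LIMSEQ_D[OF bspec[OF elim y(1)], of "r / 3"] r by auto
        have "norm (?s n x - expected_cost x) < r" if "n \<ge> max N 1" for n
        proof -
          have n1: "n \<ge> 1" "n \<ge> N" using that by auto
          show ?thesis
            using N[OF n1(2)] B(2)[OF n1(1), of "\<lambda>i. X i \<omega>" x y] B(2)[OF n1(1), of "\<lambda>i. X i \<omega>" y x]
              elip[of x y] elip[of y x] n by (simp add: abs_if split: if_splits)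
        qed
        then show "\<exists>N. \<forall>n\<ge>N. norm (?s n x - expected_cost x) < r" by blast
      qed
    qed
  qed
qed

text \<open>In \<open>r \<bullet> rhs x \<zeta>\<close> the decision enters only as a threshold for
  \<open>r \<bullet> (h0 + H *v \<zeta>)\<close>. One null set per row \<open>r\<close> thus serves
  all decisions, including those that depend on the samples.\<close>

lemma AE_sample_feasible_subset:
  "AE \<omega> in M. (\<Inter>N. sample_feasible (\<lambda>i. X i \<omega>) N) \<subseteq> feasible_decisions"
proof -
  have "AE \<omega> in M. \<forall>r\<in>R. \<forall>b::real. (\<forall>i\<ge>1. r \<bullet> (h0 + H *v X i \<omega>) \<le> b)
      \<longrightarrow> (AE \<omega>' in M. r \<bullet> (h0 + H *v Z \<omega>') \<le> b)"
  proof -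
    have meas: "(\<lambda>\<zeta>. r \<bullet> (h0 + H *v \<zeta>)) \<in> borel_measurable borel" for r
      by (intro borel_measurable_continuous_onI continuous_intros linear_continuous_on
        matrix_vector_mul_linear[THEN linear_conv_bounded_linear[THEN iffD1]])
    show ?thesis
      unfolding AE_finite_all[OF finite_R] using AE_samples_exceed[OF meas] by blast
  qed
  then show ?thesis
  proof eventually_elim
    case (elim \<omega>)
    show ?case
    proof
      fix x assume x: "x \<in> (\<Inter>N. sample_feasible (\<lambda>i. X i \<omega>) N)"
      have feas: "feasible_at x (X i \<omega>)" if "i \<ge> 1" for i
      proof -
        have "x \<in> sample_feasible (\<lambda>i. X i \<omega>) i" using x by blast
        then show ?thesis using that by (simp add: sample_feasible_def)
      qed
      have "AE \<omega>' in M. r \<bullet> rhs x (Z \<omega>') \<le> 0" if r: "r \<in> R" for r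
      proof -
        have "\<forall>i\<ge>1. r \<bullet> (h0 + H *v X i \<omega>) \<le> r \<bullet> (T *v x)"
          using feas r by (auto simp: feasible_at_def rhs_def inner_diff_right)
        then have "AE \<omega>' in M. r \<bullet> (h0 + H *v Z \<omega>') \<le> r \<bullet> (T *v x)" using elim r by blast
        then show ?thesis by eventually_elim (simp add: rhs_def inner_diff_right)
      qed
      then show "x \<in> feasible_decisions"
        using finite_R by (simp add: feasible_decisions_def feasible_at_def AE_finite_all)
    qed
  qed
qed

text \<open>The alternative for \<open>V\<close> treats both problems at once: each cost lies
  between the sample average with its domain and the multi-policy cost, and the argument uses only
  this sandwich.\<close>

lemma AE_convergence:
  fixes x0 xb :: "real ^ 'n" and p :: ereal and e :: real and eps :: "nat \<Rightarrow> real"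
  defines "U \<equiv> \<lambda>N \<omega> i. lp_ball p (X i \<omega>) (eps N) \<inter> {\<zeta>. g \<le> G *v \<zeta>}"
  assumes p: "p \<ge> 1" and e: "e > 0"
    and xb: "\<And>z. g \<le> G *v z \<Longrightarrow> \<exists>y\<in>linear_decision_rules.
      \<forall>\<zeta>\<in>lp_ball p z e. g \<le> G *v \<zeta> \<longrightarrow> rhs xb \<zeta> \<le> W *v y \<zeta>"
    and eps: "\<And>N. N \<ge> 1 \<Longrightarrow> eps N \<ge> 0" "eps \<longlonglongrightarrow> 0"
    and x0: "x0 \<in> feasible_decisions" and opt: "\<And>x. x \<in> feasible_decisions \<Longrightarrow> expected_cost x0 \<le> expected_cost x"
    and bdd: "bounded {x \<in> feasible_decisions. expected_cost x \<le> expected_cost x0}"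
    and V: "V = sample_robust_cost c q T W (\<lambda>\<zeta>. h0 + H *v \<zeta>) \<or>
      V = multi_policy_cost linear_decision_rules c q T W (\<lambda>\<zeta>. h0 + H *v \<zeta>)"
  shows "AE \<omega> in M. (\<lambda>N. INF x. V N (U N \<omega>) x) \<longlonglongrightarrow> ereal (expected_cost x0) \<and>
    (\<forall>xh. (\<forall>\<^sub>F N in sequentially. xh N \<in> optimal_decisions (V N (U N \<omega>))) \<longrightarrow>
      (\<forall>a. accumulation_point xh a \<longrightarrow> a \<in> feasible_decisions \<and> expected_cost a \<le> expected_cost x0))"
proof -
  have closed_support: "closed {\<zeta>. g \<le> G *v \<zeta>}"
    unfolding less_eq_vec_def
    by (intro closed_Collect_all closed_Collect_le continuous_intros linear_continuous_on
        matrix_vector_mul_linear[THEN linear_conv_bounded_linear[THEN iffD1]])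
  have "AE \<omega> in M. \<forall>i\<ge>1. X i \<omega> \<in> {\<zeta>. g \<le> G *v \<zeta>}"
    using support by (intro AE_samples_closed closed_support) simp
  moreover have "AE \<omega> in M. \<forall>i\<ge>1. X i \<omega> \<in> {\<zeta>. feasible_at x0 \<zeta>}"
    using x0 by (intro AE_samples_closed closed_feasible_at) (simp add: feasible_decisions_def)
  ultimately show ?thesis
    using AE_sample_average_tendsto AE_sample_feasible_subset
  proof eventually_elim
    case (elim \<omega>)
    define s where "s i = X i \<omega>" for i
    have s: "g \<le> G *v s i" "feasible_at x0 (s i)" if "i \<ge> 1" for i
      using elim(1,2) that by (auto simp: s_def)
    have lim: "(\<lambda>N. sample_average c s N x) \<longlonglongrightarrow> expected_cost x" for x
      using elim(3) by (simp add: s_def[abs_def])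
    have sub: "(\<Inter>N. sample_feasible s N) \<subseteq> feasible_decisions"
      using elim(4) by (simp add: s_def[abs_def])
    have U: "U N \<omega> = (\<lambda>i. lp_ball p (s i) (eps N) \<inter> {\<zeta>. g \<le> G *v \<zeta>})" for N
      by (simp add: U_def s_def)
    have s_U: "s i \<in> U N \<omega> i" if "N \<ge> 1" "i \<in> {1..N}" for N i
      using s[of i] that eps(1)[of N] p by (simp add: U lp_ball_def)
    have V_le: "V N (U N \<omega>) x \<le> multi_policy_cost linear_decision_rules c q T W (\<lambda>\<zeta>. h0 + H *v \<zeta>) N (U N \<omega>) x"
      for N x using V sample_robust_le_multi_policy by auto
    have V_ge: "(if x \<in> sample_feasible s N then ereal (sample_average c s N x) else \<infinity>) \<le> V N (U N \<omega>) x"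
      if "N \<ge> 1" for N x
    proof -
      have "(if x \<in> sample_feasible s N then ereal (sample_average c s N x) else \<infinity>)
          \<le> sample_robust_cost c q T W (\<lambda>\<zeta>. h0 + H *v \<zeta>) N (U N \<omega>) x"
        using that s_U by (intro sample_robust_ge_sample_average) auto
      also have "\<dots> \<le> V N (U N \<omega>) x" using V sample_robust_le_multi_policy by auto
      finally show ?thesis .
    qed
    have upper: "\<exists>x. \<forall>\<^sub>F N in sequentially. V N (U N \<omega>) x \<le> ereal (expected_cost x0 + \<eta>)" if \<eta>: "\<eta> > 0" for \<eta>
    proof -
      define D where "D = \<bar>expected_cost xb - expected_cost x0\<bar>"
      \<comment> \<open>Two mixtures of weight \<open>\<theta>\<close> raise the cost by at most
        \<open>2 * \<theta> * D \<le> \<eta> / 2\<close>; the other half of \<open>\<eta>\<close>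
        goes into the multi-policy bound. The added 1 covers \<open>D = 0\<close>.\<close>
      define \<theta> where "\<theta> = min 1 (\<eta> / (4 * (D + 1)))"
      have D0: "D \<ge> 0" by (simp add: D_def)
      have \<theta>: "0 < \<theta>" "\<theta> \<le> 1" using \<eta> D0 by (auto simp: \<theta>_def)
      have \<theta>D: "2 * \<theta> * D \<le> \<eta> / 2"
      proof -
        have "\<theta> * (4 * (D + 1)) \<le> \<eta>"
          using mult_right_mono[of \<theta> "\<eta> / (4 * (D + 1))" "4 * (D + 1)"] D0 by (simp add: \<theta>_def)
        then show ?thesis using \<theta> by (simp add: algebra_simps)
      qed
      define x' where "x' = (1 - \<theta>) *\<^sub>R x0 + \<theta> *\<^sub>R xb"
      define x'' where "x'' = (1 - \<theta>) *\<^sub>R x' + \<theta> *\<^sub>R xb"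
      have step: "expected_cost ((1 - \<theta>) *\<^sub>R z + \<theta> *\<^sub>R xb) \<le> expected_cost x0 + b + \<theta> * D"
        if "expected_cost z \<le> expected_cost x0 + b" "b \<ge> 0" for z b
      proof -
        have "expected_cost ((1 - \<theta>) *\<^sub>R z + \<theta> *\<^sub>R xb) \<le> (1 - \<theta>) * expected_cost z + \<theta> * expected_cost xb"
          using \<theta> by (intro expected_cost_convex_comb) auto
        also have "\<dots> \<le> (1 - \<theta>) * (expected_cost x0 + b) + \<theta> * (expected_cost x0 + D)"
          using that \<theta> by (intro add_mono mult_left_mono) (auto simp: D_def)
        also have "\<dots> \<le> expected_cost x0 + b + \<theta> * D" using \<theta> that by (simp add: algebra_simps)
        finally show ?thesis .
      qed
      have "expected_cost x' \<le> expected_cost x0 + 0 + \<theta> * D" unfolding x'_def by (rule step) auto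
      then have "expected_cost x'' \<le> expected_cost x0 + \<theta> * D + \<theta> * D"
        unfolding x''_def using \<theta> D0 by (intro step) auto
      then have cost: "expected_cost x'' \<le> expected_cost x0 + \<eta> / 2" using \<theta>D by linarith
      have "\<eta> / 2 > 0" using \<eta> by simp
      from multi_policy_eventually_le[OF p e \<theta> xb x'_def x''_def s eps lim this]
      have "\<forall>\<^sub>F N in sequentially. multi_policy_cost linear_decision_rules c q T W (\<lambda>\<zeta>. h0 + H *v \<zeta>) N
          (U N \<omega>) x'' \<le> ereal (expected_cost x'' + \<eta> / 2)"
        unfolding U by simp
      then have "\<forall>\<^sub>F N in sequentially. V N (U N \<omega>) x'' \<le> ereal (expected_cost x0 + \<eta>)"
      proof eventually_elim
        case (elim N)
        have "ereal (expected_cost x'' + \<eta> / 2) \<le> ereal (expected_cost x0 + \<eta>)" using cost by simp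
        then show ?case using V_le[of N x''] elim by order
      qed
      then show ?thesis by blast
    qed
    obtain B where B: "B \<ge> 0" "\<And>s N x y. N \<ge> 1 \<Longrightarrow> sample_average c s N x \<le> sample_average c s N y + B * norm (x - y)"
      using sample_average_lipschitz by blast
    have x0_mem: "x0 \<in> sample_feasible s N" for N using s(2) by (auto simp: sample_feasible_def)
    note convergence = convergence_of_minimal_values[of "sample_average c s" B expected_cost "sample_feasible s"
        feasible_decisions x0 "expected_cost x0" "\<lambda>N. V N (U N \<omega>)", OF sample_average_convex_comb B(2) lim
        closed_sample_feasible convex_sample_feasible decseq_sample_feasible sub x0_mem refl opt bdd V_ge upper]
    show ?case
    proof (rule conjI)
      show "(\<lambda>N. INF x. V N (U N \<omega>) x) \<longlonglongrightarrow> ereal (expected_cost x0)"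
        by (rule convergence(1))
      show "\<forall>xh. (\<forall>\<^sub>F N in sequentially. xh N \<in> optimal_decisions (V N (U N \<omega>))) \<longrightarrow>
          (\<forall>a. accumulation_point xh a \<longrightarrow> a \<in> feasible_decisions \<and> expected_cost a \<le> expected_cost x0)"
        by (intro allI impI) (rule convergence(2))
    qed
  qed
qed

end

text \<open>The degenerate case of an empty \<open>L\<close>: every cost level can be reached
  wherever the program is feasible, so no value is finite.\<close>

lemma second_stage_cost_without_dual_solution:
  assumes "\<And>b t. (\<exists>y. b \<le> W *v y \<and> q \<bullet> y \<le> t) \<longleftrightarrow> (\<forall>r\<in>R. r \<bullet> b \<le> 0)"
  shows "second_stage_cost q T W h x \<zeta> = (if \<forall>r\<in>R. r \<bullet> (h \<zeta> - T *v x) \<le> 0 then - \<infinity> else \<infinity>)"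
proof -
  have le_iff: "h \<zeta> \<le> T *v x + W *v y \<longleftrightarrow> h \<zeta> - T *v x \<le> W *v y" for y
    by (simp add: less_eq_vec_def algebra_simps)
  show ?thesis
  proof (cases "\<forall>r\<in>R. r \<bullet> (h \<zeta> - T *v x) \<le> 0")
    case True
    have "second_stage_cost q T W h x \<zeta> \<le> ereal t" for t
    proof -
      obtain y where "h \<zeta> - T *v x \<le> W *v y" "q \<bullet> y \<le> t" using assms True by blast
      then show ?thesis
        unfolding second_stage_cost_def by (intro INF_lower2[of y]) (auto simp: le_iff)
    qed
    then show ?thesis using True by (simp add: ereal_bot)
  next
    case False
    then have "\<not> h \<zeta> - T *v x \<le> W *v y" for y using assms by blast
    then show ?thesis using False by (simp add: second_stage_cost_def le_iff top_ereal_def)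
  qed
qed

theorem theorem2:
  fixes c :: "real ^ 'n" and q :: "real ^ 'r"
    and T :: "real ^ 'n ^ 'm" and W :: "real ^ 'r ^ 'm"
    and h0 :: "real ^ 'm" and H :: "real ^ 'd ^ 'm" and h :: "real ^ 'd \<Rightarrow> real ^ 'm"
    and G :: "real ^ 'd ^ 'k" and g0 :: "real ^ 'k" and \<Xi> :: "(real ^ 'd) set"
    and M :: "'w measure" and \<xi> :: "'w \<Rightarrow> real ^ 'd" and \<xi>s :: "nat \<Rightarrow> 'w \<Rightarrow> real ^ 'd"
    and p :: ereal and \<epsilon> :: "nat \<Rightarrow> real"
    and U :: "nat \<Rightarrow> 'w \<Rightarrow> nat \<Rightarrow> (real ^ 'd) set"
    and Pol :: "(real ^ 'd \<Rightarrow> real ^ 'r) set"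
  assumes h: "h = (\<lambda>\<zeta>. h0 + H *v \<zeta>)"
    and Xi: "\<Xi> = {\<zeta>. G *v \<zeta> \<ge> g0}"
    and M: "prob_space M"
    and xi: "\<xi> \<in> borel_measurable M"
    and xi_Xi: "measure M {\<omega> \<in> space M. \<xi> \<omega> \<in> \<Xi>} = 1"
    and samples_indep: "prob_space.indep_vars M (\<lambda>_. borel) \<xi>s {1..}"
    and samples_distr: "\<And>i. i \<ge> 1 \<Longrightarrow> distr M borel (\<xi>s i) = distr M borel \<xi>"
    and p: "p \<ge> 1"
    and eps_nonneg: "\<And>N. N \<ge> 1 \<Longrightarrow> \<epsilon> N \<ge> 0"
    and U: "U = (\<lambda>N \<omega> i. lp_ball p (\<xi>s i \<omega>) (\<epsilon> N) \<inter> \<Xi>)"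
    and A1: "Pol = linear_decision_rules" "\<epsilon> \<longlonglongrightarrow> 0"
    and A2: "\<bar>INF x. stochastic_cost M \<xi> c q T W h x\<bar> \<noteq> \<infinity>"
            "integrable M (\<lambda>\<omega>. lp_norm p (\<xi> \<omega>))"
    and A3: "optimal_decisions (stochastic_cost M \<xi> c q T W h) \<noteq> {}"
            "bounded (optimal_decisions (stochastic_cost M \<xi> c q T W h))"
    and A4: "\<exists>(x :: real ^ 'n) e. e > 0 \<and>
               (\<forall>z\<in>\<Xi>. \<exists>y\<in>linear_decision_rules. \<forall>\<zeta>\<in>lp_ball p z e \<inter> \<Xi>. T *v x + W *v y \<zeta> \<ge> h \<zeta>)"
  shows
    "(AE \<omega> in M.
        (\<lambda>N. INF x. sample_robust_cost c q T W h N (U N \<omega>) x)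
          \<longlonglongrightarrow> (INF x. stochastic_cost M \<xi> c q T W h x) \<and>
        (\<lambda>N. INF x. multi_policy_cost Pol c q T W h N (U N \<omega>) x)
          \<longlonglongrightarrow> (INF x. stochastic_cost M \<xi> c q T W h x)) \<and>
     (AE \<omega> in M. \<forall>xhat :: nat \<Rightarrow> real ^ 'n.
        (\<forall>\<^sub>F N in sequentially.
           xhat N \<in> optimal_decisions (sample_robust_cost c q T W h N (U N \<omega>))) \<longrightarrow>
        (\<forall>a. accumulation_point xhat a \<longrightarrow>
           a \<in> optimal_decisions (stochastic_cost M \<xi> c q T W h))) \<and>
     (AE \<omega> in M. \<forall>xhat :: nat \<Rightarrow> real ^ 'n.
        (\<forall>\<^sub>F N in sequentially.
           xhat N \<in> optimal_decisions (multi_policy_cost Pol c q T W h N (U N \<omega>))) \<longrightarrow>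
        (\<forall>a. accumulation_point xhat a \<longrightarrow>
           a \<in> optimal_decisions (stochastic_cost M \<xi> c q T W h)))"

proof -
  interpret prob_space M by (rule M)
  define V where "V = stochastic_cost M \<xi> c q T W h"
  obtain x0 where x0: "x0 \<in> optimal_decisions V" using A3(1) unfolding V_def by blast
  have x0_le: "V x0 \<le> V x" for x
    using x0 by (simp add: optimal_decisions_def is_arg_min_def not_less)
  have V_x0: "(INF x. V x) = V x0"
    using x0_le by (intro antisym INF_lower INF_greatest) auto
  have fin: "\<bar>V x0\<bar> \<noteq> \<infinity>" using A2(1) V_x0 unfolding V_def by simp
  have Xi': "\<Xi> = {\<zeta>. g0 \<le> G *v \<zeta>}" by (simp add: Xi)
  obtain R L :: "(real ^ 'm) set" where RL: "finite R" "finite L"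
    "\<And>b t. (\<exists>y. b \<le> W *v y \<and> q \<bullet> y \<le> t) \<longleftrightarrow> (\<forall>r\<in>R. r \<bullet> b \<le> 0) \<and> (\<forall>l\<in>L. l \<bullet> b \<le> t)"
    by (rule linear_program_value[of W q]) (rule that)
  \<comment> \<open>Finiteness of the optimal value excludes an empty \<open>L\<close>: the
    second-stage cost at \<open>x0\<close> would be infinite everywhere, with expectation
    \<open>- \<infinity>\<close> or \<open>\<infinity>\<close> according to whether
    \<open>x0\<close> is feasible almost surely.\<close>
  have L: "L \<noteq> {}"
  proof
    assume "L = {}"
    then have cost: "second_stage_cost q T W h x0 \<zeta> = (if \<forall>r\<in>R. r \<bullet> (h \<zeta> - T *v x0) \<le> 0 then - \<infinity> else \<infinity>)" for \<zeta>
      using RL(3) by (intro second_stage_cost_without_dual_solution) simp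
    let ?P = "\<lambda>\<omega>. \<forall>r\<in>R. r \<bullet> (h (\<xi> \<omega>) - T *v x0) \<le> 0"
    have closed: "closed (\<Inter>r\<in>R. {\<zeta>. r \<bullet> (h0 + H *v \<zeta> - T *v x0) \<le> 0})"
      by (intro closed_INT ballI closed_Collect_le continuous_intros linear_continuous_on
          matrix_vector_mul_linear[THEN linear_conv_bounded_linear[THEN iffD1]])
    have "{\<omega> \<in> space M. ?P \<omega>} = \<xi> -` (\<Inter>r\<in>R. {\<zeta>. r \<bullet> (h0 + H *v \<zeta> - T *v x0) \<le> 0}) \<inter> space M"
      by (auto simp: h)
    also have "\<dots> \<in> sets M" using closed by (intro measurable_sets[OF xi]) auto
    finally have P: "{\<omega> \<in> space M. ?P \<omega>} \<in> sets M" .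
    have "\<bar>ereal_expectation M (\<lambda>\<omega>. second_stage_cost q T W h x0 (\<xi> \<omega>))\<bar> = \<infinity>"
    proof (cases "AE \<omega> in M. ?P \<omega>")
      case True
      then have "AE \<omega> in M. second_stage_cost q T W h x0 (\<xi> \<omega>) = - \<infinity>"
        by eventually_elim (simp add: cost)
      then show ?thesis by (simp add: ereal_expectation_minus_infinite)
    next
      case False
      have "ereal_expectation M (\<lambda>\<omega>. second_stage_cost q T W h x0 (\<xi> \<omega>)) = \<infinity>"
        by (rule ereal_expectation_infinite[OF P False]) (simp only: cost if_False)
      then show ?thesis by simp
    qed
    then show False using fin unfolding V_def stochastic_cost_def by auto
  qed
  have int: "integrable M (\<lambda>\<omega>. norm (\<xi> \<omega>))"
  proof (rule Bochner_Integration.integrable_bound)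
    show "integrable M (\<lambda>\<omega>. real CARD('d) * lp_norm p (\<xi> \<omega>))" using A2(2) by simp
    show "AE \<omega> in M. norm (norm (\<xi> \<omega>)) \<le> norm (real CARD('d) * lp_norm p (\<xi> \<omega>))"
    proof (rule AE_I2)
      fix \<omega>
      show "norm (norm (\<xi> \<omega>)) \<le> norm (real CARD('d) * lp_norm p (\<xi> \<omega>))"
        using lp_norm_bounds(1)[OF p, of "\<xi> \<omega>"] abs_ge_self[of "real CARD('d) * lp_norm p (\<xi> \<omega>)"]
        unfolding real_norm_def abs_norm_cancel by linarith
    qed
  qed (use xi in measurable)
  have supp: "AE \<omega> in M. g0 \<le> G *v \<xi> \<omega>"
  proof -
    have "prob {\<omega> \<in> space M. \<xi> \<omega> \<in> \<Xi>} = 1" by (rule xi_Xi)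
    then have "AE \<omega> in M. \<omega> \<in> {\<omega> \<in> space M. \<xi> \<omega> \<in> \<Xi>}"
      by (metis AE_prob_1)
    then show ?thesis by eventually_elim (simp add: Xi')
  qed
  interpret S: stochastic_two_stage q T W h0 H G g0 R L M \<xi> \<xi>s c
    by unfold_locales (use RL L xi samples_indep samples_distr int supp in auto)
  have V_eq: "V x = (if x \<in> S.feasible_decisions then ereal (S.expected_cost x) else \<infinity>)" for x
    unfolding V_def h by (rule S.stochastic_cost_eq)
  have x0_feas: "x0 \<in> S.feasible_decisions" using fin V_eq[of x0] by (auto split: if_splits)
  have V_x0': "V x0 = ereal (S.expected_cost x0)" using V_eq x0_feas by simp
  have opt: "S.expected_cost x0 \<le> S.expected_cost x" if "x \<in> S.feasible_decisions" for x
    using x0_le[of x] V_x0' V_eq[of x] that by simp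
  \<comment> \<open>\<open>A3\<close> speaks of minimizers, the convergence argument of a sublevel
    set of a real function on its domain; they agree because \<open>V x0\<close> is finite.\<close>
  have opt_set: "optimal_decisions V = {x \<in> S.feasible_decisions. S.expected_cost x \<le> S.expected_cost x0}"
  proof (intro set_eqI iffI)
    fix x assume "x \<in> optimal_decisions V"
    then have "V x \<le> V x0" by (simp add: optimal_decisions_def is_arg_min_def not_less)
    then show "x \<in> {x \<in> S.feasible_decisions. S.expected_cost x \<le> S.expected_cost x0}"
      using V_eq[of x] V_x0' by (auto split: if_splits)
  next
    fix x assume "x \<in> {x \<in> S.feasible_decisions. S.expected_cost x \<le> S.expected_cost x0}"
    then have "V x \<le> V x0" using V_eq[of x] V_x0' by simp
    then have "V x \<le> V z" for z using x0_le[of z] by order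
    then show "x \<in> optimal_decisions V" by (simp add: optimal_decisions_def is_arg_min_def not_less)
  qed
  obtain xb e where e: "e > 0" and A4': "\<forall>z\<in>\<Xi>. \<exists>y\<in>linear_decision_rules. \<forall>\<zeta>\<in>lp_ball p z e \<inter> \<Xi>. h \<zeta> \<le> T *v xb + W *v y \<zeta>"
    using A4 by blast
  have xb: "\<exists>y\<in>linear_decision_rules. \<forall>\<zeta>\<in>lp_ball p z e. g0 \<le> G *v \<zeta> \<longrightarrow> S.rhs xb \<zeta> \<le> W *v y \<zeta>"
    if "g0 \<le> G *v z" for z
    using bspec[OF A4', of z] that unfolding S.rhs_le_iff by (auto simp: Xi' h)
  have bdd: "bounded {x \<in> S.feasible_decisions. S.expected_cost x \<le> S.expected_cost x0}"
    using A3(2) unfolding V_def[symmetric] opt_set .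
  have limit: "(INF x. stochastic_cost M \<xi> c q T W h x) = ereal (S.expected_cost x0)"
    using V_x0 V_x0' unfolding V_def by simp
  have opt_iff: "a \<in> optimal_decisions (stochastic_cost M \<xi> c q T W h)
      \<longleftrightarrow> a \<in> S.feasible_decisions \<and> S.expected_cost a \<le> S.expected_cost x0" for a
    using opt_set unfolding V_def by auto
  have U_eq: "U = (\<lambda>N \<omega> i. lp_ball p (\<xi>s i \<omega>) (\<epsilon> N) \<inter> {\<zeta>. g0 \<le> G *v \<zeta>})"
    unfolding U Xi' ..
  have convergence: "AE \<omega> in M. (\<lambda>N. INF x. C N (U N \<omega>) x) \<longlonglongrightarrow> ereal (S.expected_cost x0) \<and>
    (\<forall>xh. (\<forall>\<^sub>F N in sequentially. xh N \<in> optimal_decisions (C N (U N \<omega>))) \<longrightarrow>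
      (\<forall>a. accumulation_point xh a \<longrightarrow> a \<in> S.feasible_decisions \<and> S.expected_cost a \<le> S.expected_cost x0))"
    if "C = sample_robust_cost c q T W h \<or> C = multi_policy_cost Pol c q T W h" for C
    unfolding U_eq
    by (rule S.AE_convergence[OF p e])
      (erule xb | erule eps_nonneg | erule opt | rule A1(2) x0_feas bdd that[unfolded h A1(1)])+
  note SRO = convergence[OF disjI1[OF refl]] and MP = convergence[OF disjI2[OF refl]]
  show ?thesis
    unfolding limit opt_iff
  proof (intro conjI)
    show "AE \<omega> in M.
        (\<lambda>N. INF x. sample_robust_cost c q T W h N (U N \<omega>) x) \<longlonglongrightarrow> ereal (S.expected_cost x0) \<and>
        (\<lambda>N. INF x. multi_policy_cost Pol c q T W h N (U N \<omega>) x) \<longlonglongrightarrow> ereal (S.expected_cost x0)"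
      using SRO MP by eventually_elim (rule conjI, erule conjunct1, erule conjunct1)
  qed (rule eventually_mono[OF SRO], erule conjunct2, rule eventually_mono[OF MP], erule conjunct2)
qed

end
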